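(* Assume $\mu_*<1$. Let $f$ be a function on $\Omega_+$ depending only on $\zeta_0,\dots,\zeta_{m-1}$ ($m\ge1$) with $\langle f\rangle_\wp=0$, and let $S_n(\widehat\zeta\mid f)=\sum_{t=0}^{n-1}f(S^t\widehat\zeta)$. Then the series $$\sigma_f^2=\langle f^2\rangle_\wp+2\sum_{t=1}^\infty\langle f\cdot f\circ S^t\rangle_\wp$$ converges absolutely, $\sigma_f^2\ge0$, and the variance of $S_n(\cdot\mid f)/\sqrt n$ under $\wp$ converges to $\sigma_f^2$ as $n\to\infty$. Moreover, if $\sigma_f^2>0$, the distribution of $S_n(\cdot\mid f)/\sqrt n$ under $\wp$ converges weakly to the centered Gaussian distribution with variance $\sigma_f^2$.
   Context: Model. Fix $d\ge1$. $(X_t,\xi_t)_{t\in\mathbb{Z}_+}$ is a Markov chain with $X_t\in\mathbb{Z}^d$, $X_0=0$, $\xi_t\in\Omega:=\{-1,+1\}^{\mathbb{Z}^d}$. Given $X_t=x,\xi_t=\bar\xi$, the next position and the next environment are conditionally independent; $P(X_{t+1}=x+u\mid X_t=x,\xi_t=\bar\xi)=P_0(u)+\epsilon c(u)\bar\xi(x)$, where $\epsilon>0$, $P_0$ is an even, finite-range probability distribution on $\mathbb{Z}^d$ with $|\sum_u P_0(u)e^{i(\lambda,u)}|=1$ iff $\lambda=0$ and such that $1/\tilde p_0(\lambda)$ (with $\tilde p_0(\lambda)=\sum_u P_0(u)e^{i(\lambda,u)}$) has absolutely summable Fourier coefficients, and $c$ is an odd finite-range real function with $P_0(u)\pm\epsilon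 c(u)\in[0,1)$. Given $X_t=x,\xi_t=\bar\xi$, the values $\xi_{t+1}(y)$, $y\in\mathbb{Z}^d$, are independent with $P(\xi_{t+1}(y)=s)=Q_0(\bar\xi(y),s)$ if $y\ne x$ and $Q_1(\bar\xi(y),s)$ if $y=x$, where $Q_0,Q_1$ are symmetric $2\times2$ stochastic matrices, $Q_0$ has eigenvalues $1,\mu$ with $0<|\mu|<1$, and $Q_1-Q_0=O(\epsilon)$. The environment seen from the walk, $\eta_t(x)=\xi_t(X_t+x)$, is a Markov chain on $\Omega$ with stochastic operator $(\mathcal T f)(\bar\eta)=\mathcal E[f(\eta_{t+1})\mid\eta_t=\bar\eta]$. $\Pi_0$ is the product of uniform measures on $\{\pm1\}$. For finite $\Gamma\subset\mathbb{Z}^d$ let $\Phi_\Gamma(\eta)=\prod_{x\in\Gamma}\eta(x)$, $\Phi_\emptyset=1$; each $f\in L^2(\Omega,\Pi_0)$ is written $f=\sum_\Gamma f_\Gamma\Phi_\Gamma$. For a fixed $M>1$, $\mathcal H_M=\{f:\|f\|_M:=\sum_\Gamma|f_\Gamma|M^{|\Gamma|}<\infty\}$. Standing assumptions (valid for $\epsilon,|\mu|$ small): $\mathcal T$ maps $\mathcal H_M$ into itself; the chain $(\eta_t)$ has an invariant probability measure $\Pi$, absolutely continuous w.r.t. $\Pi_0$ with bounded density; there is $\bar\mu\in(0,1)$ with $\|\mathcal T f\|_M\le\bar\mu\|f\|_M$ for all $f\in\widehat{\mathcal H}_M:=\{f\in\mathcal H_M:\int f\,d\Pi=0\}$. The dynamics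 and $\Pi$ are invariant under the global spin flip $\eta\mapsto-\eta$. Path space notation: $\mathcal P_\Pi$ is the law of $(\eta_t)_{t\ge0}$ with $\eta_0\sim\Pi$ (stationary under time shift). $\zeta_t:=\eta_t(0)$, $\widehat\zeta=(\zeta_t)_{t\ge0}\in\Omega_+:=\{\pm1\}^{\mathbb{Z}_+}$; $\wp$ is the law of $\widehat\zeta$ under $\mathcal P_\Pi$, $\langle\cdot\rangle_\wp$ its expectation; $S$ is the time shift $S\widehat\zeta=(\zeta_1,\zeta_2,\dots)$. $\mu_*:=M\sqrt{\bar\mu(1+2\bar\mu)}$. *)

theory Defs
  imports "HOL-Probability.Probability"
begin

text \<open>Sites are elements of int^'d (Z^d, d = CARD('d)); spins are the reals -1, +1.
  An environment is a function from sites to spins.\<close>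

definition OmegaM :: "(int^'d \<Rightarrow> real) measure" where
  "OmegaM = PiM UNIV (\<lambda>_. count_space {-1, 1})"

definition Pi0 :: "(int^'d \<Rightarrow> real) measure" where
  "Pi0 = PiM UNIV (\<lambda>_. uniform_count_measure {-1, 1})"

definition Phi :: "(int^'d) set \<Rightarrow> (int^'d \<Rightarrow> real) \<Rightarrow> real" where
  "Phi \<Gamma> \<eta> = (\<Prod>x\<in>\<Gamma>. \<eta> x)"

definition coef :: "((int^'d \<Rightarrow> real) \<Rightarrow> real) \<Rightarrow> (int^'d) set \<Rightarrow> real" where
  "coef f \<Gamma> = (\<integral>\<eta>. f \<eta> * Phi \<Gamma> \<eta> \<partial>Pi0)"

definition normM :: "real \<Rightarrow> ((int^'d \<Rightarrow> real) \<Rightarrow> real) \<Rightarrow> real" where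
  "normM M f = (\<Sum>\<^sub>\<infinity>\<Gamma>\<in>{\<Gamma>. finite \<Gamma>}. \<bar>coef f \<Gamma>\<bar> * M ^ card \<Gamma>)"

text \<open>H_M; an element is represented by its canonical (everywhere convergent)
  Walsh expansion, so that the transition operator acts on it unambiguously.\<close>
definition HM :: "real \<Rightarrow> ((int^'d \<Rightarrow> real) \<Rightarrow> real) \<Rightarrow> bool" where
  "HM M f \<longleftrightarrow> f \<in> borel_measurable OmegaM
     \<and> integrable Pi0 (\<lambda>\<eta>. (f \<eta>)\<^sup>2)
     \<and> (\<lambda>\<Gamma>. \<bar>coef f \<Gamma>\<bar> * M ^ card \<Gamma>) summable_on {\<Gamma>. finite \<Gamma>}
     \<and> (\<forall>\<eta>\<in>space OmegaM. f \<eta> = (\<Sum>\<^sub>\<infinity>\<Gamma>\<in>{\<Gamma>. finite \<Gamma>}. coef f \<Gamma> * Phi \<Gamma> \<eta>))"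

definition inner_zd :: "real^'d \<Rightarrow> int^'d \<Rightarrow> real" where
  "inner_zd lam u = (\<Sum>j\<in>UNIV. lam$j * real_of_int (u$j))"

definition ptilde0 :: "(int^'d \<Rightarrow> real) \<Rightarrow> real^'d \<Rightarrow> complex" where
  "ptilde0 P0 lam = (\<Sum>u\<in>{u. P0 u \<noteq> 0}. complex_of_real (P0 u) * cis (inner_zd lam u))"

definition stoch_sym :: "(real \<Rightarrow> real \<Rightarrow> real) \<Rightarrow> bool" where
  "stoch_sym Q \<longleftrightarrow> (\<forall>s\<in>{-1,1}. \<forall>s'\<in>{-1,1}. Q s s' \<ge> 0 \<and> Q s s' = Q s' s)
     \<and> (\<forall>s\<in>{-1,1}. Q s (-1) + Q s 1 = 1)"

definition has_eigenvalue2 :: "(real \<Rightarrow> real \<Rightarrow> real) \<Rightarrow> real \<Rightarrow> bool" where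
  "has_eigenvalue2 Q \<mu> \<longleftrightarrow> (\<exists>v :: real \<Rightarrow> real. (v (-1) \<noteq> 0 \<or> v 1 \<noteq> 0) \<and>
      (\<forall>s\<in>{-1,1}. Q s (-1) * v (-1) + Q s 1 * v 1 = \<mu> * v s))"

definition Qmeas :: "(real \<Rightarrow> real \<Rightarrow> real) \<Rightarrow> real \<Rightarrow> real measure" where
  "Qmeas Q s = point_measure {-1, 1} (\<lambda>s'. ennreal (Q s s'))"

definition step_support :: "(int^'d \<Rightarrow> real) \<Rightarrow> (int^'d \<Rightarrow> real) \<Rightarrow> (int^'d) set" where
  "step_support P0 c = {u. P0 u \<noteq> 0 \<or> c u \<noteq> 0}"

text \<open>Transition kernel of the environment seen from the walk: given eta_t = eta,
  the walk jumps by u with probability P0 u + eps c u eta(0); independently the new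
  spins xi'(y) ~ Q_{[y=0]}(eta(y), .); then eta_{t+1}(x) = xi'(u + x).\<close>
definition Kern :: "real \<Rightarrow> (int^'d \<Rightarrow> real) \<Rightarrow> (int^'d \<Rightarrow> real)
     \<Rightarrow> (real \<Rightarrow> real \<Rightarrow> real) \<Rightarrow> (real \<Rightarrow> real \<Rightarrow> real)
     \<Rightarrow> (int^'d \<Rightarrow> real) \<Rightarrow> (int^'d \<Rightarrow> real) measure" where
  "Kern eps P0 c Q0 Q1 \<eta> = measure_of (space OmegaM) (sets OmegaM)
     (\<lambda>A. \<Sum>u\<in>step_support P0 c. ennreal (P0 u + eps * c u * \<eta> 0) *
        emeasure (PiM UNIV (\<lambda>x. Qmeas (if u + x = 0 then Q1 else Q0) (\<eta> (u + x)))) A)"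

definition Top :: "real \<Rightarrow> (int^'d \<Rightarrow> real) \<Rightarrow> (int^'d \<Rightarrow> real)
     \<Rightarrow> (real \<Rightarrow> real \<Rightarrow> real) \<Rightarrow> (real \<Rightarrow> real \<Rightarrow> real)
     \<Rightarrow> ((int^'d \<Rightarrow> real) \<Rightarrow> real) \<Rightarrow> (int^'d \<Rightarrow> real) \<Rightarrow> real" where
  "Top eps P0 c Q0 Q1 f \<eta> = (\<integral>\<eta>'. f \<eta>' \<partial>Kern eps P0 c Q0 Q1 \<eta>)"

fun chainexp :: "(('a \<Rightarrow> real) \<Rightarrow> 'a \<Rightarrow> real) \<Rightarrow> ('a \<Rightarrow> real) list \<Rightarrow> 'a \<Rightarrow> real" where
  "chainexp T [] = (\<lambda>_. 1)"
| "chainexp T (g # gs) = (\<lambda>\<eta>. g \<eta> * T (chainexp T gs) \<eta>)"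

text \<open>P is the law of the Markov chain (eta_t) with stochastic operator T and eta_0 ~ PiInv:
  all finite-dimensional expectations E[g_0(eta_0) ... g_n(eta_n)] are as prescribed.\<close>
definition is_chain_law :: "(nat \<Rightarrow> int^'d \<Rightarrow> real) measure
     \<Rightarrow> (((int^'d \<Rightarrow> real) \<Rightarrow> real) \<Rightarrow> (int^'d \<Rightarrow> real) \<Rightarrow> real)
     \<Rightarrow> (int^'d \<Rightarrow> real) measure \<Rightarrow> bool" where
  "is_chain_law P T PiInv \<longleftrightarrow> prob_space P \<and> sets P = sets (PiM UNIV (\<lambda>_::nat. OmegaM)) \<and>
     (\<forall>gs. (\<forall>g\<in>set gs. g \<in> borel_measurable OmegaM \<and> (\<exists>B. \<forall>\<eta>. \<bar>g \<eta>\<bar> \<le> B)) \<longrightarrow>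
        (\<integral>\<omega>. (\<Prod>i<length gs. (gs ! i) (\<omega> i)) \<partial>P) = (\<integral>\<eta>. chainexp T gs \<eta> \<partial>PiInv))"

definition OmegaPlus :: "(nat \<Rightarrow> real) measure" where
  "OmegaPlus = PiM UNIV (\<lambda>_. count_space {-1, 1})"

definition zeta_law :: "(nat \<Rightarrow> int^'d \<Rightarrow> real) measure \<Rightarrow> (nat \<Rightarrow> real) measure" where
  "zeta_law P = distr P OmegaPlus (\<lambda>\<omega> t. \<omega> t 0)"

definition shiftn :: "nat \<Rightarrow> (nat \<Rightarrow> real) \<Rightarrow> (nat \<Rightarrow> real)" where
  "shiftn t \<zeta> = (\<lambda>s. \<zeta> (s + t))"

definition Ssum :: "((nat \<Rightarrow> real) \<Rightarrow> real) \<Rightarrow> nat \<Rightarrow> (nat \<Rightarrow> real) \<Rightarrow> real" where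
  "Ssum f n \<zeta> = (\<Sum>t<n. f (shiftn t \<zeta>))"

definition sigma2 :: "(nat \<Rightarrow> real) measure \<Rightarrow> ((nat \<Rightarrow> real) \<Rightarrow> real) \<Rightarrow> real" where
  "sigma2 W f = (\<integral>\<zeta>. (f \<zeta>)\<^sup>2 \<partial>W)
      + 2 * (\<Sum>t. \<integral>\<zeta>. f \<zeta> * f (shiftn (Suc t) \<zeta>) \<partial>W)"

end

theory Submission
  imports Defs
begin

text \<open>The summands are \<open>X\<^sub>t = F (\<zeta>\<^sub>t, \<dots>, \<zeta>\<^bsub>t+m-1\<^esub>)\<close>. Conditioning on the environment at time \<open>t + m - 1\<close> and on the
  last \<open>m\<close> spins turns a function \<open>G\<close> of this window and environment into another one, \<open>window_op G\<close>.
  After \<open>m\<close> steps the window is forgotten, so the contraction of the chain on \<open>\<H>\<^sub>M\<close> solves the Poisson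
  equation \<open>A - window_op A = G\<close> for centered \<open>G\<close>. Solving it for \<open>F\<close> and then for
  \<open>\<sigma>\<^sup>2 / 2 - F\<^sup>2 / 2 - F * window_op A\<close>, which is centered precisely when \<open>\<sigma>\<^sup>2\<close> is the asymptotic variance, gives
  bounded correctors \<open>a\<^sub>t, b\<^sub>t\<close> such that \<open>\<psi>\<^sub>t = E exp (i \<theta> S\<^sub>t) (1 + i \<theta> a\<^sub>t + \<theta>\<^sup>2 b\<^sub>t)\<close> satisfies
  \<open>\<psi>\<^bsub>t+1\<^esub> = (1 - \<theta>\<^sup>2 \<sigma>\<^sup>2 / 2) \<psi>\<^sub>t + O(\<theta>\<^sup>3)\<close>. With \<open>\<theta>\<close> of order \<open>n\<^sup>-\<^sup>1\<^sup>/\<^sup>2\<close>, iterating \<open>n\<close> times yields the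
  characteristic function of the Gaussian, and Levy's continuity theorem applies. The limit of the
  variances follows from the geometric decay of the covariances.\<close>

section \<open>A central limit theorem from correctors\<close>

text \<open>The contraction concerns centered functions of one environment, while a summand reads
  \<open>m\<close> successive spins, which the environment at the end of the window does not
  determine. This is why the pair of window and environment is carried along. The second Poisson
  equation contains \<open>window_op A\<close>, which depends on the environment even though
  \<open>F\<close> does not; hence the equation is solved for families of elements of H_M indexed by
  windows, and not only for functions of spins. The factor 1 + i \<theta> a + \<theta>^2 b imitates
  the leading eigenfunction of the transition operator twisted by exp (i \<theta> x), and 1 -
  \<theta>^2 \<sigma>^2 / 2 imitates its eigenvalue. Working with approximations replaces spectral
  perturbation theory by two Poisson equations: \<open>n\<close> one-step errors of order \<theta>^3
  add up to order n^(-1/2), and inserting or removing the bounded correctors costs O(\<theta>). The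
  transition operator acts on functions defined at every configuration, so Neumann series have to
  converge pointwise as well as in \<open>normM\<close>, and the sum has to be given by its own
  Walsh expansion everywhere.\<close>

lemma LIMSEQ_Cesaro:
  fixes d :: "nat \<Rightarrow> real"
  assumes "d \<longlonglongrightarrow> L"
  shows "(\<lambda>n. (\<Sum>k<n. d k) / real n) \<longlonglongrightarrow> L"
proof (rule LIMSEQ_I)
  fix r :: real assume r: "r > 0"
  obtain N where N: "\<And>k. k \<ge> N \<Longrightarrow> \<bar>d k - L\<bar> < r / 2"
    using LIMSEQ_D[OF assms, of "r/2"] r by (auto simp: real_norm_def)
  define C where "C = (\<Sum>k<N. \<bar>d k - L\<bar>)"
  \<comment> \<open>Beyond \<open>K\<close> the fixed head \<open>C\<close> contributes less than
    \<open>r / 2\<close> to the average.\<close>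
  obtain K :: nat where K: "real K > 2 * C / r" using reals_Archimedean2 by blast
  have "norm ((\<Sum>k<n. d k) / real n - L) < r" if n: "n \<ge> max (Suc N) K" for n
  proof -
    have n0: "real n > 0" "N \<le> n" using n by auto
    have "(\<Sum>k<n. d k) / real n - L = (\<Sum>k<n. d k - L) / real n"
      using n0 by (simp add: sum_subtractf field_simps)
    moreover have "\<bar>\<Sum>k<n. d k - L\<bar> \<le> (\<Sum>k<n. \<bar>d k - L\<bar>)" by (rule sum_abs)
    moreover have "(\<Sum>k<n. \<bar>d k - L\<bar>) = C + (\<Sum>k=N..<n. \<bar>d k - L\<bar>)"
      unfolding C_def using n0 sum.atLeastLessThan_concat[of 0 N n "\<lambda>k. \<bar>d k - L\<bar>"] by (simp add: lessThan_atLeast0)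
    moreover have "(\<Sum>k=N..<n. \<bar>d k - L\<bar>) \<le> (\<Sum>k=N..<n. r / 2)"
      by (rule sum_mono, rule less_imp_le, rule N) simp
    moreover have "\<dots> \<le> real n * (r / 2)" using n0 r by (simp add: mult_right_mono)
    moreover have "C < real n * (r / 2)"
    proof -
      have "2 * C / r < real n" using K n by linarith
      then show ?thesis using r by (simp add: field_simps)
    qed
    ultimately have "\<bar>\<Sum>k<n. d k - L\<bar> < real n * r" by linarith
    then show ?thesis
      using n0 \<open>(\<Sum>k<n. d k) / real n - L = _\<close> by (simp add: abs_divide field_simps)
  qed
  then show "\<exists>no. \<forall>n\<ge>no. norm ((\<Sum>k<n. d k) / real n - L) < r" by blast
qed

text \<open>Adding the term with index \<open>n\<close> raises the second moment of the sum by
  \<open>c 0 + 2 * (\<Sum>j<n. c (Suc j))\<close>. After division by \<open>n\<close> the second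
  moment is therefore a Cesaro mean of a convergent sequence.\<close>

lemma (in prob_space) variance_partial_sums:
  fixes X :: "nat \<Rightarrow> 'a \<Rightarrow> real" and c :: "nat \<Rightarrow> real"
  assumes X: "\<And>t. X t \<in> borel_measurable M" "\<And>t \<omega>. \<omega> \<in> space M \<Longrightarrow> \<bar>X t \<omega>\<bar> \<le> B"
    and c: "\<And>s k. expectation (\<lambda>\<omega>. X s \<omega> * X (s + k) \<omega>) = c k"
    and summable_c: "summable (\<lambda>k. c (Suc k))"
  shows "(\<lambda>n. expectation (\<lambda>\<omega>. ((\<Sum>t<n. X t \<omega>) / sqrt n)\<^sup>2)) \<longlonglongrightarrow> c 0 + 2 * (\<Sum>k. c (Suc k))"
proof -
  have int: "integrable M (\<lambda>\<omega>. X s \<omega> * X t \<omega>)" for s t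
  proof (rule integrable_const_bound[where B="B * B"])
    show "AE \<omega> in M. norm (X s \<omega> * X t \<omega>) \<le> B * B"
    proof (rule AE_I2)
      fix \<omega> assume "\<omega> \<in> space M"
      from X(2)[OF this, of s] X(2)[OF this, of t] show "norm (X s \<omega> * X t \<omega>) \<le> B * B"
        by (auto simp: abs_mult intro!: mult_mono)
    qed
  qed (use X in simp)
  have *: "expectation (\<lambda>\<omega>. (\<Sum>t<n. X t \<omega>)\<^sup>2) = (\<Sum>k<n. c 0 + 2 * (\<Sum>j<k. c (Suc j)))" for n
  proof (induction n)
    case (Suc n)
    have "(\<Sum>t<Suc n. X t \<omega>)\<^sup>2 = (\<Sum>t<n. X t \<omega>)\<^sup>2 + (X n \<omega> * X n \<omega> + 2 * (\<Sum>t<n. X t \<omega> * X n \<omega>))" for \<omega>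
      by (simp add: power2_eq_square algebra_simps sum_distrib_left)
    moreover have "integrable M (\<lambda>\<omega>. (\<Sum>t<n. X t \<omega>)\<^sup>2)"
      unfolding power2_eq_square sum_product by (intro Bochner_Integration.integrable_sum int)
    moreover have "(\<Sum>t<n. expectation (\<lambda>\<omega>. X t \<omega> * X n \<omega>)) = (\<Sum>j<n. c (Suc j))"
    proof -
      have "(\<Sum>t<n. expectation (\<lambda>\<omega>. X t \<omega> * X n \<omega>)) = (\<Sum>t<n. c (n - t))"
      proof (rule sum.cong[OF refl])
        fix t assume "t \<in> {..<n}"
        then show "expectation (\<lambda>\<omega>. X t \<omega> * X n \<omega>) = c (n - t)" using c[of t "n - t"] by simp
      qed
      also have "\<dots> = (\<Sum>j<n. c (Suc j))"
        by (rule sum.reindex_bij_witness[of _ "\<lambda>j. n - Suc j" "\<lambda>t. n - Suc t"]) (auto simp: Suc_diff_Suc)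
      finally show ?thesis .
    qed
    ultimately show ?case using Suc int c[of n 0] by (simp add: Bochner_Integration.integral_sum)
  qed simp
  have "(\<lambda>n. (\<Sum>k<n. c 0 + 2 * (\<Sum>j<k. c (Suc j))) / real n) \<longlonglongrightarrow> c 0 + 2 * (\<Sum>k. c (Suc k))"
    by (intro LIMSEQ_Cesaro tendsto_intros summable_LIMSEQ summable_c)
  then show ?thesis by (simp add: power_divide *)
qed

section \<open>Characteristic functions and second-order correctors\<close>

lemma char_normal_distribution:
  assumes "\<sigma> > 0"
  shows "char (density lborel (normal_density 0 \<sigma>)) t = complex_of_real (exp (- (\<sigma> * t)\<^sup>2 / 2))"
proof -
  interpret N: prob_space std_normal_distribution
    by (rule prob_space_normal_density) simp
  have "distributed std_normal_distribution lborel (\<lambda>x. x) std_normal_density"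
    unfolding distributed_def by (auto simp: distr_id2 measurable_ident_sets)
  from N.normal_density_affine[OF this, of \<sigma> 0] assms
  have "distributed std_normal_distribution lborel (\<lambda>x. \<sigma> * x) (normal_density 0 \<sigma>)" by simp
  then have "density lborel (normal_density 0 \<sigma>) = distr std_normal_distribution lborel (\<lambda>x. \<sigma> * x)"
    by (simp add: distributed_distr_eq_density)
  then have "char (density lborel (normal_density 0 \<sigma>)) t = char std_normal_distribution (\<sigma> * t)"
    unfolding char_def by (simp add: integral_distr ac_simps)
  then show ?thesis by (simp add: char_std_normal_distribution)
qed

text \<open>Here \<open>a - x\<close> and \<open>b - \<sigma>\<^sup>2 / 2 + x\<^sup>2 / 2 + x * (a - x)\<close> play the role of the conditional expectations of
  the next values of the correctors \<open>a\<close> and \<open>b\<close>; they are chosen to cancel the terms of order \<open>\<theta>\<close>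
  and \<open>\<theta>\<^sup>2\<close>.\<close>

lemma quasi_eigenfunction_expansion:
  fixes \<theta> x p q a b s :: real
  assumes "p = a - x" "q = b - s / 2 + x\<^sup>2 / 2 + x * p"
  shows "(1 + \<i> * \<theta> * x - \<theta>\<^sup>2 * x\<^sup>2 / 2) * (1 + \<i> * \<theta> * of_real p + of_real (\<theta>\<^sup>2) * of_real q)
          - (1 - \<theta>\<^sup>2 * s / 2) * (1 + \<i> * \<theta> * of_real a + of_real (\<theta>\<^sup>2) * of_real b)
        = \<i> * of_real (\<theta> ^ 3 * (x * q - x\<^sup>2 * p / 2 + a * s / 2)) + of_real (\<theta> ^ 4 * (b * s / 2 - x\<^sup>2 * q / 2))" 
proof (rule complex_eqI, goal_cases)
  case 1
  \<comment> \<open>Real part, even powers of \<theta>: this relation is the cancellation of the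
    coefficients of \<theta>^2.\<close>
  have "b = q + s / 2 - x\<^sup>2 / 2 - x * p" using assms by simp
  then show ?case
    by (simp only:) (simp, simp add: algebra_simps power2_eq_square power4_eq_xxxx add_divide_distrib diff_divide_distrib)
next
  case 2
  \<comment> \<open>Imaginary part, odd powers of \<theta>: this relation is the cancellation of the
    linear coefficients.\<close>
  have "a = p + x" using assms by simp
  then show ?case
    by (simp only:) (simp, simp add: algebra_simps power2_eq_square power3_eq_cube add_divide_distrib diff_divide_distrib)
qed
text \<open>Replacing the exponential by its quadratic Taylor polynomial costs a cubic remainder,
  and the expansion above leaves only terms in \<theta>^3 and \<theta>^4. The constant is uniform in
  \<open>x\<close>, \<open>a\<close>, \<open>b\<close>, so the estimate can later be integrated over
  the probability space.\<close>

lemma quasi_eigenfunction_error: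
  fixes B \<sigma>2 :: real
  assumes "B \<ge> 0" "\<sigma>2 \<ge> 0"
  shows "\<exists>K\<ge>0. \<forall>\<theta> x a b. \<bar>\<theta>\<bar> \<le> 1 \<longrightarrow> \<bar>x\<bar> \<le> B \<longrightarrow> \<bar>a\<bar> \<le> B \<longrightarrow> \<bar>b\<bar> \<le> B \<longrightarrow>
    cmod (iexp (\<theta> * x) * (1 + \<i> * \<theta> * of_real (a - x) + of_real (\<theta>\<^sup>2) * of_real (b - \<sigma>2 / 2 + x\<^sup>2 / 2 + x * (a - x)))
      - (1 - \<theta>\<^sup>2 * \<sigma>2 / 2) * (1 + \<i> * \<theta> * of_real a + of_real (\<theta>\<^sup>2) * of_real b)) \<le> K * \<bar>\<theta>\<bar> ^ 3"
proof -
  \<comment> \<open>\<open>P\<close> bounds \<open>\<bar>p\<bar>\<close> and \<open>Q\<close> bounds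
    \<open>\<bar>q\<bar>\<close>. The three groups in \<open>K\<close> account for the Taylor
    remainder times the corrector factor, for the cubic term and for the quartic term, the last one
    using \<open>\<bar>\<theta>\<bar> \<le> 1\<close>.\<close>
  define P where "P = 2 * B"
  define Q where "Q = B + \<sigma>2 / 2 + B\<^sup>2 / 2 + B * P"
  define K where "K = B ^ 3 * (1 + P + Q) + (B * Q + B\<^sup>2 * P / 2 + B * \<sigma>2 / 2) + (B * \<sigma>2 / 2 + B\<^sup>2 * Q / 2)"
  have PQ: "P \<ge> 0" "Q \<ge> 0" using assms by (auto simp: P_def Q_def)
  have "K \<ge> 0" using PQ assms by (auto simp: K_def)
  have main: "cmod (iexp (\<theta> * x) * (1 + \<i> * \<theta> * of_real (a - x) + of_real (\<theta>\<^sup>2) * of_real (b - \<sigma>2 / 2 + x\<^sup>2 / 2 + x * (a - x)))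
      - (1 - \<theta>\<^sup>2 * \<sigma>2 / 2) * (1 + \<i> * \<theta> * of_real a + of_real (\<theta>\<^sup>2) * of_real b)) \<le> K * \<bar>\<theta>\<bar> ^ 3"
    if \<theta>: "\<bar>\<theta>\<bar> \<le> 1" and x: "\<bar>x\<bar> \<le> B" and a: "\<bar>a\<bar> \<le> B" and b: "\<bar>b\<bar> \<le> B" for \<theta> x a b :: real
  proof -
    define p where "p = a - x"
    define q where "q = b - \<sigma>2 / 2 + x\<^sup>2 / 2 + x * p"
    define R where "R = iexp (\<theta> * x) - (1 + \<i> * \<theta> * x - \<theta>\<^sup>2 * x\<^sup>2 / 2)"
    have p: "\<bar>p\<bar> \<le> P" using x a by (auto simp: p_def P_def)
    have x2: "x\<^sup>2 \<le> B\<^sup>2" using x by (metis power2_abs abs_ge_zero power_mono)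
    have "\<bar>x * p\<bar> \<le> B * P" unfolding abs_mult using x p assms by (intro mult_mono) auto
    then have q: "\<bar>q\<bar> \<le> Q" using b x2 assms zero_le_power2[of x] unfolding q_def Q_def by linarith
    have R: "cmod R \<le> \<bar>\<theta>\<bar> ^ 3 * B ^ 3"
    proof -
      have "R = iexp (\<theta> * x) - (\<Sum>k\<le>2. (\<i> * (\<theta> * x)) ^ k / fact k)"
        by (simp add: R_def numeral_2_eq_2 power_mult_distrib field_simps)
      then have "cmod R \<le> \<bar>\<theta> * x\<bar> ^ Suc 2 / fact (Suc 2)" using iexp_approx1[of "\<theta> * x" 2] by simp
      also have "\<dots> \<le> \<bar>\<theta> * x\<bar> ^ Suc 2 / 1" by (rule divide_left_mono) (auto simp: fact_ge_1)
      also have "\<dots> = \<bar>\<theta> * x\<bar> ^ 3" by simp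
      also have "\<dots> \<le> (\<bar>\<theta>\<bar> * B) ^ 3" unfolding abs_mult using x by (intro power_mono mult_mono) auto
      finally show ?thesis by (simp add: power_mult_distrib)
    qed
    have eq: "iexp (\<theta> * x) * (1 + \<i> * \<theta> * of_real p + of_real (\<theta>\<^sup>2) * of_real q)
        - (1 - \<theta>\<^sup>2 * \<sigma>2 / 2) * (1 + \<i> * \<theta> * of_real a + of_real (\<theta>\<^sup>2) * of_real b)
      = R * (1 + \<i> * \<theta> * of_real p + of_real (\<theta>\<^sup>2) * of_real q)
        + \<i> * of_real (\<theta> ^ 3 * (x * q - x\<^sup>2 * p / 2 + a * \<sigma>2 / 2)) + of_real (\<theta> ^ 4 * (b * \<sigma>2 / 2 - x\<^sup>2 * q / 2))"
    proof -
      have "iexp (\<theta> * x) = R + (1 + \<i> * \<theta> * x - \<theta>\<^sup>2 * x\<^sup>2 / 2)" by (simp add: R_def)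
      moreover have "(1 + \<i> * \<theta> * x - \<theta>\<^sup>2 * x\<^sup>2 / 2) * (1 + \<i> * \<theta> * of_real p + of_real (\<theta>\<^sup>2) * of_real q)
          - (1 - \<theta>\<^sup>2 * \<sigma>2 / 2) * (1 + \<i> * \<theta> * of_real a + of_real (\<theta>\<^sup>2) * of_real b)
        = \<i> * of_real (\<theta> ^ 3 * (x * q - x\<^sup>2 * p / 2 + a * \<sigma>2 / 2)) + of_real (\<theta> ^ 4 * (b * \<sigma>2 / 2 - x\<^sup>2 * q / 2))"
        by (rule quasi_eigenfunction_expansion) (simp_all add: p_def q_def)
      moreover have "e * w - v = r * w + u1 + u2" if "e = r + l" "l * w - v = u1 + u2" for e r l w v u1 u2 :: complex
        using that by (simp add: algebra_simps)
      ultimately show ?thesis by blast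
    qed
    have \<theta>': "\<bar>\<theta>\<bar> \<le> 1" "\<theta>\<^sup>2 \<le> 1" using \<theta> by (auto simp: abs_square_le_1)
    have 1: "cmod (R * (1 + \<i> * \<theta> * of_real p + of_real (\<theta>\<^sup>2) * of_real q)) \<le> \<bar>\<theta>\<bar> ^ 3 * (B ^ 3 * (1 + P + Q))"
    proof -
      have "cmod (1 + \<i> * \<theta> * of_real p + of_real (\<theta>\<^sup>2) * of_real q) \<le> 1 + \<bar>\<theta>\<bar> * \<bar>p\<bar> + \<theta>\<^sup>2 * \<bar>q\<bar>"
        by (intro norm_triangle_mono) (simp_all add: norm_mult norm_power)
      also have "\<dots> \<le> 1 + 1 * P + 1 * Q" using p q \<theta>' by (intro add_mono mult_mono) auto
      finally have "cmod (1 + \<i> * \<theta> * of_real p + of_real (\<theta>\<^sup>2) * of_real q) \<le> 1 + P + Q" by simp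
      then have "cmod (R * (1 + \<i> * \<theta> * of_real p + of_real (\<theta>\<^sup>2) * of_real q)) \<le> (\<bar>\<theta>\<bar> ^ 3 * B ^ 3) * (1 + P + Q)"
        unfolding norm_mult using R assms by (intro mult_mono) auto
      then show ?thesis by (simp add: ac_simps)
    qed
    have 2: "cmod (\<i> * of_real (\<theta> ^ 3 * (x * q - x\<^sup>2 * p / 2 + a * \<sigma>2 / 2))) \<le> \<bar>\<theta>\<bar> ^ 3 * (B * Q + B\<^sup>2 * P / 2 + B * \<sigma>2 / 2)"
    proof -
      have "\<bar>x * q\<bar> \<le> B * Q" unfolding abs_mult using x q assms by (intro mult_mono) auto
      moreover have "\<bar>x\<^sup>2 * p\<bar> \<le> B\<^sup>2 * P" unfolding abs_mult using x2 p by (intro mult_mono) auto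
      moreover have "\<bar>a * \<sigma>2\<bar> \<le> B * \<sigma>2" unfolding abs_mult using a assms by (intro mult_mono) auto
      ultimately have "\<bar>x * q - x\<^sup>2 * p / 2 + a * \<sigma>2 / 2\<bar> \<le> B * Q + B\<^sup>2 * P / 2 + B * \<sigma>2 / 2" by linarith
      then show ?thesis by (simp only: norm_mult norm_ii norm_of_real abs_mult power_abs mult_1 mult_left_mono zero_le_power abs_ge_zero)
    qed
    have 3: "cmod (of_real (\<theta> ^ 4 * (b * \<sigma>2 / 2 - x\<^sup>2 * q / 2))) \<le> \<bar>\<theta>\<bar> ^ 3 * (B * \<sigma>2 / 2 + B\<^sup>2 * Q / 2)"
    proof -
      have "\<bar>b * \<sigma>2\<bar> \<le> B * \<sigma>2" unfolding abs_mult using b assms by (intro mult_mono) auto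
      moreover have "\<bar>x\<^sup>2 * q\<bar> \<le> B\<^sup>2 * Q" unfolding abs_mult using x2 q by (intro mult_mono) auto
      ultimately have "\<bar>b * \<sigma>2 / 2 - x\<^sup>2 * q / 2\<bar> \<le> B * \<sigma>2 / 2 + B\<^sup>2 * Q / 2" by linarith
      moreover have "\<bar>\<theta>\<bar> ^ 4 \<le> \<bar>\<theta>\<bar> ^ 3" using \<theta> by (intro power_decreasing) auto
      ultimately show ?thesis
        by (simp only: norm_of_real abs_mult power_abs) (intro mult_mono, auto)
    qed
    have "cmod (iexp (\<theta> * x) * (1 + \<i> * \<theta> * of_real p + of_real (\<theta>\<^sup>2) * of_real q)
        - (1 - \<theta>\<^sup>2 * \<sigma>2 / 2) * (1 + \<i> * \<theta> * of_real a + of_real (\<theta>\<^sup>2) * of_real b)) \<le>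
       \<bar>\<theta>\<bar> ^ 3 * (B ^ 3 * (1 + P + Q)) + \<bar>\<theta>\<bar> ^ 3 * (B * Q + B\<^sup>2 * P / 2 + B * \<sigma>2 / 2)
       + \<bar>\<theta>\<bar> ^ 3 * (B * \<sigma>2 / 2 + B\<^sup>2 * Q / 2)"
      unfolding eq by (intro norm_triangle_mono 1 2 3)
    also have "\<dots> = K * \<bar>\<theta>\<bar> ^ 3" by (simp add: K_def algebra_simps)
    finally show ?thesis unfolding q_def p_def .
  qed
  show ?thesis using \<open>K \<ge> 0\<close> by (intro exI[of _ K] conjI allI impI main)
qed

lemma (in prob_space) norm_integral_le_const:
  fixes f :: "'a \<Rightarrow> 'b :: {banach, second_countable_topology}"
  assumes "integrable M f" "\<And>\<omega>. \<omega> \<in> space M \<Longrightarrow> norm (f \<omega>) \<le> C"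
  shows "norm (\<integral>\<omega>. f \<omega> \<partial>M) \<le> C"
proof -
  have "norm (\<integral>\<omega>. f \<omega> \<partial>M) \<le> (\<integral>\<omega>. norm (f \<omega>) \<partial>M)" by (rule integral_norm_bound)
  also have "\<dots> \<le> (\<integral>\<omega>. C \<partial>M)" using assms by (intro integral_mono) auto
  finally show ?thesis by (simp add: prob_space)
qed

text \<open>The last two hypotheses say that \<open>a\<close> and \<open>b\<close> have the
  predicted conditional expectations, but only tested against bounded functions of the partial sum
  including \<open>X n\<close>. That suffices, because the characteristic function sees the past
  only through this sum, and no filtration has to be introduced.\<close>

theorem (in prob_space) clt_from_correctors:
  fixes X a b :: "nat \<Rightarrow> 'a \<Rightarrow> real" and B \<sigma> :: real
  assumes meas [measurable]: "\<And>t. X t \<in> borel_measurable M" "\<And>t. a t \<in> borel_measurable M" "\<And>t. b t \<in> borel_measurable M"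
    and bound: "\<And>t \<omega>. \<omega> \<in> space M \<Longrightarrow> \<bar>X t \<omega>\<bar> \<le> B" "\<And>t \<omega>. \<omega> \<in> space M \<Longrightarrow> \<bar>a t \<omega>\<bar> \<le> B"
      "\<And>t \<omega>. \<omega> \<in> space M \<Longrightarrow> \<bar>b t \<omega>\<bar> \<le> B"
    and "\<sigma> > 0"
    and a: "\<And>n \<phi>. \<phi> \<in> borel_measurable borel \<Longrightarrow> (\<And>x. \<bar>\<phi> x\<bar> \<le> 1) \<Longrightarrow>
      expectation (\<lambda>\<omega>. \<phi> (\<Sum>t<Suc n. X t \<omega>) * (a (Suc n) \<omega> - (a n \<omega> - X n \<omega>))) = 0"
    and b: "\<And>n \<phi>. \<phi> \<in> borel_measurable borel \<Longrightarrow> (\<And>x. \<bar>\<phi> x\<bar> \<le> 1) \<Longrightarrow>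
      expectation (\<lambda>\<omega>. \<phi> (\<Sum>t<Suc n. X t \<omega>) * (b (Suc n) \<omega> -
        (b n \<omega> - \<sigma>\<^sup>2 / 2 + (X n \<omega>)\<^sup>2 / 2 + X n \<omega> * (a n \<omega> - X n \<omega>)))) = 0"
  shows "weak_conv_m (\<lambda>n. distr M borel (\<lambda>\<omega>. (\<Sum>t<n. X t \<omega>) / sqrt n)) (density lborel (normal_density 0 \<sigma>))"
proof (rule levy_continuity)
  show "real_distribution (distr M borel (\<lambda>\<omega>. (\<Sum>t<n. X t \<omega>) / sqrt n))" for n
    by (rule real_distribution_distr) measurable
  show "real_distribution (density lborel (normal_density 0 \<sigma>))"
    using prob_space_normal_density[OF \<open>\<sigma> > 0\<close>, of 0]
    by (simp add: real_distribution_def real_distribution_axioms_def)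
next
  fix x :: real
  have "B \<ge> 0"
    using not_empty bound(1) by (meson abs_ge_zero all_not_in_conv order_trans)
  then obtain K where K: "K \<ge> 0"
    "\<And>\<theta> x a b. \<bar>\<theta>\<bar> \<le> 1 \<Longrightarrow> \<bar>x\<bar> \<le> B \<Longrightarrow> \<bar>a\<bar> \<le> B \<Longrightarrow> \<bar>b\<bar> \<le> B \<Longrightarrow>
    cmod (iexp (\<theta> * x) * (1 + \<i> * \<theta> * of_real (a - x) + of_real (\<theta>\<^sup>2) * of_real (b - \<sigma>\<^sup>2 / 2 + x\<^sup>2 / 2 + x * (a - x)))
      - (1 - \<theta>\<^sup>2 * \<sigma>\<^sup>2 / 2) * (1 + \<i> * \<theta> * of_real a + of_real (\<theta>\<^sup>2) * of_real b)) \<le> K * \<bar>\<theta>\<bar> ^ 3"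
    using quasi_eigenfunction_error[of B "\<sigma>\<^sup>2"] by (metis zero_le_power2)
  define S where "S n \<omega> = (\<Sum>t<n. X t \<omega>)" for n \<omega>
  have [measurable]: "S n \<in> borel_measurable M" for n unfolding S_def by measurable
  define A where "A \<theta> n \<omega> = 1 + \<i> * \<theta> * of_real (a n \<omega>) + of_real (\<theta>\<^sup>2) * of_real (b n \<omega>)" for \<theta> :: real and n \<omega>
  have [measurable]: "A \<theta> n \<in> borel_measurable M" for \<theta> n unfolding A_def by measurable
  define \<psi> where "\<psi> \<theta> n = (CLINT \<omega>|M. iexp (\<theta> * S n \<omega>) * A \<theta> n \<omega>)" for \<theta> :: real and n

  have A1: "cmod (A \<theta> n \<omega> - 1) \<le> 2 * B * \<bar>\<theta>\<bar>" if "\<bar>\<theta>\<bar> \<le> 1" "\<omega> \<in> space M" for \<theta> n \<omega>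
  proof -
    have "cmod (A \<theta> n \<omega> - 1) \<le> cmod (\<i> * \<theta> * of_real (a n \<omega>)) + cmod (of_real (\<theta>\<^sup>2) * of_real (b n \<omega>))"
      unfolding A_def using norm_triangle_ineq[of "\<i> * \<theta> * of_real (a n \<omega>)" "of_real (\<theta>\<^sup>2) * of_real (b n \<omega>)"] by simp
    also have "\<dots> = \<bar>\<theta>\<bar> * \<bar>a n \<omega>\<bar> + \<bar>\<theta>\<bar> * (\<bar>\<theta>\<bar> * \<bar>b n \<omega>\<bar>)"
      by (simp add: norm_mult power2_eq_square)
    also have "\<dots> \<le> \<bar>\<theta>\<bar> * B + \<bar>\<theta>\<bar> * (1 * B)"
      using bound(2,3)[OF that(2), of n] that(1) by (intro add_mono mult_mono) auto
    finally show ?thesis by (simp add: ac_simps)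
  qed
  have int: "integrable M f" if "f \<in> borel_measurable M" "\<And>\<omega>. \<omega> \<in> space M \<Longrightarrow> cmod (f \<omega>) \<le> C" for f C
    using that by (intro integrable_const_bound[where B=C]) auto
  have iexp1: "cmod (iexp y * z) = cmod z" for y z
    by (simp add: norm_mult)
  have intA: "integrable M (\<lambda>\<omega>. iexp (\<theta> * S n \<omega>) * A \<theta> n \<omega>)" if "\<bar>\<theta>\<bar> \<le> 1" for \<theta> n
  proof (rule int)
    fix \<omega> assume "\<omega> \<in> space M"
    then have "cmod (A \<theta> n \<omega>) \<le> 1 + 2 * B * \<bar>\<theta>\<bar>"
      using A1[OF that, of \<omega> n] norm_triangle_ineq2[of "A \<theta> n \<omega>" 1] by simp
    then show "cmod (iexp (\<theta> * S n \<omega>) * A \<theta> n \<omega>) \<le> 1 + 2 * B * \<bar>\<theta>\<bar>"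
      unfolding iexp1 .
  qed measurable

  \<comment> \<open>The hypotheses speak of real test functions with values in [-1, 1]; cosine and
    sine are two such functions and together give the complex exponential.\<close>
  have martingale: "(CLINT \<omega>|M. iexp (\<theta> * S (Suc n) \<omega>) * of_real (D \<omega>)) = 0"
    if D: "D \<in> borel_measurable M" "\<And>\<omega>. \<omega> \<in> space M \<Longrightarrow> \<bar>D \<omega>\<bar> \<le> C"
      "\<And>\<phi>. \<phi> \<in> borel_measurable borel \<Longrightarrow> (\<And>x. \<bar>\<phi> x\<bar> \<le> 1) \<Longrightarrow> expectation (\<lambda>\<omega>. \<phi> (S (Suc n) \<omega>) * D \<omega>) = 0"
    for \<theta> n D C
  proof -
    have "integrable M (\<lambda>\<omega>. \<phi> (S (Suc n) \<omega>) * D \<omega>)" if "\<phi> \<in> borel_measurable borel" "\<And>x. \<bar>\<phi> x\<bar> \<le> 1" for \<phi> :: "real \<Rightarrow> real"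
    proof (rule integrable_const_bound[where B=C])
      show "AE \<omega> in M. norm (\<phi> (S (Suc n) \<omega>) * D \<omega>) \<le> C"
        using that(2) D(2) by (intro AE_I2) (auto simp: abs_mult intro: order_trans[OF mult_left_le_one_le])
    qed (use that D in measurable)
    from this[of "\<lambda>y. cos (\<theta> * y)"] this[of "\<lambda>y. sin (\<theta> * y)"]
    have i: "integrable M (\<lambda>\<omega>. cos (\<theta> * S (Suc n) \<omega>) * D \<omega>)" "integrable M (\<lambda>\<omega>. sin (\<theta> * S (Suc n) \<omega>) * D \<omega>)" by auto
    have "(CLINT \<omega>|M. iexp (\<theta> * S (Suc n) \<omega>) * of_real (D \<omega>)) =
      (CLINT \<omega>|M. of_real (cos (\<theta> * S (Suc n) \<omega>) * D \<omega>) + \<i> * of_real (sin (\<theta> * S (Suc n) \<omega>) * D \<omega>))"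
      by (intro Bochner_Integration.integral_cong) (auto simp: complex_eq_iff Re_exp Im_exp)
    also have "\<dots> = of_real (expectation (\<lambda>\<omega>. cos (\<theta> * S (Suc n) \<omega>) * D \<omega>)) + \<i> * of_real (expectation (\<lambda>\<omega>. sin (\<theta> * S (Suc n) \<omega>) * D \<omega>))"
      using i by (subst Bochner_Integration.integral_add) (auto simp del: of_real_mult)
    also have "\<dots> = 0"
      using D(3)[of "\<lambda>y. cos (\<theta> * y)"] D(3)[of "\<lambda>y. sin (\<theta> * y)"] by simp
    finally show ?thesis .
  qed

  have step: "cmod (\<psi> \<theta> (Suc n) - (1 - \<theta>\<^sup>2 * \<sigma>\<^sup>2 / 2) * \<psi> \<theta> n) \<le> K * \<bar>\<theta>\<bar> ^ 3" if \<theta>: "\<bar>\<theta>\<bar> \<le> 1" for \<theta> :: real and n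
  proof -
    define p where "p \<omega> = a n \<omega> - X n \<omega>" for \<omega>
    define q where "q \<omega> = b n \<omega> - \<sigma>\<^sup>2 / 2 + (X n \<omega>)\<^sup>2 / 2 + X n \<omega> * (a n \<omega> - X n \<omega>)" for \<omega>
    have [measurable]: "p \<in> borel_measurable M" "q \<in> borel_measurable M" unfolding p_def q_def by measurable
    have p: "\<bar>p \<omega>\<bar> \<le> 2 * B" if "\<omega> \<in> space M" for \<omega>
      using bound[OF that, of n] unfolding p_def by linarith
    have q: "\<bar>q \<omega>\<bar> \<le> B + \<sigma>\<^sup>2 / 2 + B\<^sup>2 / 2 + B * (2 * B)" if "\<omega> \<in> space M" for \<omega>
    proof -
      have "(X n \<omega>)\<^sup>2 \<le> B\<^sup>2" using bound(1)[OF that, of n] by (metis power2_abs abs_ge_zero power_mono)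
      moreover have "\<bar>X n \<omega> * (a n \<omega> - X n \<omega>)\<bar> \<le> B * (2 * B)"
        unfolding abs_mult using p[OF that] bound(1)[OF that, of n] \<open>B \<ge> 0\<close> by (intro mult_mono) (auto simp: p_def)
      ultimately show ?thesis using bound(3)[OF that, of n] zero_le_power2[of "X n \<omega>"] zero_le_power2[of \<sigma>]
        unfolding q_def by linarith
    qed
    have p': "(CLINT \<omega>|M. iexp (\<theta> * S (Suc n) \<omega>) * of_real (a (Suc n) \<omega> - p \<omega>)) = 0"
    proof (rule martingale)
      show "\<bar>a (Suc n) \<omega> - p \<omega>\<bar> \<le> B + 2 * B" if "\<omega> \<in> space M" for \<omega>
        using p[OF that] bound(2)[OF that, of "Suc n"] by linarith
    qed (use a in \<open>auto simp: S_def p_def\<close>)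
    have q': "(CLINT \<omega>|M. iexp (\<theta> * S (Suc n) \<omega>) * of_real (b (Suc n) \<omega> - q \<omega>)) = 0"
    proof (rule martingale)
      show "\<bar>b (Suc n) \<omega> - q \<omega>\<bar> \<le> B + (B + \<sigma>\<^sup>2 / 2 + B\<^sup>2 / 2 + B * (2 * B))" if "\<omega> \<in> space M" for \<omega>
        using q[OF that] bound(3)[OF that, of "Suc n"] by linarith
    qed (use b in \<open>auto simp: S_def q_def\<close>)
    let ?e = "\<lambda>\<omega>. iexp (\<theta> * S (Suc n) \<omega>)"
    have int_pq: "integrable M (\<lambda>\<omega>. ?e \<omega> * of_real (a (Suc n) \<omega> - p \<omega>))" "integrable M (\<lambda>\<omega>. ?e \<omega> * of_real (b (Suc n) \<omega> - q \<omega>))"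
    proof -
      show "integrable M (\<lambda>\<omega>. ?e \<omega> * of_real (a (Suc n) \<omega> - p \<omega>))"
      proof (rule int)
        show "cmod (?e \<omega> * of_real (a (Suc n) \<omega> - p \<omega>)) \<le> B + 2 * B" if "\<omega> \<in> space M" for \<omega>
          unfolding iexp1 norm_of_real using p[OF that] bound(2)[OF that, of "Suc n"] by linarith
      qed measurable
      show "integrable M (\<lambda>\<omega>. ?e \<omega> * of_real (b (Suc n) \<omega> - q \<omega>))"
      proof (rule int)
        show "cmod (?e \<omega> * of_real (b (Suc n) \<omega> - q \<omega>)) \<le> B + (B + \<sigma>\<^sup>2 / 2 + B\<^sup>2 / 2 + B * (2 * B))" if "\<omega> \<in> space M" for \<omega>
          unfolding iexp1 norm_of_real using q[OF that] bound(3)[OF that, of "Suc n"] by linarith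
      qed measurable
    qed
    \<comment> \<open>\<open>?N\<close> is the integrand at time \<open>Suc n\<close> with the new
      correctors replaced by their predictions \<open>p\<close> and \<open>q\<close>. The
      discrepancy \<open>?d\<close> integrates to 0 by \<open>p'\<close> and \<open>q'\<close>, so
      \<open>?N\<close> also represents \<open>\<psi> \<theta> (Suc n)\<close>, and now only
      quantities of time \<open>n\<close> occur beside the exponential.\<close>
    let ?N = "\<lambda>\<omega>. ?e \<omega> * (1 + \<i> * \<theta> * of_real (p \<omega>) + of_real (\<theta>\<^sup>2) * of_real (q \<omega>))"
    let ?d = "\<lambda>\<omega>. \<i> * \<theta> * (?e \<omega> * of_real (a (Suc n) \<omega> - p \<omega>)) + of_real (\<theta>\<^sup>2) * (?e \<omega> * of_real (b (Suc n) \<omega> - q \<omega>))"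
    have N_eq: "?N = (\<lambda>\<omega>. ?e \<omega> * A \<theta> (Suc n) \<omega> - ?d \<omega>)"
      by (auto simp: A_def algebra_simps)
    have int_d: "integrable M ?d" using int_pq by (intro Bochner_Integration.integrable_add integrable_mult_right)
    have int_N: "integrable M ?N"
      unfolding N_eq by (intro Bochner_Integration.integrable_diff intA \<theta> int_d)
    have "(CLINT \<omega>|M. ?d \<omega>) = 0"
      using int_pq p' q' by (subst Bochner_Integration.integral_add) (auto intro!: integrable_mult_right simp del: of_real_diff)
    then have "\<psi> \<theta> (Suc n) = (CLINT \<omega>|M. ?N \<omega>)"
      unfolding N_eq \<psi>_def by (subst Bochner_Integration.integral_diff[OF intA[OF \<theta>] int_d]) simp
    then have "\<psi> \<theta> (Suc n) - (1 - \<theta>\<^sup>2 * \<sigma>\<^sup>2 / 2) * \<psi> \<theta> n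
        = (CLINT \<omega>|M. ?N \<omega> - (1 - \<theta>\<^sup>2 * \<sigma>\<^sup>2 / 2) * (iexp (\<theta> * S n \<omega>) * A \<theta> n \<omega>))"
      using intA[OF \<theta>, of n] int_N by (subst Bochner_Integration.integral_diff) (auto simp: \<psi>_def)
    also have "cmod \<dots> \<le> K * \<bar>\<theta>\<bar> ^ 3"
    proof (rule norm_integral_le_const)
      show "integrable M (\<lambda>\<omega>. ?N \<omega> - (1 - \<theta>\<^sup>2 * \<sigma>\<^sup>2 / 2) * (iexp (\<theta> * S n \<omega>) * A \<theta> n \<omega>))"
        using intA[OF \<theta>, of n] int_N by (intro Bochner_Integration.integrable_diff integrable_mult_right)
      fix \<omega> assume \<omega>: "\<omega> \<in> space M"
      have "?e \<omega> = iexp (\<theta> * S n \<omega>) * iexp (\<theta> * X n \<omega>)"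
        by (simp add: S_def ring_distribs exp_add)
      then have "?N \<omega> - (1 - \<theta>\<^sup>2 * \<sigma>\<^sup>2 / 2) * (iexp (\<theta> * S n \<omega>) * A \<theta> n \<omega>) =
         iexp (\<theta> * S n \<omega>) * (iexp (\<theta> * X n \<omega>) * (1 + \<i> * \<theta> * of_real (p \<omega>) + of_real (\<theta>\<^sup>2) * of_real (q \<omega>))
            - (1 - \<theta>\<^sup>2 * \<sigma>\<^sup>2 / 2) * (1 + \<i> * \<theta> * of_real (a n \<omega>) + of_real (\<theta>\<^sup>2) * of_real (b n \<omega>)))"
        unfolding A_def by (simp only: right_diff_distrib ac_simps)
      then show "cmod (?N \<omega> - (1 - \<theta>\<^sup>2 * \<sigma>\<^sup>2 / 2) * (iexp (\<theta> * S n \<omega>) * A \<theta> n \<omega>)) \<le> K * \<bar>\<theta>\<bar> ^ 3"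
        using K(2)[OF \<theta> bound[OF \<omega>, of n]] unfolding p_def q_def by (simp only: iexp1)
    qed
    finally show ?thesis .
  qed

  \<comment> \<open>The two conditions on \<theta> place the factor
    \<open>1 - \<theta>\<^sup>2 * \<sigma>\<^sup>2 / 2\<close> in [0, 1], so earlier errors are not
    amplified and the one-step errors simply add up.\<close>
  have iter: "cmod (\<psi> \<theta> n - of_real ((1 - \<theta>\<^sup>2 * \<sigma>\<^sup>2 / 2) ^ n) * \<psi> \<theta> 0) \<le> real n * (K * \<bar>\<theta>\<bar> ^ 3)"
    if \<theta>: "\<bar>\<theta>\<bar> \<le> 1" "\<theta>\<^sup>2 * \<sigma>\<^sup>2 / 2 \<le> 1" for \<theta> :: real and n
  proof (induction n)
    case (Suc n)
    let ?l = "1 - \<theta>\<^sup>2 * \<sigma>\<^sup>2 / 2"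
    have "\<psi> \<theta> (Suc n) - of_real (?l ^ Suc n) * \<psi> \<theta> 0 = (\<psi> \<theta> (Suc n) - ?l * \<psi> \<theta> n) + ?l * (\<psi> \<theta> n - of_real (?l ^ n) * \<psi> \<theta> 0)"
      by (simp add: algebra_simps)
    moreover have "cmod (of_real ?l * (\<psi> \<theta> n - of_real (?l ^ n) * \<psi> \<theta> 0)) \<le> 1 * (real n * (K * \<bar>\<theta>\<bar> ^ 3))"
      unfolding norm_mult norm_of_real
    proof (rule mult_mono)
      show "\<bar>?l\<bar> \<le> 1" using \<theta> zero_le_power2[of "\<theta> * \<sigma>"] by (simp add: abs_le_iff power_mult_distrib)
    qed (use Suc in auto)
    ultimately have "cmod (\<psi> \<theta> (Suc n) - of_real (?l ^ Suc n) * \<psi> \<theta> 0) \<le> K * \<bar>\<theta>\<bar> ^ 3 + real n * (K * \<bar>\<theta>\<bar> ^ 3)"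
      using step[OF \<theta>(1), of n] norm_triangle_mono by (metis (no_types, lifting) mult_1)
    then show ?case by (simp add: ring_distribs)
  qed simp

  have \<psi>_char: "cmod (\<psi> \<theta> n - (CLINT \<omega>|M. iexp (\<theta> * S n \<omega>))) \<le> 2 * B * \<bar>\<theta>\<bar>" if \<theta>: "\<bar>\<theta>\<bar> \<le> 1" for \<theta> n
  proof -
    have i: "integrable M (\<lambda>\<omega>. iexp (\<theta> * S n \<omega>))"
      by (rule int[of _ 1]) auto
    have "\<psi> \<theta> n - (CLINT \<omega>|M. iexp (\<theta> * S n \<omega>)) = (CLINT \<omega>|M. iexp (\<theta> * S n \<omega>) * A \<theta> n \<omega> - iexp (\<theta> * S n \<omega>))"
      unfolding \<psi>_def by (rule Bochner_Integration.integral_diff[symmetric, OF intA[OF \<theta>] i])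
    also have "cmod \<dots> \<le> 2 * B * \<bar>\<theta>\<bar>"
    proof (rule norm_integral_le_const)
      fix \<omega> assume \<omega>: "\<omega> \<in> space M"
      have "iexp (\<theta> * S n \<omega>) * A \<theta> n \<omega> - iexp (\<theta> * S n \<omega>) = iexp (\<theta> * S n \<omega>) * (A \<theta> n \<omega> - 1)"
        by (simp add: ring_distribs)
      then show "cmod (iexp (\<theta> * S n \<omega>) * A \<theta> n \<omega> - iexp (\<theta> * S n \<omega>)) \<le> 2 * B * \<bar>\<theta>\<bar>"
        using A1[OF \<theta> \<omega>, of n] by (simp only: iexp1)
    qed (use intA[OF \<theta>] i in auto)
    finally show ?thesis .
  qed

  define \<theta> where "\<theta> n = x / sqrt (real n)" for n
  have sqrt_inf: "filterlim (\<lambda>n. sqrt (real n)) at_top sequentially"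
    by (intro filterlim_compose[OF sqrt_at_top] filterlim_real_sequentially)
  have \<theta>0: "\<theta> \<longlonglongrightarrow> 0" unfolding \<theta>_def by (rule real_tendsto_divide_at_top[OF tendsto_const sqrt_inf])
  have "(\<lambda>n. (CLINT \<omega>|M. iexp (\<theta> n * S n \<omega>)) - of_real ((1 - (\<theta> n)\<^sup>2 * \<sigma>\<^sup>2 / 2) ^ n)) \<longlonglongrightarrow> 0"
  proof (rule Lim_null_comparison)
    have "eventually (\<lambda>n. \<bar>\<theta> n\<bar> < 1) sequentially"
      using tendsto_rabs_zero[OF \<theta>0] by (rule order_tendstoD) simp
    moreover have "(\<lambda>n. (\<theta> n)\<^sup>2 * \<sigma>\<^sup>2 / 2) \<longlonglongrightarrow> 0\<^sup>2 * \<sigma>\<^sup>2 / 2" by (intro tendsto_intros \<theta>0) simp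
    then have "eventually (\<lambda>n. (\<theta> n)\<^sup>2 * \<sigma>\<^sup>2 / 2 < 1) sequentially" by (rule order_tendstoD) simp
    \<comment> \<open>The corrector factor is removed at time \<open>n\<close> and again at time 0,
      each for \<open>2 * B * \<bar>\<theta> n\<bar>\<close>; the rest comes from the
      iteration.\<close>
    ultimately show "eventually (\<lambda>n. norm ((CLINT \<omega>|M. iexp (\<theta> n * S n \<omega>)) - of_real ((1 - (\<theta> n)\<^sup>2 * \<sigma>\<^sup>2 / 2) ^ n))
      \<le> 4 * B * \<bar>\<theta> n\<bar> + real n * (K * \<bar>\<theta> n\<bar> ^ 3)) sequentially"
    proof eventually_elim
      case (elim n)
      let ?l = "1 - (\<theta> n)\<^sup>2 * \<sigma>\<^sup>2 / 2" and ?c = "CLINT \<omega>|M. iexp (\<theta> n * S n \<omega>)"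
      have \<theta>: "\<bar>\<theta> n\<bar> \<le> 1" "(\<theta> n)\<^sup>2 * \<sigma>\<^sup>2 / 2 \<le> 1" using elim by auto
      have "cmod (\<psi> (\<theta> n) 0 - 1) \<le> 2 * B * \<bar>\<theta> n\<bar>" using \<psi>_char[OF \<theta>(1), of 0] by (simp add: S_def prob_space)
      moreover have "cmod (of_real (?l ^ n)) \<le> 1"
        unfolding norm_of_real power_abs using \<theta> zero_le_power2[of "\<theta> n * \<sigma>"]
        by (intro power_le_one) (auto simp: abs_le_iff power_mult_distrib)
      ultimately have "cmod (of_real (?l ^ n) * (\<psi> (\<theta> n) 0 - 1)) \<le> 1 * (2 * B * \<bar>\<theta> n\<bar>)"
        unfolding norm_mult by (intro mult_mono) auto
      moreover have "cmod (?c - \<psi> (\<theta> n) n) \<le> 2 * B * \<bar>\<theta> n\<bar>" using \<psi>_char[OF \<theta>(1), of n] by (simp add: norm_minus_commute)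
      moreover have "?c - of_real (?l ^ n) = (?c - \<psi> (\<theta> n) n) + (\<psi> (\<theta> n) n - of_real (?l ^ n) * \<psi> (\<theta> n) 0) + of_real (?l ^ n) * (\<psi> (\<theta> n) 0 - 1)"
        by (simp add: ring_distribs)
      ultimately have "cmod (?c - of_real (?l ^ n)) \<le> 2 * B * \<bar>\<theta> n\<bar> + real n * (K * \<bar>\<theta> n\<bar> ^ 3) + 1 * (2 * B * \<bar>\<theta> n\<bar>)"
        using iter[OF \<theta>, of n] by (simp only: norm_triangle_mono of_real_power)
      then show ?case by simp
    qed
    \<comment> \<open>On the scale n^(-1/2) the accumulated cubic errors are still of order
      \<theta>. The case \<open>n = 0\<close> holds because division by zero makes
      \<open>\<theta> 0\<close> equal to 0.\<close>
    have "real n * \<bar>\<theta> n\<bar> ^ 3 = x\<^sup>2 * \<bar>\<theta> n\<bar>" for n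
    proof -
      have "\<bar>\<theta> n\<bar> ^ 3 = (\<theta> n)\<^sup>2 * \<bar>\<theta> n\<bar>" by (simp add: power3_eq_cube power2_eq_square)
      moreover have "n \<noteq> 0 \<Longrightarrow> real n * (\<theta> n)\<^sup>2 = x\<^sup>2" by (simp add: \<theta>_def power_divide)
      moreover have "n = 0 \<Longrightarrow> \<theta> n = 0" by (simp add: \<theta>_def)
      ultimately show ?thesis by (cases "n = 0") (simp_all flip: mult.assoc)
    qed
    then have "(\<lambda>n. 4 * B * \<bar>\<theta> n\<bar> + real n * (K * \<bar>\<theta> n\<bar> ^ 3)) = (\<lambda>n. 4 * B * \<bar>\<theta> n\<bar> + K * (x\<^sup>2 * \<bar>\<theta> n\<bar>))"
      by (simp add: mult.left_commute)
    moreover have "(\<lambda>n. 4 * B * \<bar>\<theta> n\<bar> + K * (x\<^sup>2 * \<bar>\<theta> n\<bar>)) \<longlonglongrightarrow> 4 * B * 0 + K * (x\<^sup>2 * 0)"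
      by (intro tendsto_intros tendsto_rabs_zero \<theta>0)
    ultimately show "(\<lambda>n. 4 * B * \<bar>\<theta> n\<bar> + real n * (K * \<bar>\<theta> n\<bar> ^ 3)) \<longlonglongrightarrow> 0" by simp
  qed
  moreover have "(\<lambda>n. (1 - (\<theta> n)\<^sup>2 * \<sigma>\<^sup>2 / 2) ^ n) \<longlonglongrightarrow> exp (- (\<sigma> * x)\<^sup>2 / 2)"
  proof -
    have "(\<lambda>n. (1 + (- (\<sigma> * x)\<^sup>2 / 2) / real n) ^ n) \<longlonglongrightarrow> exp (- (\<sigma> * x)\<^sup>2 / 2)"
      by (rule tendsto_exp_limit_sequentially)
    then show ?thesis
      by (simp add: \<theta>_def power_divide power_mult_distrib ac_simps)
  qed
  ultimately have "(\<lambda>n. (CLINT \<omega>|M. iexp (\<theta> n * S n \<omega>))) \<longlonglongrightarrow> 0 + of_real (exp (- (\<sigma> * x)\<^sup>2 / 2))"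
    using tendsto_add[OF _ tendsto_of_real] by fastforce
  moreover have "char (distr M borel (\<lambda>\<omega>. (\<Sum>t<n. X t \<omega>) / sqrt n)) x = (CLINT \<omega>|M. iexp (\<theta> n * S n \<omega>))" for n
    unfolding char_def by (subst integral_distr) (auto simp: \<theta>_def S_def intro!: Bochner_Integration.integral_cong)
  ultimately show "(\<lambda>n. char (distr M borel (\<lambda>\<omega>. (\<Sum>t<n. X t \<omega>) / sqrt n)) x) \<longlonglongrightarrow> char (density lborel (normal_density 0 \<sigma>)) x"
    by (simp add: char_normal_distribution[OF \<open>\<sigma> > 0\<close>])
qed

section \<open>Walsh expansions\<close>

lemma space_OmegaM: "\<eta> \<in> space OmegaM \<longleftrightarrow> (\<forall>x. \<eta> x = -1 \<or> \<eta> x = 1)"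
  by (auto simp: OmegaM_def space_PiM PiE_UNIV_domain)

lemma sets_Pi0 [measurable_cong]: "sets Pi0 = sets OmegaM"
  unfolding Pi0_def OmegaM_def by (intro sets_PiM_cong) (auto simp: sets_uniform_count_measure)

lemma space_Pi0: "space Pi0 = space OmegaM"
  by (rule sets_eq_imp_space_eq) (rule sets_Pi0)

interpretation Pi0: prob_space Pi0
  unfolding Pi0_def by (intro prob_space_PiM prob_space_uniform_count_measure) auto

lemma measurable_spin_count_space [measurable]: "(\<lambda>\<eta>. \<eta> x) \<in> OmegaM \<rightarrow>\<^sub>M count_space {-1, 1}"
  unfolding OmegaM_def by measurable

lemma measurable_spin [measurable]: "(\<lambda>\<eta>. \<eta> x) \<in> borel_measurable OmegaM"
  using measurable_comp[OF measurable_spin_count_space, of "\<lambda>s. s" borel] by (simp add: comp_def)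

lemma measurable_Phi [measurable]: "Phi \<Gamma> \<in> borel_measurable OmegaM"
  unfolding Phi_def by measurable

lemma abs_Phi: "\<eta> \<in> space OmegaM \<Longrightarrow> \<bar>Phi \<Gamma> \<eta>\<bar> = 1"
  unfolding Phi_def abs_prod by (intro prod.neutral) (auto simp: space_OmegaM, metis abs_1 abs_minus_cancel)

text \<open>The product formula for integrals concerns finite index sets, hence the passage to the
  marginal on \<Gamma>. There every factor is the mean of a fair spin.\<close>

lemma integral_Phi: "finite \<Gamma> \<Longrightarrow> \<Gamma> \<noteq> {} \<Longrightarrow> (\<integral>\<eta>. Phi \<Gamma> \<eta> \<partial>Pi0) = 0"
proof -
  assume \<Gamma>: "finite \<Gamma>" "\<Gamma> \<noteq> {}"
  let ?U = "uniform_count_measure {-1, 1 :: real}"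
  interpret product_prob_space "\<lambda>_ :: int ^ 'd. ?U" UNIV
    by (intro product_prob_spaceI prob_space_uniform_count_measure) auto
  have "(\<integral>\<eta>. Phi \<Gamma> \<eta> \<partial>Pi0) = (\<integral>\<eta>. Phi \<Gamma> (restrict \<eta> \<Gamma>) \<partial>Pi0)"
    by (simp add: Phi_def)
  also have "\<dots> = (\<integral>\<eta>. Phi \<Gamma> \<eta> \<partial>distr (PiM UNIV (\<lambda>_. ?U)) (PiM \<Gamma> (\<lambda>_. ?U)) (\<lambda>\<eta>. restrict \<eta> \<Gamma>))"
    unfolding Pi0_def Phi_def
    by (intro integral_distr[symmetric] measurable_restrict_subset borel_measurable_prod
        measurable_compose[OF measurable_component_singleton]) (auto simp: uniform_count_measure_def)
  also have "\<dots> = (\<integral>\<eta>. (\<Prod>x\<in>\<Gamma>. \<eta> x) \<partial>PiM \<Gamma> (\<lambda>_. ?U))"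
    using \<Gamma> by (subst distr_PiM_restrict_finite) (auto simp: Phi_def[abs_def])
  also have "\<dots> = (\<Prod>x\<in>\<Gamma>. \<integral>s. s \<partial>?U)"
  proof (intro product_integral_prod \<Gamma>(1))
    have "prob_space ?U" by (rule prob_space_uniform_count_measure) auto
    then show "integrable ?U (\<lambda>s. s)"
      by (intro finite_measure.integrable_const_bound[where B=1] prob_space.finite_measure AE_I2)
        (auto simp: uniform_count_measure_def space_point_measure)
  qed
  also have "(\<integral>s. s \<partial>?U) = 0"
    by (subst integral_uniform_count_measure) auto
  finally show ?thesis using \<Gamma> by (simp add: power_0_left)
qed

lemma integrable_Pi0_bounded:
  fixes f :: "(int ^ 'd \<Rightarrow> real) \<Rightarrow> real"
  assumes "f \<in> borel_measurable OmegaM" "\<And>\<eta>. \<eta> \<in> space OmegaM \<Longrightarrow> \<bar>f \<eta>\<bar> \<le> B"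
  shows "integrable Pi0 f"
  using assms by (intro Pi0.integrable_const_bound[where B=B] AE_I2) (auto simp: space_Pi0 measurable_cong_sets[OF sets_Pi0 refl])

lemma coef_cong: "(\<And>\<eta>. \<eta> \<in> space OmegaM \<Longrightarrow> f \<eta> = g \<eta>) \<Longrightarrow> coef f \<Gamma> = coef g \<Gamma>"
  unfolding coef_def by (intro Bochner_Integration.integral_cong) (auto simp: space_Pi0)

text \<open>Functions are defined for all real-valued configurations, but membership in H_M sees
  only those with values -1 and 1. This permits rewriting by identities such as
  \<open>\<eta> x * \<eta> x = 1\<close>, which fail elsewhere.\<close>

lemma HM_cong:
  assumes "\<And>\<eta>. \<eta> \<in> space OmegaM \<Longrightarrow> f \<eta> = g \<eta>"
  shows "HM M f \<longleftrightarrow> HM M g"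
proof -
  have "f \<in> borel_measurable OmegaM \<longleftrightarrow> g \<in> borel_measurable OmegaM"
    using assms by (intro measurable_cong)
  moreover have "integrable Pi0 (\<lambda>\<eta>. (f \<eta>)\<^sup>2) \<longleftrightarrow> integrable Pi0 (\<lambda>\<eta>. (g \<eta>)\<^sup>2)"
    using assms by (intro Bochner_Integration.integrable_cong) (auto simp: space_Pi0)
  ultimately show ?thesis
    unfolding HM_def using assms coef_cong[of f g] by simp
qed

text \<open>On spin configurations \<open>Phi\<close> has modulus 1, and the weights
  \<open>M ^ card \<Gamma>\<close> are at least 1. The weighted coefficient norm thus dominates the
  supremum norm as well as each single coefficient.\<close>

lemma HM_D:
  assumes "HM M f" "M \<ge> 1"
  shows HM_measurable: "f \<in> borel_measurable OmegaM"
    and HM_summable: "(\<lambda>\<Gamma>. \<bar>coef f \<Gamma>\<bar> * M ^ card \<Gamma>) summable_on {\<Gamma>. finite \<Gamma>}"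
    and HM_expansion: "\<eta> \<in> space OmegaM \<Longrightarrow> f \<eta> = (\<Sum>\<^sub>\<infinity>\<Gamma>\<in>{\<Gamma>. finite \<Gamma>}. coef f \<Gamma> * Phi \<Gamma> \<eta>)"
    and HM_expansion_summable: "\<eta> \<in> space OmegaM \<Longrightarrow> (\<lambda>\<Gamma>. coef f \<Gamma> * Phi \<Gamma> \<eta>) summable_on {\<Gamma>. finite \<Gamma>}"
    and HM_bound: "\<eta> \<in> space OmegaM \<Longrightarrow> \<bar>f \<eta>\<bar> \<le> normM M f"
    and HM_coef_bound: "finite \<Gamma> \<Longrightarrow> \<bar>coef f \<Gamma>\<bar> * M ^ card \<Gamma> \<le> normM M f"
proof -
  show f: "f \<in> borel_measurable OmegaM" and s: "(\<lambda>\<Gamma>. \<bar>coef f \<Gamma>\<bar> * M ^ card \<Gamma>) summable_on {\<Gamma>. finite \<Gamma>}"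
    using assms by (auto simp: HM_def)
  have le: "\<bar>coef f \<Gamma>\<bar> \<le> \<bar>coef f \<Gamma>\<bar> * M ^ card \<Gamma>" for \<Gamma>
    using assms(2) by (simp add: mult_le_cancel_left1 one_le_power)
  have abs: "(\<lambda>\<Gamma>. \<bar>coef f \<Gamma>\<bar>) summable_on {\<Gamma>. finite \<Gamma>}"
    by (rule summable_on_comparison_test[OF s]) (use le in auto)
  show "finite \<Gamma> \<Longrightarrow> \<bar>coef f \<Gamma>\<bar> * M ^ card \<Gamma> \<le> normM M f"
    using finite_sum_le_infsum[OF s, of "{\<Gamma>}"] assms(2) unfolding normM_def by simp
  assume \<eta>: "\<eta> \<in> space OmegaM"
  then show e: "f \<eta> = (\<Sum>\<^sub>\<infinity>\<Gamma>\<in>{\<Gamma>. finite \<Gamma>}. coef f \<Gamma> * Phi \<Gamma> \<eta>)" using assms by (auto simp: HM_def)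
  have abs': "(\<lambda>\<Gamma>. norm (coef f \<Gamma> * Phi \<Gamma> \<eta>)) summable_on {\<Gamma>. finite \<Gamma>}"
    using abs \<eta> by (simp add: abs_mult abs_Phi)
  then show "(\<lambda>\<Gamma>. coef f \<Gamma> * Phi \<Gamma> \<eta>) summable_on {\<Gamma>. finite \<Gamma>}"
    by (rule Infinite_Sum.abs_summable_summable)
  have "\<bar>f \<eta>\<bar> \<le> (\<Sum>\<^sub>\<infinity>\<Gamma>\<in>{\<Gamma>. finite \<Gamma>}. \<bar>coef f \<Gamma>\<bar>)"
    unfolding e using norm_infsum_bound[OF abs'] \<eta> by (simp add: abs_mult abs_Phi)
  also have "\<dots> \<le> normM M f"
    unfolding normM_def by (intro infsum_mono abs s le)
  finally show "\<bar>f \<eta>\<bar> \<le> normM M f" .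
qed

lemma HM_I:
  assumes "f \<in> borel_measurable OmegaM" "\<And>\<eta>. \<eta> \<in> space OmegaM \<Longrightarrow> \<bar>f \<eta>\<bar> \<le> B"
    and "(\<lambda>\<Gamma>. \<bar>coef f \<Gamma>\<bar> * M ^ card \<Gamma>) summable_on {\<Gamma>. finite \<Gamma>}"
    and "\<And>\<eta>. \<eta> \<in> space OmegaM \<Longrightarrow> f \<eta> = (\<Sum>\<^sub>\<infinity>\<Gamma>\<in>{\<Gamma>. finite \<Gamma>}. coef f \<Gamma> * Phi \<Gamma> \<eta>)"
  shows "HM M f"
proof -
  have "integrable Pi0 (\<lambda>\<eta>. (f \<eta>)\<^sup>2)"
  proof (rule integrable_Pi0_bounded)
    show "\<bar>(f \<eta>)\<^sup>2\<bar> \<le> B\<^sup>2" if "\<eta> \<in> space OmegaM" for \<eta>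
      using power_mono[OF assms(2)[OF that], of 2] by simp
  qed (use assms(1) in measurable)
  with assms show ?thesis by (auto simp: HM_def)
qed

section \<open>Closure properties of H_M\<close>

lemma normM_nonneg: "M \<ge> 0 \<Longrightarrow> normM M f \<ge> 0"
  unfolding normM_def by (intro infsum_nonneg) auto

lemma integrable_coef:
  assumes "HM M f" "M \<ge> 1"
  shows "integrable Pi0 (\<lambda>\<eta>. f \<eta> * Phi \<Gamma> \<eta>)"
  using HM_measurable[OF assms] HM_bound[OF assms]
  by (intro integrable_Pi0_bounded[where B="normM M f"]) (auto simp: abs_mult abs_Phi)

lemma coef_add:
  assumes "HM M f" "HM M g" "M \<ge> 1"
  shows "coef (\<lambda>\<eta>. f \<eta> + g \<eta>) \<Gamma> = coef f \<Gamma> + coef g \<Gamma>"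
  unfolding coef_def distrib_right using assms
  by (intro Bochner_Integration.integral_add integrable_coef)

lemma coef_cmult: "coef (\<lambda>\<eta>. c * f \<eta>) \<Gamma> = c * coef f \<Gamma>"
  unfolding coef_def by (simp add: mult.assoc)

lemma HM_add:
  assumes "HM M f" "HM M g" "M \<ge> 1"
  shows "HM M (\<lambda>\<eta>. f \<eta> + g \<eta>)"
proof (rule HM_I)
  show "(\<lambda>\<eta>. f \<eta> + g \<eta>) \<in> borel_measurable OmegaM"
    using assms HM_measurable by measurable
  show "\<bar>f \<eta> + g \<eta>\<bar> \<le> normM M f + normM M g" if "\<eta> \<in> space OmegaM" for \<eta>
    using HM_bound[OF assms(1,3) that] HM_bound[OF assms(2,3) that] by linarith
  show "(\<lambda>\<Gamma>. \<bar>coef (\<lambda>\<eta>. f \<eta> + g \<eta>) \<Gamma>\<bar> * M ^ card \<Gamma>) summable_on {\<Gamma>. finite \<Gamma>}"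
    using assms(3) unfolding coef_add[OF assms]
    by (intro summable_on_comparison_test[OF summable_on_add[OF HM_summable[OF assms(1,3)] HM_summable[OF assms(2,3)]]])
      (auto simp flip: distrib_right intro!: mult_right_mono)
  show "f \<eta> + g \<eta> = (\<Sum>\<^sub>\<infinity>\<Gamma>\<in>{\<Gamma>. finite \<Gamma>}. coef (\<lambda>\<eta>. f \<eta> + g \<eta>) \<Gamma> * Phi \<Gamma> \<eta>)" if "\<eta> \<in> space OmegaM" for \<eta>
    unfolding coef_add[OF assms] distrib_right
    using assms HM_expansion[of M _ \<eta>] HM_expansion_summable[of M _ \<eta>] that by (simp add: infsum_add)
qed

lemma HM_cmult:
  assumes "HM M f" "M \<ge> 1"
  shows "HM M (\<lambda>\<eta>. c * f \<eta>)"
proof (rule HM_I)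
  show "(\<lambda>\<eta>. c * f \<eta>) \<in> borel_measurable OmegaM"
    using assms HM_measurable by measurable
  show "\<bar>c * f \<eta>\<bar> \<le> \<bar>c\<bar> * normM M f" if "\<eta> \<in> space OmegaM" for \<eta>
    using HM_bound[OF assms that] by (simp add: abs_mult mult_left_mono)
  show "(\<lambda>\<Gamma>. \<bar>coef (\<lambda>\<eta>. c * f \<eta>) \<Gamma>\<bar> * M ^ card \<Gamma>) summable_on {\<Gamma>. finite \<Gamma>}"
    using summable_on_cmult_right[OF HM_summable[OF assms], of "\<bar>c\<bar>"]
    by (simp add: coef_cmult abs_mult ac_simps)
  show "c * f \<eta> = (\<Sum>\<^sub>\<infinity>\<Gamma>\<in>{\<Gamma>. finite \<Gamma>}. coef (\<lambda>\<eta>. c * f \<eta>) \<Gamma> * Phi \<Gamma> \<eta>)" if "\<eta> \<in> space OmegaM" for \<eta>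
    unfolding coef_cmult mult.assoc HM_expansion[OF assms that] by (rule infsum_cmult_right'[symmetric])
qed

lemma coef_const: "finite \<Gamma> \<Longrightarrow> coef (\<lambda>_. c) \<Gamma> = (if \<Gamma> = {} then c else 0)"
  unfolding coef_def using integral_Phi[of \<Gamma>] by (auto simp: Phi_def Pi0.prob_space)

lemma HM_const: "HM M (\<lambda>_. c)"
proof (rule HM_I)
  show "(\<lambda>\<Gamma>. \<bar>coef (\<lambda>_. c) \<Gamma>\<bar> * M ^ card \<Gamma>) summable_on {\<Gamma> :: (int ^ 'd) set. finite \<Gamma>}"
    by (subst summable_on_cong_neutral[where T="{{}}" and g="\<lambda>\<Gamma>. \<bar>coef (\<lambda>_. c) \<Gamma>\<bar> * M ^ card \<Gamma>"])
      (auto simp: coef_const)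
  fix \<eta> :: "int ^ 'd \<Rightarrow> real"
  have "(\<Sum>\<^sub>\<infinity>\<Gamma>\<in>{\<Gamma> :: (int ^ 'd) set. finite \<Gamma>}. coef (\<lambda>_. c) \<Gamma> * Phi \<Gamma> \<eta>) = (\<Sum>\<^sub>\<infinity>\<Gamma>\<in>{{}}. coef (\<lambda>_. c) \<Gamma> * Phi \<Gamma> \<eta>)"
    by (rule infsum_cong_neutral) (auto simp: coef_const)
  then show "c = (\<Sum>\<^sub>\<infinity>\<Gamma>\<in>{\<Gamma> :: (int ^ 'd) set. finite \<Gamma>}. coef (\<lambda>_. c) \<Gamma> * Phi \<Gamma> \<eta>)"
    by (simp add: coef_const) (simp add: Phi_def)
qed auto

lemma HM_sum:
  assumes "\<And>i. i \<in> I \<Longrightarrow> HM M (f i)" "M \<ge> 1"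
  shows "HM M (\<lambda>\<eta>. \<Sum>i\<in>I. f i \<eta>)"
  using assms(1)
proof (induction I rule: infinite_finite_induct)
  case (insert i I)
  then show ?case by (simp, intro HM_add assms(2)) auto
qed (simp_all add: HM_const)

text \<open>Since the square of a spin is 1, multiplication by \<open>\<eta> x\<close> permutes the
  Walsh functions: \<Gamma> becomes its symmetric difference with {x}. This involution,
  \<open>tog\<close>, changes the cardinality by one, so the weighted norm grows at most by the
  factor \<open>M\<close>.\<close>

lemma HM_spin_mult:
  assumes "HM M f" "M \<ge> 1"
  shows "HM M (\<lambda>\<eta>. \<eta> x * f \<eta>)"
proof (rule HM_I)
  define tog where "tog \<Gamma> = (if x \<in> \<Gamma> then \<Gamma> - {x} else insert x \<Gamma>)" for \<Gamma>
  have tog_tog: "tog (tog \<Gamma>) = \<Gamma>" for \<Gamma> by (auto simp: tog_def)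
  have fin_tog: "finite (tog \<Gamma>) \<longleftrightarrow> finite \<Gamma>" for \<Gamma> by (auto simp: tog_def)
  have bij: "bij_betw tog {\<Gamma>. finite \<Gamma>} {\<Gamma>. finite \<Gamma>}"
    by (rule bij_betwI[of _ _ _ tog]) (auto simp: tog_tog fin_tog)
  have Phi_tog: "\<eta> x * Phi \<Gamma> \<eta> = Phi (tog \<Gamma>) \<eta>" if "\<eta> \<in> space OmegaM" "finite \<Gamma>" for \<eta> \<Gamma>
  proof -
    have "\<eta> x * \<eta> x = 1" using that(1) by (auto simp: space_OmegaM dest: spec[of _ x])
    then show ?thesis using that(2) by (auto simp: Phi_def tog_def prod.remove[of \<Gamma> x] simp flip: mult.assoc)
  qed
  have coef_tog: "coef (\<lambda>\<eta>. \<eta> x * f \<eta>) \<Gamma> = coef f (tog \<Gamma>)" if "finite \<Gamma>" for \<Gamma>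
    unfolding coef_def using that
    by (intro Bochner_Integration.integral_cong) (auto simp: space_Pi0 mult.assoc mult.left_commute Phi_tog[symmetric])
  show "(\<lambda>\<eta>. \<eta> x * f \<eta>) \<in> borel_measurable OmegaM"
    using assms HM_measurable by measurable
  show "\<bar>\<eta> x * f \<eta>\<bar> \<le> normM M f" if "\<eta> \<in> space OmegaM" for \<eta>
  proof -
    have "\<bar>\<eta> x\<bar> = 1" using that by (auto simp: space_OmegaM dest: spec[of _ x])
    then show ?thesis using HM_bound[OF assms that] by (simp add: abs_mult)
  qed
  have "(\<lambda>\<Gamma>. M * (\<bar>coef f (tog \<Gamma>)\<bar> * M ^ card (tog \<Gamma>))) summable_on {\<Gamma>. finite \<Gamma>}"
    by (intro summable_on_cmult_right summable_on_reindex_bij_betw[OF bij, THEN iffD2] HM_summable assms)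
  then show "(\<lambda>\<Gamma>. \<bar>coef (\<lambda>\<eta>. \<eta> x * f \<eta>) \<Gamma>\<bar> * M ^ card \<Gamma>) summable_on {\<Gamma>. finite \<Gamma>}"
  proof (rule summable_on_comparison_test)
    fix \<Gamma> :: "(int ^ 'a) set" assume \<Gamma>: "\<Gamma> \<in> {\<Gamma>. finite \<Gamma>}"
    have "card \<Gamma> \<le> Suc (card (tog \<Gamma>))"
      using \<Gamma> by (auto simp: tog_def card_Diff_singleton_if card_insert_if)
    then have "M ^ card \<Gamma> \<le> M * M ^ card (tog \<Gamma>)"
      using power_increasing[of "card \<Gamma>" "Suc (card (tog \<Gamma>))" M] assms(2) by simp
    then have "\<bar>coef f (tog \<Gamma>)\<bar> * M ^ card \<Gamma> \<le> \<bar>coef f (tog \<Gamma>)\<bar> * (M * M ^ card (tog \<Gamma>))"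
      by (rule mult_left_mono) simp
    then show "\<bar>coef (\<lambda>\<eta>. \<eta> x * f \<eta>) \<Gamma>\<bar> * M ^ card \<Gamma> \<le> M * (\<bar>coef f (tog \<Gamma>)\<bar> * M ^ card (tog \<Gamma>))"
      using \<Gamma> by (simp add: coef_tog ac_simps)
  qed (use assms(2) in auto)
  show "\<eta> x * f \<eta> = (\<Sum>\<^sub>\<infinity>\<Gamma>\<in>{\<Gamma>. finite \<Gamma>}. coef (\<lambda>\<eta>. \<eta> x * f \<eta>) \<Gamma> * Phi \<Gamma> \<eta>)" if \<eta>: "\<eta> \<in> space OmegaM" for \<eta>
  proof -
    have "\<eta> x * f \<eta> = (\<Sum>\<^sub>\<infinity>\<Gamma>\<in>{\<Gamma>. finite \<Gamma>}. \<eta> x * (coef f \<Gamma> * Phi \<Gamma> \<eta>))"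
      unfolding HM_expansion[OF assms \<eta>] by (rule infsum_cmult_right'[symmetric])
    also have "\<dots> = (\<Sum>\<^sub>\<infinity>\<Gamma>\<in>{\<Gamma>. finite \<Gamma>}. coef f (tog (tog \<Gamma>)) * Phi (tog \<Gamma>) \<eta>)"
      by (intro infsum_cong) (simp add: tog_tog Phi_tog[OF \<eta>, symmetric])
    also have "\<dots> = (\<Sum>\<^sub>\<infinity>\<Gamma>\<in>{\<Gamma>. finite \<Gamma>}. coef f (tog \<Gamma>) * Phi \<Gamma> \<eta>)"
      by (rule infsum_reindex_bij_betw[OF bij, where f="\<lambda>\<Gamma>. coef f (tog \<Gamma>) * Phi \<Gamma> \<eta>"])
    also have "\<dots> = (\<Sum>\<^sub>\<infinity>\<Gamma>\<in>{\<Gamma>. finite \<Gamma>}. coef (\<lambda>\<eta>. \<eta> x * f \<eta>) \<Gamma> * Phi \<Gamma> \<eta>)"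
      by (intro infsum_cong) (simp add: coef_tog)
    finally show ?thesis .
  qed
qed

lemma suminf_eq_infsum:
  fixes f :: "nat \<Rightarrow> real"
  assumes "summable (\<lambda>n. \<bar>f n\<bar>)"
  shows "(\<Sum>n. f n) = (\<Sum>\<^sub>\<infinity>n. f n)"
  using norm_summable_imp_has_sum[of f "\<Sum>n. f n"] assms
  by (auto intro!: infsumI[symmetric] summable_sums summable_rabs_cancel)

text \<open>Completeness of H_M, in the form used for Neumann series. Coefficients may be taken term
  by term by dominated convergence; absolute summability over all pairs of an index and a finite set
  then allows the two summations in the expansion to be exchanged.\<close>

lemma HM_suminf:
  fixes g :: "nat \<Rightarrow> (int ^ 'd \<Rightarrow> real) \<Rightarrow> real"
  assumes g: "\<And>k. HM M (g k)" and M: "M \<ge> 1" and summable: "summable (\<lambda>k. normM M (g k))"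
  shows "HM M (\<lambda>\<eta>. \<Sum>k. g k \<eta>)"
proof (rule HM_I)
  let ?F = "{\<Gamma> :: (int ^ 'd) set. finite \<Gamma>}"
  have g_le: "\<bar>g k \<eta>\<bar> \<le> normM M (g k)" if "\<eta> \<in> space OmegaM" for k \<eta>
    using HM_bound[OF g M that] .
  have summable_g: "summable (\<lambda>k. \<bar>g k \<eta>\<bar>)" if "\<eta> \<in> space OmegaM" for \<eta>
    by (rule summable_comparison_test'[OF summable]) (use g_le that in auto)
  have meas [measurable]: "g k \<in> borel_measurable OmegaM" for k by (rule HM_measurable[OF g M])
  show "(\<lambda>\<eta>. \<Sum>k. g k \<eta>) \<in> borel_measurable OmegaM" by measurable
  show "\<bar>\<Sum>k. g k \<eta>\<bar> \<le> (\<Sum>k. normM M (g k))" if "\<eta> \<in> space OmegaM" for \<eta>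
    using summable_rabs[OF summable_g[OF that]] suminf_le[OF g_le[OF that] summable_g[OF that] summable] by linarith
  have coef_le: "\<bar>coef (g k) \<Gamma>\<bar> * M ^ card \<Gamma> \<le> normM M (g k)" if "finite \<Gamma>" for k \<Gamma>
    by (rule HM_coef_bound[OF g M that])
  have summable_coef: "summable (\<lambda>k. \<bar>coef (g k) \<Gamma>\<bar>)" if "finite \<Gamma>" for \<Gamma>
  proof (rule summable_comparison_test'[OF summable])
    fix k show "norm \<bar>coef (g k) \<Gamma>\<bar> \<le> normM M (g k)"
      using coef_le[OF that, of k] mult_left_mono[OF one_le_power[OF M, of "card \<Gamma>"], of "\<bar>coef (g k) \<Gamma>\<bar>"] by simp
  qed
  have coef_suminf: "coef (\<lambda>\<eta>. \<Sum>k. g k \<eta>) \<Gamma> = (\<Sum>k. coef (g k) \<Gamma>)" for \<Gamma>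
  proof -
    have "coef (\<lambda>\<eta>. \<Sum>k. g k \<eta>) \<Gamma> = (\<integral>\<eta>. (\<Sum>k. g k \<eta> * Phi \<Gamma> \<eta>) \<partial>Pi0)"
      unfolding coef_def
      by (intro Bochner_Integration.integral_cong)
        (auto simp: space_Pi0 intro!: suminf_mult2 summable_rabs_cancel summable_g)
    also have "\<dots> = (\<Sum>k. coef (g k) \<Gamma>)"
      unfolding coef_def
    proof (rule integral_suminf)
      show "integrable Pi0 (\<lambda>\<eta>. g k \<eta> * Phi \<Gamma> \<eta>)" for k by (rule integrable_coef[OF g M])
      show "AE \<eta> in Pi0. summable (\<lambda>k. norm (g k \<eta> * Phi \<Gamma> \<eta>))"
        by (rule AE_I2) (simp add: space_Pi0 abs_mult abs_Phi summable_g)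
      show "summable (\<lambda>k. \<integral>\<eta>. norm (g k \<eta> * Phi \<Gamma> \<eta>) \<partial>Pi0)"
      proof (rule summable_comparison_test'[OF summable])
        fix k
        have "norm (\<integral>\<eta>. norm (g k \<eta> * Phi \<Gamma> \<eta>) \<partial>Pi0) \<le> normM M (g k)"
          by (rule Pi0.norm_integral_le_const[OF integrable_norm[OF integrable_coef[OF g M]]])
            (use g_le in \<open>auto simp: space_Pi0 abs_mult abs_Phi\<close>)
        then show "norm (\<integral>\<eta>. norm (g k \<eta> * Phi \<Gamma> \<eta>) \<partial>Pi0) \<le> normM M (g k)" .
      qed
    qed
    finally show ?thesis .
  qed
  \<comment> \<open>Summed over \<Gamma> for fixed \<open>k\<close>, this family gives
    \<open>normM M (g k)\<close>, so the hypothesis on the norms makes it summable over pairs. The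
    absolute values of the expansion terms lie below it.\<close>
  let ?c = "\<lambda>(k, \<Gamma>). \<bar>coef (g k) \<Gamma>\<bar> * M ^ card \<Gamma>"
  have S: "?c summable_on (UNIV \<times> ?F)"
  proof (rule summable_on_SigmaI)
    show "((\<lambda>\<Gamma>. ?c (k, \<Gamma>)) has_sum normM M (g k)) ?F" for k
      unfolding normM_def using HM_summable[OF g M, of k] by simp
    show "(\<lambda>k. normM M (g k)) summable_on UNIV"
      using summable normM_nonneg[of M] M by (subst summable_on_UNIV_nonneg_real_iff) auto
  qed (use M in auto)
  then have "(\<lambda>(\<Gamma>, k). \<bar>coef (g k) \<Gamma>\<bar> * M ^ card \<Gamma>) summable_on (?F \<times> UNIV)"
    by (subst (asm) summable_on_swap) (simp add: case_prod_unfold)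
  then have S': "(\<lambda>\<Gamma>. \<Sum>\<^sub>\<infinity>k. \<bar>coef (g k) \<Gamma>\<bar> * M ^ card \<Gamma>) summable_on ?F"
    by (rule summable_on_Sigma_banach)
  show "(\<lambda>\<Gamma>. \<bar>coef (\<lambda>\<eta>. \<Sum>k. g k \<eta>) \<Gamma>\<bar> * M ^ card \<Gamma>) summable_on ?F"
  proof (rule summable_on_comparison_test[OF S'])
    fix \<Gamma> assume "\<Gamma> \<in> ?F"
    then have s: "summable (\<lambda>k. \<bar>coef (g k) \<Gamma>\<bar>)" using summable_coef by simp
    have "\<bar>\<Sum>k. coef (g k) \<Gamma>\<bar> * M ^ card \<Gamma> \<le> (\<Sum>k. \<bar>coef (g k) \<Gamma>\<bar>) * M ^ card \<Gamma>"
      using M by (intro mult_right_mono summable_rabs s) auto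
    also have "\<dots> = (\<Sum>\<^sub>\<infinity>k. \<bar>coef (g k) \<Gamma>\<bar>) * M ^ card \<Gamma>" using s by (subst suminf_eq_infsum) auto
    also have "\<dots> = (\<Sum>\<^sub>\<infinity>k. \<bar>coef (g k) \<Gamma>\<bar> * M ^ card \<Gamma>)" by (rule infsum_cmult_left'[symmetric])
    finally show "\<bar>coef (\<lambda>\<eta>. \<Sum>k. g k \<eta>) \<Gamma>\<bar> * M ^ card \<Gamma> \<le> (\<Sum>\<^sub>\<infinity>k. \<bar>coef (g k) \<Gamma>\<bar> * M ^ card \<Gamma>)"
      by (simp add: coef_suminf)
  qed (use M in auto)
  show "(\<Sum>k. g k \<eta>) = (\<Sum>\<^sub>\<infinity>\<Gamma>\<in>?F. coef (\<lambda>\<eta>. \<Sum>k. g k \<eta>) \<Gamma> * Phi \<Gamma> \<eta>)" if \<eta>: "\<eta> \<in> space OmegaM" for \<eta>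
  proof -
    have "(\<lambda>x. norm (?c x)) = ?c" using M by (auto simp: fun_eq_iff)
    with S have "(\<lambda>x. norm (?c x)) summable_on (UNIV \<times> ?F)" by simp
    then have "(\<lambda>x. norm ((\<lambda>(k, \<Gamma>). coef (g k) \<Gamma> * Phi \<Gamma> \<eta>) x)) summable_on (UNIV \<times> ?F)"
    proof (rule Infinite_Sum.abs_summable_on_comparison_test, clarify)
      fix k and \<Gamma> :: "(int ^ 'd) set"
      show "norm (coef (g k) \<Gamma> * Phi \<Gamma> \<eta>) \<le> norm (\<bar>coef (g k) \<Gamma>\<bar> * M ^ card \<Gamma>)"
        using \<eta> M by (simp add: abs_mult abs_Phi mult_le_cancel_left1 one_le_power)
    qed
    then have sum2: "(\<lambda>(k, \<Gamma>). coef (g k) \<Gamma> * Phi \<Gamma> \<eta>) summable_on (UNIV \<times> ?F)"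
      by (rule Infinite_Sum.abs_summable_summable)
    have "(\<Sum>k. g k \<eta>) = (\<Sum>\<^sub>\<infinity>k. \<Sum>\<^sub>\<infinity>\<Gamma>\<in>?F. coef (g k) \<Gamma> * Phi \<Gamma> \<eta>)"
      by (simp only: suminf_eq_infsum[OF summable_g[OF \<eta>]] HM_expansion[OF g M \<eta>, symmetric])
    also have "\<dots> = (\<Sum>\<^sub>\<infinity>\<Gamma>\<in>?F. \<Sum>\<^sub>\<infinity>k. coef (g k) \<Gamma> * Phi \<Gamma> \<eta>)"
      by (rule infsum_swap_banach[OF sum2])
    also have "\<dots> = (\<Sum>\<^sub>\<infinity>\<Gamma>\<in>?F. coef (\<lambda>\<eta>. \<Sum>k. g k \<eta>) \<Gamma> * Phi \<Gamma> \<eta>)"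
    proof (rule infsum_cong)
      fix \<Gamma> assume "\<Gamma> \<in> ?F"
      then have "(\<Sum>\<^sub>\<infinity>k. coef (g k) \<Gamma>) = coef (\<lambda>\<eta>. \<Sum>k. g k \<eta>) \<Gamma>"
        unfolding coef_suminf by (intro suminf_eq_infsum[symmetric] summable_coef) simp
      then show "(\<Sum>\<^sub>\<infinity>k. coef (g k) \<Gamma> * Phi \<Gamma> \<eta>) = coef (\<lambda>\<eta>. \<Sum>k. g k \<eta>) \<Gamma> * Phi \<Gamma> \<eta>"
        by (simp only: infsum_cmult_left')
    qed
    finally show ?thesis .
  qed
qed

section \<open>The transition operator and its Poisson equation\<close>

text \<open>A spin has two values, so the selection is affine in it: half the sum of
  \<open>g 1\<close> and \<open>g (-1)\<close>, plus the spin times half their difference. It is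
  used when a new spin is read off the environment and written into the window.\<close>

lemma HM_spin_select:
  assumes "\<And>s. HM M (g s)" "M \<ge> 1"
  shows "HM M (\<lambda>\<eta>. g (\<eta> x) \<eta>)"
proof -
  have "HM M (\<lambda>\<eta>. 1 / 2 * (g 1 \<eta> + g (-1) \<eta>) + 1 / 2 * (\<eta> x * (g 1 \<eta> + (-1) * g (-1) \<eta>)))"
    by (intro HM_add HM_cmult HM_spin_mult assms)
  moreover have "g (\<eta> x) \<eta> = 1 / 2 * (g 1 \<eta> + g (-1) \<eta>) + 1 / 2 * (\<eta> x * (g 1 \<eta> + (-1) * g (-1) \<eta>))"
    if "\<eta> \<in> space OmegaM" for \<eta>
  proof -
    from that have "\<eta> x = -1 \<or> \<eta> x = 1" by (simp add: space_OmegaM)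
    then show ?thesis by (auto simp: field_simps)
  qed
  ultimately show ?thesis by (subst HM_cong)
qed

text \<open>The bound is asked for on spin configurations only: even a single coordinate is
  unbounded on the whole function type.\<close>

definition bounded_measurable :: "((int ^ 'd \<Rightarrow> real) \<Rightarrow> real) \<Rightarrow> bool" where
  "bounded_measurable g \<longleftrightarrow> g \<in> borel_measurable OmegaM \<and> (\<exists>B. \<forall>\<eta>\<in>space OmegaM. \<bar>g \<eta>\<bar> \<le> B)"

lemma bounded_measurableI:
  "g \<in> borel_measurable OmegaM \<Longrightarrow> (\<And>\<eta>. \<eta> \<in> space OmegaM \<Longrightarrow> \<bar>g \<eta>\<bar> \<le> B) \<Longrightarrow> bounded_measurable g"
  by (auto simp: bounded_measurable_def)

lemma bounded_measurable_borel: "bounded_measurable g \<Longrightarrow> g \<in> borel_measurable OmegaM"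
  by (simp add: bounded_measurable_def)

lemma bounded_measurableE:
  assumes "bounded_measurable g"
  obtains B where "B \<ge> 0" "\<And>\<eta>. \<eta> \<in> space OmegaM \<Longrightarrow> \<bar>g \<eta>\<bar> \<le> B"
proof -
  from assms obtain B where "\<And>\<eta>. \<eta> \<in> space OmegaM \<Longrightarrow> \<bar>g \<eta>\<bar> \<le> B" by (auto simp: bounded_measurable_def)
  then have "\<And>\<eta>. \<eta> \<in> space OmegaM \<Longrightarrow> \<bar>g \<eta>\<bar> \<le> \<bar>B\<bar>" by (meson abs_ge_self order_trans)
  then show thesis using that[of "\<bar>B\<bar>"] by simp
qed

lemma bounded_measurable_const: "bounded_measurable (\<lambda>_. c)"
  by (rule bounded_measurableI[of _ "\<bar>c\<bar>"]) auto

lemma bounded_measurable_mult: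
  assumes "bounded_measurable f" "bounded_measurable g"
  shows "bounded_measurable (\<lambda>\<eta>. f \<eta> * g \<eta>)"
proof -
  obtain B where "B \<ge> 0" "\<And>\<eta>. \<eta> \<in> space OmegaM \<Longrightarrow> \<bar>f \<eta>\<bar> \<le> B"
    using assms(1) by (rule bounded_measurableE) auto
  moreover obtain C where "C \<ge> 0" "\<And>\<eta>. \<eta> \<in> space OmegaM \<Longrightarrow> \<bar>g \<eta>\<bar> \<le> C"
    using assms(2) by (rule bounded_measurableE) auto
  ultimately show ?thesis
    using assms[THEN bounded_measurable_borel]
    by (intro bounded_measurableI[of _ "B * C"]) (auto simp: abs_mult intro!: mult_mono)
qed

text \<open>The function \<phi> is arbitrary, because a coordinate is measurable into the discrete
  space {-1, 1}.\<close>

lemma bounded_measurable_spin: "bounded_measurable (\<lambda>\<eta>. \<phi> (\<eta> x))"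
proof (rule bounded_measurableI)
  show "(\<lambda>\<eta>. \<phi> (\<eta> x)) \<in> borel_measurable OmegaM"
    by (rule measurable_compose[OF measurable_spin_count_space]) simp
  fix \<eta> :: "int ^ 'a \<Rightarrow> real" assume "\<eta> \<in> space OmegaM"
  then have "\<eta> x = -1 \<or> \<eta> x = 1" by (simp add: space_OmegaM)
  then show "\<bar>\<phi> (\<eta> x)\<bar> \<le> max \<bar>\<phi> (-1)\<bar> \<bar>\<phi> 1\<bar>" by auto
qed

lemma HM_bounded_measurable: "HM M g \<Longrightarrow> M \<ge> 1 \<Longrightarrow> bounded_measurable g"
  by (rule bounded_measurableI[OF HM_measurable HM_bound])

text \<open>The walk and its environment enter the analysis through this interface: a probability
  kernel with an invariant law whose operator preserves H_M and contracts its centered part.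
  Invariance is stated set by set with a Bochner integral, as it is for \<open>PiInv\<close> in the
  final theorem.\<close>

locale spectral_gap_kernel =
  fixes K :: "(int ^ 'd \<Rightarrow> real) \<Rightarrow> (int ^ 'd \<Rightarrow> real) measure"
    and PiInv :: "(int ^ 'd \<Rightarrow> real) measure"
    and M mubar :: real
    and T :: "((int ^ 'd \<Rightarrow> real) \<Rightarrow> real) \<Rightarrow> (int ^ 'd \<Rightarrow> real) \<Rightarrow> real"
  assumes T_eq: "T g \<eta> = (\<integral>\<eta>'. g \<eta>' \<partial>K \<eta>)"
    and prob_space_K: "\<eta> \<in> space OmegaM \<Longrightarrow> prob_space (K \<eta>)"
    and sets_K: "sets (K \<eta>) = sets OmegaM"
    and prob_space_PiInv: "prob_space PiInv"
    and sets_PiInv: "sets PiInv = sets OmegaM"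
    and invariant: "A \<in> sets OmegaM \<Longrightarrow> (\<integral>\<eta>. measure (K \<eta>) A \<partial>PiInv) = measure PiInv A"
    and M_ge: "M \<ge> 1"
    and HM_T: "HM M g \<Longrightarrow> HM M (T g)"
    and mubar: "0 < mubar" "mubar < 1"
    and gap: "HM M g \<Longrightarrow> (\<integral>\<eta>. g \<eta> \<partial>PiInv) = 0 \<Longrightarrow> normM M (T g) \<le> mubar * normM M g"
begin

sublocale PiInv: prob_space PiInv by (rule prob_space_PiInv)

lemma space_PiInv: "space PiInv = space OmegaM"
  by (rule sets_eq_imp_space_eq) (rule sets_PiInv)

lemma space_K: "space (K \<eta>) = space OmegaM"
  by (rule sets_eq_imp_space_eq) (rule sets_K)

lemma T_cong: "(\<And>\<eta>'. \<eta>' \<in> space OmegaM \<Longrightarrow> g \<eta>' = h \<eta>') \<Longrightarrow> T g \<eta> = T h \<eta>"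
  unfolding T_eq by (intro Bochner_Integration.integral_cong) (auto simp: space_K)

lemma integrable_K:
  assumes "bounded_measurable g" "\<eta> \<in> space OmegaM"
  shows "integrable (K \<eta>) g"
proof -
  interpret prob_space "K \<eta>" using assms(2) by (rule prob_space_K)
  from assms(1) obtain B where "\<And>\<eta>. \<eta> \<in> space OmegaM \<Longrightarrow> \<bar>g \<eta>\<bar> \<le> B" by (rule bounded_measurableE) auto
  then show ?thesis
    using bounded_measurable_borel[OF assms(1)]
    by (intro integrable_const_bound[where B=B] AE_I2) (auto simp: space_K measurable_cong_sets[OF sets_K refl])
qed

lemma integrable_PiInv:
  assumes "bounded_measurable g"
  shows "integrable PiInv g"
proof -
  from assms obtain B where "\<And>\<eta>. \<eta> \<in> space OmegaM \<Longrightarrow> \<bar>g \<eta>\<bar> \<le> B" by (rule bounded_measurableE) auto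
  then show ?thesis
    using bounded_measurable_borel[OF assms]
    by (intro PiInv.integrable_const_bound[where B=B] AE_I2) (auto simp: space_PiInv measurable_cong_sets[OF sets_PiInv refl])
qed

lemma T_const: "\<eta> \<in> space OmegaM \<Longrightarrow> T (\<lambda>_. c) \<eta> = c"
  unfolding T_eq using prob_space.prob_space[OF prob_space_K] by simp

lemma T_cmult: "T (\<lambda>\<eta>. c * g \<eta>) \<eta> = c * T g \<eta>"
  unfolding T_eq by simp

lemma T_add:
  assumes "bounded_measurable f" "bounded_measurable g" "\<eta> \<in> space OmegaM"
  shows "T (\<lambda>\<eta>. f \<eta> + g \<eta>) \<eta> = T f \<eta> + T g \<eta>"
  unfolding T_eq using assms by (intro Bochner_Integration.integral_add integrable_K)

lemma T_diff:
  assumes "bounded_measurable f" "bounded_measurable g" "\<eta> \<in> space OmegaM"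
  shows "T (\<lambda>\<eta>. f \<eta> - g \<eta>) \<eta> = T f \<eta> - T g \<eta>"
  unfolding T_eq using assms by (intro Bochner_Integration.integral_diff integrable_K)

lemma T_sum:
  assumes "\<And>i. i \<in> I \<Longrightarrow> bounded_measurable (f i)" "\<eta> \<in> space OmegaM"
  shows "T (\<lambda>\<eta>. \<Sum>i\<in>I. f i \<eta>) \<eta> = (\<Sum>i\<in>I. T (f i) \<eta>)"
  unfolding T_eq using assms by (intro Bochner_Integration.integral_sum integrable_K)

lemma T_bound:
  assumes "bounded_measurable g" "\<eta> \<in> space OmegaM" "\<And>\<eta>. \<eta> \<in> space OmegaM \<Longrightarrow> \<bar>g \<eta>\<bar> \<le> B"
  shows "\<bar>T g \<eta>\<bar> \<le> B"
  unfolding T_eq using prob_space.norm_integral_le_const[OF prob_space_K[OF assms(2)] integrable_K[OF assms(1,2)], of B] assms(3)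
  by (simp add: space_K)

text \<open>A Bochner integral is 0 unless the integrand is measurable, so invariance of the probability
  measure \<^term>\<open>PiInv\<close> already forces the kernel to be measurable.\<close>

lemma measurable_measure_K:
  assumes A: "A \<in> sets OmegaM"
  shows "(\<lambda>\<eta>. measure (K \<eta>) A) \<in> borel_measurable OmegaM"
proof (cases "measure PiInv A = 0")
  case False
  then have "integrable PiInv (\<lambda>\<eta>. measure (K \<eta>) A)"
    using invariant[OF A] not_integrable_integral_eq by metis
  then show ?thesis
    by (simp add: borel_measurable_integrable flip: measurable_cong_sets[OF sets_PiInv refl])
next
  case True
  \<comment> \<open>For a null set the integral is 0 whether or not the integrand is measurable, so
    nothing can be read off. The complement has probability 1, which rules out the default value
    0.\<close>
  let ?A = "space OmegaM - A"
  have "?A \<in> sets OmegaM" using A by auto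
  moreover have "measure PiInv ?A = 1"
    using True PiInv.prob_compl[of A] A by (simp add: sets_PiInv space_PiInv)
  ultimately have "integrable PiInv (\<lambda>\<eta>. measure (K \<eta>) ?A)"
    using invariant[of ?A] not_integrable_integral_eq[of PiInv "\<lambda>\<eta>. measure (K \<eta>) ?A"] by force
  then have *: "(\<lambda>\<eta>. measure (K \<eta>) ?A) \<in> borel_measurable OmegaM"
    by (simp add: borel_measurable_integrable flip: measurable_cong_sets[OF sets_PiInv refl])
  have "measure (K \<eta>) A = 1 - measure (K \<eta>) ?A" if "\<eta> \<in> space OmegaM" for \<eta>
    using prob_space.prob_compl[OF prob_space_K[OF that], of A] A by (simp add: sets_K space_K)
  then show ?thesis
    using * by (subst measurable_cong[where g="\<lambda>\<eta>. 1 - measure (K \<eta>) ?A"]) auto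
qed

lemma measurable_K [measurable]: "K \<in> OmegaM \<rightarrow>\<^sub>M subprob_algebra OmegaM"
proof (rule measurable_subprob_algebra)
  show "subprob_space (K \<eta>)" if "\<eta> \<in> space OmegaM" for \<eta>
    using that by (intro prob_space_imp_subprob_space prob_space_K)
  fix A :: "(int ^ 'd \<Rightarrow> real) set" assume A: "A \<in> sets OmegaM"
  have "emeasure (K \<eta>) A = ennreal (measure (K \<eta>) A)" if "\<eta> \<in> space OmegaM" for \<eta>
    using prob_space_K[OF that] by (simp add: finite_measure.emeasure_eq_measure prob_space.finite_measure)
  then show "(\<lambda>\<eta>. emeasure (K \<eta>) A) \<in> borel_measurable OmegaM"
    using measurable_measure_K[OF A] by (subst measurable_cong[where g="\<lambda>\<eta>. ennreal (measure (K \<eta>) A)"]) auto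
qed (rule sets_K)

lemma bounded_measurable_T:
  assumes "bounded_measurable g"
  shows "bounded_measurable (T g)"
proof -
  from assms obtain B where B: "\<And>\<eta>. \<eta> \<in> space OmegaM \<Longrightarrow> \<bar>g \<eta>\<bar> \<le> B" by (rule bounded_measurableE) auto
  show ?thesis
  proof (rule bounded_measurableI)
    show "T g \<in> borel_measurable OmegaM"
      unfolding T_eq[abs_def]
      by (rule measurable_compose[OF measurable_K integral_measurable_subprob_algebra[OF bounded_measurable_borel[OF assms]]])
  qed (rule T_bound[OF assms _ B])
qed

text \<open>Turns invariance on sets into an identity of measures, from which invariance for bounded
  functions follows by integrating against a bind.\<close>

lemma bind_PiInv_K: "PiInv \<bind> K = PiInv"
proof (rule measure_eqI)
  have K: "K \<in> PiInv \<rightarrow>\<^sub>M subprob_algebra OmegaM" by (simp add: measurable_cong_sets[OF sets_PiInv refl])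
  show sets: "sets (PiInv \<bind> K) = sets PiInv"
    using sets_bind[OF sets_K PiInv.not_empty] by (simp add: sets_PiInv)
  fix A assume "A \<in> sets (PiInv \<bind> K)"
  then have A: "A \<in> sets OmegaM" by (simp add: sets sets_PiInv)
  have "emeasure (PiInv \<bind> K) A = (\<integral>\<^sup>+\<eta>. emeasure (K \<eta>) A \<partial>PiInv)"
    by (rule emeasure_bind[OF PiInv.not_empty K A])
  also have "\<dots> = (\<integral>\<^sup>+\<eta>. ennreal (measure (K \<eta>) A) \<partial>PiInv)"
    using prob_space_K by (intro nn_integral_cong) (simp add: finite_measure.emeasure_eq_measure prob_space.finite_measure space_PiInv)
  also have "\<dots> = ennreal (\<integral>\<eta>. measure (K \<eta>) A \<partial>PiInv)"
    using measurable_measure_K[OF A] prob_space_K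
    by (intro nn_integral_eq_integral PiInv.integrable_const_bound[where B=1] AE_I2)
      (auto simp: space_PiInv prob_space.prob_le_1 measurable_cong_sets[OF sets_PiInv refl])
  also have "\<dots> = emeasure PiInv A"
    by (simp add: invariant[OF A] PiInv.emeasure_eq_measure)
  finally show "emeasure (PiInv \<bind> K) A = emeasure PiInv A" .
qed

lemma integral_T:
  assumes "bounded_measurable g"
  shows "(\<integral>\<eta>. T g \<eta> \<partial>PiInv) = (\<integral>\<eta>. g \<eta> \<partial>PiInv)"
proof -
  from assms obtain B where B: "\<And>\<eta>. \<eta> \<in> space OmegaM \<Longrightarrow> \<bar>g \<eta>\<bar> \<le> B" by (rule bounded_measurableE) auto
  have "(\<integral>\<eta>. g \<eta> \<partial>(PiInv \<bind> K)) = (\<integral>\<eta>. (\<integral>\<eta>'. g \<eta>' \<partial>K \<eta>) \<partial>PiInv)"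
  proof (rule integral_bind[where K=OmegaM and B=B and B'=1])
    show "K \<in> PiInv \<rightarrow>\<^sub>M subprob_algebra OmegaM" by (simp add: measurable_cong_sets[OF sets_PiInv refl])
    show "AE \<eta> in PiInv. emeasure (K \<eta>) (space (K \<eta>)) \<le> ennreal 1"
      using prob_space_K by (intro AE_I2) (simp add: space_PiInv prob_space.emeasure_space_1)
  qed (use B bounded_measurable_borel[OF assms] PiInv.finite_measure_axioms in auto)
  then show ?thesis by (simp add: bind_PiInv_K T_eq)
qed

lemma HM_T_pow: "HM M g \<Longrightarrow> HM M ((T ^^ k) g)"
  by (induction k) (auto intro: HM_T)

lemma integral_T_pow:
  assumes "HM M g"
  shows "(\<integral>\<eta>. (T ^^ k) g \<eta> \<partial>PiInv) = (\<integral>\<eta>. g \<eta> \<partial>PiInv)"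
  by (induction k) (simp_all add: integral_T HM_bounded_measurable[OF HM_T_pow[OF assms] M_ge])

text \<open>By invariance every iterate is again centered, so the contraction applies at each
  step.\<close>

lemma normM_T_pow:
  assumes "HM M g" "(\<integral>\<eta>. g \<eta> \<partial>PiInv) = 0"
  shows "normM M ((T ^^ k) g) \<le> mubar ^ k * normM M g"
proof (induction k)
  case (Suc k)
  have "normM M ((T ^^ Suc k) g) \<le> mubar * normM M ((T ^^ k) g)"
    using gap[OF HM_T_pow[OF assms(1), of k]] assms integral_T_pow[OF assms(1), of k] by simp
  also have "\<dots> \<le> mubar * (mubar ^ k * normM M g)"
    using Suc mubar by (intro mult_left_mono) auto
  finally show ?case by simp
qed simp

text \<open>Subtracting the mean puts the function into the contracted subspace, and
  \<open>T\<close> fixes constants. The norm estimate becomes a pointwise one because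
  \<open>normM\<close> dominates the supremum.\<close>

lemma T_pow_decay:
  assumes g: "HM M g"
  shows "\<exists>C\<ge>0. \<forall>k. \<forall>\<eta>\<in>space OmegaM. \<bar>(T ^^ k) g \<eta> - (\<integral>\<eta>. g \<eta> \<partial>PiInv)\<bar> \<le> C * mubar ^ k"
proof -
  define c where "c = (\<integral>\<eta>. g \<eta> \<partial>PiInv)"
  define h where "h \<eta> = g \<eta> + - c" for \<eta>
  have h: "HM M h" unfolding h_def by (intro HM_add g HM_const M_ge)
  have h0: "(\<integral>\<eta>. h \<eta> \<partial>PiInv) = 0"
    unfolding h_def using integrable_PiInv[OF HM_bounded_measurable[OF g M_ge]]
    by (simp add: c_def PiInv.prob_space)
  have eq: "(T ^^ k) h \<eta> = (T ^^ k) g \<eta> - c" if "\<eta> \<in> space OmegaM" for k \<eta>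
    using that
  proof (induction k arbitrary: \<eta>)
    case (Suc k)
    have "T ((T ^^ k) h) \<eta> = T (\<lambda>\<eta>. (T ^^ k) g \<eta> - c) \<eta>" by (rule T_cong) (rule Suc.IH)
    also have "\<dots> = T ((T ^^ k) g) \<eta> - T (\<lambda>_. c) \<eta>"
      by (rule T_diff[OF HM_bounded_measurable[OF HM_T_pow[OF g] M_ge] bounded_measurable_const Suc.prems])
    finally show ?case by (simp add: T_const[OF Suc.prems])
  qed (simp add: h_def)
  then have "\<bar>(T ^^ k) g \<eta> - c\<bar> \<le> normM M h * mubar ^ k" if "\<eta> \<in> space OmegaM" for k \<eta>
    using order_trans[OF HM_bound[OF HM_T_pow[OF h] M_ge that, of k] normM_T_pow[OF h h0, of k]] eq[OF that]
    by (simp add: mult.commute)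
  moreover have "normM M h \<ge> 0" using M_ge by (intro normM_nonneg) simp
  ultimately show ?thesis unfolding c_def by (intro exI[of _ "normM M h"]) auto
qed

text \<open>The solution is the Neumann series of the iterates of \<open>T\<close>. Its norms decay
  geometrically, so the sum stays in H_M and \<open>T\<close> can be applied term by term; in
  \<open>u - T u\<close> everything but the zeroth term cancels.\<close>

lemma poisson_equation:
  assumes g: "HM M g" "(\<integral>\<eta>. g \<eta> \<partial>PiInv) = 0"
  shows "\<exists>u. HM M u \<and> (\<forall>\<eta>\<in>space OmegaM. u \<eta> - T u \<eta> = g \<eta>)"
proof -
  define u where "u \<eta> = (\<Sum>k. (T ^^ k) g \<eta>)" for \<eta>
  have geometric: "summable (\<lambda>k. mubar ^ k * normM M g)"
    using mubar by (intro summable_mult2 summable_geometric) auto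
  have norm0: "normM M f \<ge> 0" for f :: "(int ^ 'd \<Rightarrow> real) \<Rightarrow> real" using M_ge by (intro normM_nonneg) simp
  have summable_norm: "summable (\<lambda>k. normM M ((T ^^ k) g))"
    by (rule summable_comparison_test'[OF geometric, of 0]) (use normM_T_pow[OF g] norm0 in auto)
  have HM_u: "HM M u" unfolding u_def by (intro HM_suminf HM_T_pow g(1) M_ge summable_norm)
  have le: "\<bar>(T ^^ k) g \<eta>\<bar> \<le> normM M ((T ^^ k) g)" if "\<eta> \<in> space OmegaM" for k \<eta>
    by (rule HM_bound[OF HM_T_pow[OF g(1)] M_ge that])
  have summable_abs: "summable (\<lambda>k. \<bar>(T ^^ k) g \<eta>\<bar>)" if "\<eta> \<in> space OmegaM" for \<eta>
    by (rule summable_comparison_test'[OF summable_norm, of 0]) (use le that in auto)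
  have "u \<eta> - T u \<eta> = g \<eta>" if \<eta>: "\<eta> \<in> space OmegaM" for \<eta>
  proof -
    have "T u \<eta> = (\<Sum>k. T ((T ^^ k) g) \<eta>)"
      unfolding T_eq[of _ \<eta>] u_def
    proof (rule integral_suminf)
      show int: "integrable (K \<eta>) ((T ^^ k) g)" for k
        by (intro integrable_K HM_bounded_measurable[OF HM_T_pow[OF g(1)] M_ge] \<eta>)
      show "AE \<eta>' in K \<eta>. summable (\<lambda>k. norm ((T ^^ k) g \<eta>'))"
        by (rule AE_I2) (simp add: space_K summable_abs)
      show "summable (\<lambda>k. \<integral>\<eta>'. norm ((T ^^ k) g \<eta>') \<partial>K \<eta>)"
      proof (rule summable_comparison_test'[OF summable_norm, of 0])
        show "norm (\<integral>\<eta>'. norm ((T ^^ k) g \<eta>') \<partial>K \<eta>) \<le> normM M ((T ^^ k) g)" for k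
          by (rule prob_space.norm_integral_le_const[OF prob_space_K[OF \<eta>] integrable_norm[OF int]])
            (use le in \<open>simp add: space_K\<close>)
      qed
    qed
    then have "T u \<eta> = (\<Sum>k. (T ^^ Suc k) g \<eta>)" by simp
    moreover have "u \<eta> = (\<Sum>k. (T ^^ Suc k) g \<eta>) + g \<eta>"
      unfolding u_def using suminf_split_head[OF summable_rabs_cancel[OF summable_abs[OF \<eta>]]] by simp
    ultimately show ?thesis by simp
  qed
  with HM_u show ?thesis by (intro exI[of _ u]) auto
qed

end

section \<open>The path measure\<close>

lemma finite_spin_lists: "finite {h :: real list. set h \<subseteq> {-1, 1} \<and> length h = n}"
  by (rule finite_lists_length_eq) simp

text \<open>Writes the event that a given spin word occurs as a product over times, which is the
  form in which the chain law prescribes expectations.\<close>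

lemma prod_spin_indicator:
  fixes h :: "real list"
  shows "(\<Prod>i<length h. if \<omega> i = h ! i then 1 else 0 :: real) = (if map \<omega> [0..<length h] = h then 1 else 0)"
proof (cases "map \<omega> [0..<length h] = h")
  case True
  then have "\<omega> i = h ! i" if "i < length h" for i
    using that by (metis add_0 diff_zero length_map length_upt nth_map nth_upt)
  then have "(\<Prod>i<length h. if \<omega> i = h ! i then 1 else 0 :: real) = 1" by (intro prod.neutral) auto
  then show ?thesis by (simp only: True refl if_True)
next
  case False
  have "\<exists>i<length h. \<omega> i \<noteq> h ! i"
  proof (rule ccontr)
    assume "\<not> (\<exists>i<length h. \<omega> i \<noteq> h ! i)"
    then have "map \<omega> [0..<length h] = h" by (intro nth_equalityI) auto
    with False show False by (rule notE)
  qed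
  then have "(\<Prod>i<length h. if \<omega> i = h ! i then 1 else 0 :: real) = 0" by (intro prod_zero) auto
  then show ?thesis by (simp only: False if_False)
qed

locale spectral_gap_chain = spectral_gap_kernel K PiInv M mubar T
  for K :: "(int ^ 'd \<Rightarrow> real) \<Rightarrow> (int ^ 'd \<Rightarrow> real) measure" and PiInv M mubar T +
  fixes P :: "(nat \<Rightarrow> int ^ 'd \<Rightarrow> real) measure" and m :: nat
  assumes chain_law: "is_chain_law P T PiInv"
    and m_pos: "m \<ge> 1"
begin

sublocale P: prob_space P
  using chain_law by (simp add: is_chain_law_def)

lemma sets_P: "sets P = sets (PiM UNIV (\<lambda>_. OmegaM))"
  using chain_law by (simp add: is_chain_law_def)

lemma space_P: "\<omega> \<in> space P \<longleftrightarrow> (\<forall>t. \<omega> t \<in> space OmegaM)"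
  using sets_eq_imp_space_eq[OF sets_P] by (auto simp: space_PiM PiE_UNIV_domain)

lemma measurable_coordinate: "(\<lambda>\<omega>. \<omega> t) \<in> P \<rightarrow>\<^sub>M OmegaM"
  unfolding measurable_cong_sets[OF sets_P refl] by measurable

lemma measurable_P [measurable (raw)]: "bounded_measurable g \<Longrightarrow> (\<lambda>\<omega>. g (\<omega> t)) \<in> borel_measurable P"
  by (rule measurable_compose[OF measurable_coordinate]) (rule bounded_measurable_borel)

lemma integrable_P:
  fixes f :: "(nat \<Rightarrow> int ^ 'd \<Rightarrow> real) \<Rightarrow> real"
  assumes "f \<in> borel_measurable P" "\<And>\<omega>. \<omega> \<in> space P \<Longrightarrow> \<bar>f \<omega>\<bar> \<le> B"
  shows "integrable P f"
  using assms by (intro P.integrable_const_bound[where B=B] AE_I2) auto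

definition clip :: "((int ^ 'd \<Rightarrow> real) \<Rightarrow> real) \<Rightarrow> (int ^ 'd \<Rightarrow> real) \<Rightarrow> real" where
  "clip g \<eta> = (if \<eta> \<in> space OmegaM then g \<eta> else 0)"

lemma clip_eq: "\<eta> \<in> space OmegaM \<Longrightarrow> clip g \<eta> = g \<eta>"
  by (simp add: clip_def)

lemma chainexp_clip: "\<eta> \<in> space OmegaM \<Longrightarrow> chainexp T (map clip gs) \<eta> = chainexp T gs \<eta>"
proof (induction gs arbitrary: \<eta>)
  case (Cons g gs)
  then have "T (chainexp T (map clip gs)) \<eta> = T (chainexp T gs) \<eta>" by (intro T_cong)
  with Cons.prems show ?case by (simp add: clip_eq)
qed simp

text \<open>The definition of the chain law asks for test functions bounded on the whole type,
  whereas our functions are only controlled on the space of spin configurations.\<close>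

lemma integral_prod_chain:
  assumes "\<And>g. g \<in> set gs \<Longrightarrow> bounded_measurable g"
  shows "(\<integral>\<omega>. (\<Prod>i<length gs. (gs ! i) (\<omega> i)) \<partial>P) = (\<integral>\<eta>. chainexp T gs \<eta> \<partial>PiInv)"
proof -
  have "\<forall>g\<in>set (map clip gs). g \<in> borel_measurable OmegaM \<and> (\<exists>B. \<forall>\<eta>. \<bar>g \<eta>\<bar> \<le> B)"
  proof
    fix g assume "g \<in> set (map clip gs)"
    then obtain f where f: "f \<in> set gs" "g = clip f" by auto
    from assms[OF f(1)] obtain B where "B \<ge> 0" "\<And>\<eta>. \<eta> \<in> space OmegaM \<Longrightarrow> \<bar>f \<eta>\<bar> \<le> B"
      by (rule bounded_measurableE) auto
    then have "\<forall>\<eta>. \<bar>g \<eta>\<bar> \<le> B" by (auto simp: f clip_def)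
    moreover have "g \<in> borel_measurable OmegaM"
      using bounded_measurable_borel[OF assms[OF f(1)]]
      by (subst measurable_cong[where g=f]) (auto simp: f clip_eq)
    ultimately show "g \<in> borel_measurable OmegaM \<and> (\<exists>B. \<forall>\<eta>. \<bar>g \<eta>\<bar> \<le> B)" by blast
  qed
  then have "(\<integral>\<omega>. (\<Prod>i<length (map clip gs). (map clip gs ! i) (\<omega> i)) \<partial>P) = (\<integral>\<eta>. chainexp T (map clip gs) \<eta> \<partial>PiInv)"
    using chain_law unfolding is_chain_law_def by blast
  moreover have "(\<integral>\<omega>. (\<Prod>i<length (map clip gs). (map clip gs ! i) (\<omega> i)) \<partial>P) = (\<integral>\<omega>. (\<Prod>i<length gs. (gs ! i) (\<omega> i)) \<partial>P)"
    by (intro Bochner_Integration.integral_cong prod.cong) (auto simp: space_P clip_eq)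
  moreover have "(\<integral>\<eta>. chainexp T (map clip gs) \<eta> \<partial>PiInv) = (\<integral>\<eta>. chainexp T gs \<eta> \<partial>PiInv)"
    by (intro Bochner_Integration.integral_cong) (auto simp: space_PiInv chainexp_clip)
  ultimately show ?thesis by simp
qed

lemma bounded_measurable_chainexp:
  "(\<And>g. g \<in> set gs \<Longrightarrow> bounded_measurable g) \<Longrightarrow> bounded_measurable (chainexp T gs)"
  by (induction gs) (auto intro!: bounded_measurable_const bounded_measurable_mult bounded_measurable_T)

text \<open>The Markov property in algebraic form: the last coordinate is integrated out with the
  kernel, since \<open>T\<close> maps the constant 1 at the end of the list to 1.\<close>

lemma chainexp_markov:
  assumes "\<eta> \<in> space OmegaM"
  shows "chainexp T (gs @ [a, b]) \<eta> = chainexp T (gs @ [\<lambda>\<eta>. a \<eta> * T b \<eta>]) \<eta>"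
  using assms
proof (induction gs arbitrary: \<eta>)
  case Nil
  have "T (\<lambda>\<eta>. b \<eta> * T (\<lambda>_. 1) \<eta>) \<eta> = T b \<eta>" by (intro T_cong) (simp add: T_const)
  with Nil show ?case by (simp add: T_const)
next
  case (Cons g gs)
  then have "T (chainexp T (gs @ [a, b])) \<eta> = T (chainexp T (gs @ [\<lambda>\<eta>. a \<eta> * T b \<eta>])) \<eta>" by (intro T_cong)
  then show ?case by simp
qed

text \<open>Only the spins at the origin are recorded, at times 0 to \<open>t\<close>. There are
  finitely many such histories, so conditioning on the past becomes a finite sum.\<close>

definition hist :: "nat \<Rightarrow> (nat \<Rightarrow> int ^ 'd \<Rightarrow> real) \<Rightarrow> real list" where
  "hist t \<omega> = map (\<lambda>i. \<omega> i 0) [0..<Suc t]"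

lemma length_hist [simp]: "length (hist t \<omega>) = Suc t"
  by (simp add: hist_def)

lemma hist_in: "\<omega> \<in> space P \<Longrightarrow> hist t \<omega> \<in> {h. set h \<subseteq> {-1, 1} \<and> length h = Suc t}"
  by (auto simp: hist_def space_P space_OmegaM simp del: upt_Suc)

lemma sum_hist:
  fixes F :: "real list \<Rightarrow> real"
  assumes "\<omega> \<in> space P"
  shows "F (hist t \<omega>) = (\<Sum>h | set h \<subseteq> {-1, 1} \<and> length h = Suc t. (if hist t \<omega> = h then 1 else 0) * F h)"
  using hist_in[OF assms, of t] finite_spin_lists[of "Suc t"]
  by (simp add: if_distrib[of "\<lambda>x. x * _"] cong: if_cong)

lemma measurable_hist_eq: "(\<lambda>\<omega>. if hist t \<omega> = h then 1 else 0 :: real) \<in> borel_measurable P"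
proof (cases "length h = Suc t")
  case True
  then have "(\<lambda>\<omega>. if hist t \<omega> = h then 1 else 0 :: real) = (\<lambda>\<omega>. \<Prod>i<length h. if \<omega> i 0 = h ! i then 1 else 0)"
    unfolding prod_spin_indicator[where \<omega>="\<lambda>i. _ i 0"] by (simp add: hist_def)
  moreover have "(\<lambda>\<omega>. if \<omega> i 0 = h ! i then 1 else 0 :: real) \<in> borel_measurable P" for i
    by (rule measurable_P[OF bounded_measurable_spin])
  ultimately show ?thesis by simp
next
  case False
  then have "(\<lambda>\<omega>. if hist t \<omega> = h then 1 else 0 :: real) = (\<lambda>_. 0)" by (auto simp: fun_eq_iff)
  then show ?thesis by simp
qed

lemma measurable_hist_fun:
  fixes g :: "real list \<Rightarrow> (int ^ 'd \<Rightarrow> real) \<Rightarrow> real"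
  assumes "\<And>h. bounded_measurable (g h)"
  shows "(\<lambda>\<omega>. g (hist t \<omega>) (\<omega> s)) \<in> borel_measurable P"
  by (subst measurable_cong[OF sum_hist[of _ "\<lambda>h. g h (_ s)"]])
    (auto intro!: borel_measurable_sum borel_measurable_times measurable_hist_eq measurable_P assms)

text \<open>Both sides split into a finite sum over histories \<open>h\<close>. For fixed
  \<open>h\<close> the indicator of the history is a product of one-time functions, so the chain law
  applies to a list ending in \<open>ind t\<close> and \<open>g h\<close>, and the last two entries
  are merged by \<open>chainexp_markov\<close>.\<close>

theorem markov_property:
  assumes g: "\<And>h. bounded_measurable (g h)"
  shows "(\<integral>\<omega>. g (hist t \<omega>) (\<omega> (Suc t)) \<partial>P) = (\<integral>\<omega>. T (g (hist t \<omega>)) (\<omega> t) \<partial>P)"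
proof -
  let ?L = "{h :: real list. set h \<subseteq> {-1, 1} \<and> length h = Suc t}"
  have expand: "(\<integral>\<omega>. f (hist t \<omega>) (\<omega> s) \<partial>P) = (\<Sum>h\<in>?L. \<integral>\<omega>. (if hist t \<omega> = h then 1 else 0) * f h (\<omega> s) \<partial>P)"
    if f: "\<And>h. bounded_measurable (f h)" for f s
  proof -
    have "integrable P (\<lambda>\<omega>. (if hist t \<omega> = h then 1 else 0) * f h (\<omega> s))" for h
    proof -
      from f[of h] obtain B where "B \<ge> 0" "\<And>\<eta>. \<eta> \<in> space OmegaM \<Longrightarrow> \<bar>f h \<eta>\<bar> \<le> B" by (rule bounded_measurableE) auto
      then show ?thesis
        by (intro integrable_P[where B=B] borel_measurable_times measurable_hist_eq measurable_P f) (auto simp: space_P)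
    qed
    then show ?thesis
      by (subst Bochner_Integration.integral_cong[OF refl sum_hist[of _ "\<lambda>h. f h (_ s)"]])
        (auto intro!: Bochner_Integration.integral_sum)
  qed
  have "(\<integral>\<omega>. (if hist t \<omega> = h then 1 else 0) * g h (\<omega> (Suc t)) \<partial>P) = (\<integral>\<omega>. (if hist t \<omega> = h then 1 else 0) * T (g h) (\<omega> t) \<partial>P)"
    if h: "h \<in> ?L" for h
  proof -
    define ind :: "nat \<Rightarrow> (int ^ 'd \<Rightarrow> real) \<Rightarrow> real" where "ind i \<eta> = (if \<eta> 0 = h ! i then 1 else 0)" for i \<eta>
    have ind: "bounded_measurable (ind i)" for i
      unfolding ind_def[abs_def] by (rule bounded_measurable_spin)
    define gs where "gs = map ind [0..<t]"
    have gs: "\<And>f. f \<in> set gs \<Longrightarrow> bounded_measurable f" by (auto simp: gs_def ind)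
    have eq: "(if hist t \<omega> = h then 1 else 0) = (\<Prod>i<t. (gs ! i) (\<omega> i)) * ind t (\<omega> t)" for \<omega>
    proof -
      have "(if hist t \<omega> = h then 1 else 0 :: real) = (\<Prod>i<length h. if \<omega> i 0 = h ! i then 1 else 0)"
        unfolding prod_spin_indicator[where \<omega>="\<lambda>i. \<omega> i 0"] using h by (simp add: hist_def)
      also have "\<dots> = (\<Prod>i<Suc t. ind i (\<omega> i))" using h by (simp add: ind_def del: prod.lessThan_Suc)
      finally show ?thesis by (simp add: gs_def)
    qed
    have "(\<integral>\<omega>. (if hist t \<omega> = h then 1 else 0) * g h (\<omega> (Suc t)) \<partial>P)
        = (\<integral>\<omega>. (\<Prod>i<length (gs @ [ind t, g h]). ((gs @ [ind t, g h]) ! i) (\<omega> i)) \<partial>P)"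
      unfolding eq by (simp add: gs_def nth_append)
    also have "\<dots> = (\<integral>\<eta>. chainexp T (gs @ [ind t, g h]) \<eta> \<partial>PiInv)"
      using gs ind g by (intro integral_prod_chain) auto
    also have "\<dots> = (\<integral>\<eta>. chainexp T (gs @ [\<lambda>\<eta>. ind t \<eta> * T (g h) \<eta>]) \<eta> \<partial>PiInv)"
      by (intro Bochner_Integration.integral_cong chainexp_markov) (auto simp: space_PiInv)
    also have "\<dots> = (\<integral>\<omega>. (\<Prod>i<length (gs @ [\<lambda>\<eta>. ind t \<eta> * T (g h) \<eta>]). ((gs @ [\<lambda>\<eta>. ind t \<eta> * T (g h) \<eta>]) ! i) (\<omega> i)) \<partial>P)"
      using gs ind g by (intro integral_prod_chain[symmetric]) (auto intro!: bounded_measurable_mult bounded_measurable_T)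
    also have "\<dots> = (\<integral>\<omega>. (if hist t \<omega> = h then 1 else 0) * T (g h) (\<omega> t) \<partial>P)"
      unfolding eq by (simp add: gs_def nth_append mult.assoc)
    finally show ?thesis .
  qed
  then show ?thesis
    using expand[of g "Suc t"] expand[of "\<lambda>h. T (g h)" t] g bounded_measurable_T by simp
qed

definition shift :: "(nat \<Rightarrow> int ^ 'd \<Rightarrow> real) \<Rightarrow> nat \<Rightarrow> int ^ 'd \<Rightarrow> real" where
  "shift \<omega> n = \<omega> (Suc n)"

lemma measurable_shift: "shift \<in> P \<rightarrow>\<^sub>M PiM UNIV (\<lambda>_. OmegaM)"
  unfolding shift_def[abs_def] by (intro measurable_PiM_single') (auto intro: measurable_coordinate simp: space_P)

text \<open>Prepending the constant 1 to the list of test functions moves all of them one time step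
  later. In the prescribed expectation this adds one outermost \<open>T\<close>, which the invariant
  measure does not see. Cylinder sets determine the measure.\<close>

theorem stationary: "distr P (PiM UNIV (\<lambda>_. OmegaM)) shift = P"
proof (rule measure_eqI_PiM_infinite[symmetric])
  fix A and J :: "nat set" assume J: "finite J" and A: "\<And>i. i \<in> J \<Longrightarrow> A i \<in> sets (OmegaM :: (int ^ 'd \<Rightarrow> real) measure)"
  let ?X = "prod_emb UNIV (\<lambda>_. OmegaM) J (Pi\<^sub>E J A)"
  have X: "?X \<in> sets (PiM UNIV (\<lambda>_. OmegaM))" using J A by (intro sets_PiM_I) auto
  obtain n where n: "J \<subseteq> {..<n}" using J finite_nat_iff_bounded by blast
  \<comment> \<open>Times below \<open>n\<close> outside \<open>J\<close> receive the constant 1,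
    because the chain law treats initial segments of times.\<close>
  define g :: "nat \<Rightarrow> (int ^ 'd \<Rightarrow> real) \<Rightarrow> real" where "g i = (if i \<in> J then indicator (A i) else (\<lambda>_. 1))" for i
  have g: "bounded_measurable (g i)" for i
    using A by (cases "i \<in> J") (auto simp: g_def bounded_measurable_const intro!: bounded_measurableI[of _ 1] split: split_indicator)
  have indX: "indicator ?X \<omega> = (\<Prod>i<n. g i (\<omega> i))" if "\<omega> \<in> space P" for \<omega>
  proof -
    have "(\<Prod>i<n. g i (\<omega> i)) = (\<Prod>i\<in>J. indicator (A i) (\<omega> i))"
      using n by (intro prod.mono_neutral_cong_right) (auto simp: g_def)
    also have "\<dots> = (if \<forall>i\<in>J. \<omega> i \<in> A i then 1 else 0)"
      using J by (auto simp: indicator_def)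
    finally show ?thesis
      using that J by (auto simp: indicator_def prod_emb_def space_P PiE_UNIV_domain PiE_iff Pi_iff extensional_def)
  qed
  have "measure P ?X = (\<integral>\<omega>. (\<Prod>i<n. g i (\<omega> i)) \<partial>P)"
    using X by (subst Bochner_Integration.integral_cong[OF refl indX[symmetric]]) (auto simp: sets_P)
  also have "\<dots> = (\<integral>\<omega>. (\<Prod>i<length (map g [0..<n]). (map g [0..<n] ! i) (\<omega> i)) \<partial>P)" by simp
  also have "\<dots> = (\<integral>\<eta>. chainexp T (map g [0..<n]) \<eta> \<partial>PiInv)" using g by (intro integral_prod_chain) auto
  also have "\<dots> = (\<integral>\<eta>. chainexp T ((\<lambda>_. 1) # map g [0..<n]) \<eta> \<partial>PiInv)"
  proof -
    have "bounded_measurable (chainexp T (map g [0..<n]))" using g by (intro bounded_measurable_chainexp) auto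
    then show ?thesis by (simp add: integral_T)
  qed
  also have "\<dots> = (\<integral>\<omega>. (\<Prod>i<length ((\<lambda>_. 1) # map g [0..<n]). (((\<lambda>_. 1) # map g [0..<n]) ! i) (\<omega> i)) \<partial>P)"
    using g by (intro integral_prod_chain[symmetric]) (auto intro: bounded_measurable_const)
  also have "\<dots> = (\<integral>\<omega>. (\<Prod>i<n. g i (shift \<omega> i)) \<partial>P)"
    by (simp add: prod.lessThan_Suc_shift shift_def del: prod.lessThan_Suc)
  also have "\<dots> = (\<integral>\<omega>. indicator ?X (shift \<omega>) \<partial>P)"
    by (intro Bochner_Integration.integral_cong refl indX[symmetric]) (auto simp: space_P shift_def)
  also have "\<dots> = (\<integral>\<omega>. indicator ?X \<omega> \<partial>distr P (PiM UNIV (\<lambda>_. OmegaM)) shift)"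
    using X by (intro integral_distr[symmetric] measurable_shift) auto
  also have "\<dots> = measure (distr P (PiM UNIV (\<lambda>_. OmegaM)) shift) ?X"
    using X by simp
  finally show "emeasure P ?X = emeasure (distr P (PiM UNIV (\<lambda>_. OmegaM)) shift) ?X"
    using finite_measure.emeasure_eq_measure[OF prob_space.finite_measure[OF P.prob_space_distr[OF measurable_shift]]]
    by (simp add: P.emeasure_eq_measure)
qed (auto simp: sets_P P.finite_measure_axioms)

lemma integral_shift:
  fixes F :: "(nat \<Rightarrow> int ^ 'd \<Rightarrow> real) \<Rightarrow> real"
  assumes "F \<in> borel_measurable P"
  shows "(\<integral>\<omega>. F (shift \<omega>) \<partial>P) = (\<integral>\<omega>. F \<omega> \<partial>P)"
proof -
  have "(\<integral>\<omega>. F (shift \<omega>) \<partial>P) = (\<integral>\<omega>. F \<omega> \<partial>distr P (PiM UNIV (\<lambda>_. OmegaM)) shift)"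
    using assms by (intro integral_distr[symmetric] measurable_shift) (simp add: measurable_cong_sets[OF sets_P refl])
  then show ?thesis by (simp add: stationary)
qed

lemma integral_coordinate:
  assumes "bounded_measurable g"
  shows "(\<integral>\<omega>. g (\<omega> t) \<partial>P) = (\<integral>\<eta>. g \<eta> \<partial>PiInv)"
proof (induction t)
  case 0
  have "(\<integral>\<eta>. g \<eta> * T (\<lambda>_. 1) \<eta> \<partial>PiInv) = (\<integral>\<eta>. g \<eta> \<partial>PiInv)"
    by (intro Bochner_Integration.integral_cong) (auto simp: space_PiInv T_const)
  then show ?case using integral_prod_chain[of "[g]"] assms by simp
next
  case (Suc t)
  have "(\<integral>\<omega>. g (\<omega> (Suc t)) \<partial>P) = (\<integral>\<omega>. g (shift \<omega> t) \<partial>P)" by (simp add: shift_def)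
  also have "\<dots> = (\<integral>\<omega>. g (\<omega> t) \<partial>P)" using assms by (intro integral_shift measurable_P)
  finally show ?case using Suc by simp
qed

end

section \<open>Functions of a window of spins\<close>

context spectral_gap_chain
begin

definition win :: "nat \<Rightarrow> (nat \<Rightarrow> int ^ 'd \<Rightarrow> real) \<Rightarrow> real list" where
  "win t \<omega> = map (\<lambda>i. \<omega> i 0) [t..<t + m]"

text \<open>The environment is taken at the last time of the window; \<open>m \<ge> 1\<close>
  guarantees that this time belongs to it. The next step therefore only needs one application of the
  kernel.\<close>

definition rv :: "(real list \<Rightarrow> (int ^ 'd \<Rightarrow> real) \<Rightarrow> real) \<Rightarrow> nat \<Rightarrow> (nat \<Rightarrow> int ^ 'd \<Rightarrow> real) \<Rightarrow> real" where
  "rv G t \<omega> = G (win t \<omega>) (\<omega> (t + m - 1))"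

text \<open>The transition operator of the pair (window, environment): the oldest spin is dropped,
  and the spin appended is the origin value of the same new environment that enters \<open>G\<close>
  as second argument.\<close>

definition window_op :: "(real list \<Rightarrow> (int ^ 'd \<Rightarrow> real) \<Rightarrow> real) \<Rightarrow> real list \<Rightarrow> (int ^ 'd \<Rightarrow> real) \<Rightarrow> real" where
  "window_op G s = T (\<lambda>\<eta>. G (tl s @ [\<eta> 0]) \<eta>)"

definition window_HM :: "(real list \<Rightarrow> (int ^ 'd \<Rightarrow> real) \<Rightarrow> real) \<Rightarrow> bool" where
  "window_HM G \<longleftrightarrow> (\<forall>s. HM M (G s))"

lemma window_HMD: "window_HM G \<Longrightarrow> HM M (G s)"
  by (simp add: window_HM_def)

lemma length_win [simp]: "length (win t \<omega>) = m"
  by (simp add: win_def)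

lemma win_in: "\<omega> \<in> space P \<Longrightarrow> win t \<omega> \<in> {h. set h \<subseteq> {-1, 1} \<and> length h = m}"
  by (auto simp: win_def space_P space_OmegaM)

lemma win_hist: "t + m \<le> Suc n \<Longrightarrow> win t \<omega> = take m (drop t (hist n \<omega>))"
  by (simp add: win_def hist_def drop_map take_map del: upt_Suc)

lemma win_Suc: "win (Suc t) \<omega> = tl (win t \<omega>) @ [\<omega> (t + m) 0]"
  using m_pos by (simp add: win_def flip: map_tl)

lemma rv_shift: "rv G (Suc t) \<omega> = rv G t (shift \<omega>)"
proof -
  have "win (Suc t) \<omega> = win t (shift \<omega>)"
    by (simp add: win_def shift_def list_eq_iff_nth_eq del: upt_Suc)
  moreover have "\<omega> (Suc t + m - 1) = shift \<omega> (t + m - 1)" using m_pos by (simp add: shift_def)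
  ultimately show ?thesis by (simp add: rv_def)
qed

lemma measurable_rv:
  assumes "window_HM G"
  shows "rv G t \<in> borel_measurable P"
proof -
  have "rv G t = (\<lambda>\<omega>. (\<lambda>h. G (take m (drop t h))) (hist (t + m - 1) \<omega>) (\<omega> (t + m - 1)))"
    using m_pos by (auto simp: rv_def fun_eq_iff win_hist[of t "t + m - 1"])
  also have "\<dots> \<in> borel_measurable P"
    by (intro measurable_hist_fun HM_bounded_measurable[OF window_HMD[OF assms] M_ge])
  finally show ?thesis .
qed

text \<open>Along a path only the finitely many spin words of length \<open>m\<close> occur as
  windows, so the sum of their norms bounds all times at once.\<close>

lemma bounded_rv:
  assumes "window_HM G"
  obtains B where "B \<ge> 0" "\<And>t \<omega>. \<omega> \<in> space P \<Longrightarrow> \<bar>rv G t \<omega>\<bar> \<le> B"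
proof
  let ?L = "{h :: real list. set h \<subseteq> {-1, 1} \<and> length h = m}"
  let ?B = "\<Sum>s\<in>?L. normM M (G s)"
  have nonneg: "normM M (G s) \<ge> 0" for s using M_ge by (intro normM_nonneg) simp
  then show "?B \<ge> 0" by (intro sum_nonneg)
  fix t \<omega> assume \<omega>: "\<omega> \<in> space P"
  have "\<bar>rv G t \<omega>\<bar> \<le> normM M (G (win t \<omega>))"
    unfolding rv_def using \<omega> by (intro HM_bound[OF window_HMD[OF assms] M_ge]) (simp add: space_P)
  also have "\<dots> \<le> ?B"
    by (rule member_le_sum[OF win_in[OF \<omega>]]) (use nonneg finite_spin_lists in auto)
  finally show "\<bar>rv G t \<omega>\<bar> \<le> ?B" .
qed

lemma integrable_rv_mult:
  assumes "window_HM G" "window_HM H"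
  shows "integrable P (\<lambda>\<omega>. rv G s \<omega> * rv H t \<omega>)"
proof -
  obtain B where B: "B \<ge> 0" "\<And>t \<omega>. \<omega> \<in> space P \<Longrightarrow> \<bar>rv G t \<omega>\<bar> \<le> B" using assms(1) by (rule bounded_rv) auto
  obtain C where C: "C \<ge> 0" "\<And>t \<omega>. \<omega> \<in> space P \<Longrightarrow> \<bar>rv H t \<omega>\<bar> \<le> C" using assms(2) by (rule bounded_rv) auto
  show ?thesis
    using B C by (intro integrable_P[where B="B * C"] borel_measurable_times measurable_rv assms)
      (auto simp: abs_mult intro!: mult_mono)
qed

lemma integrable_rv:
  assumes "window_HM G"
  shows "integrable P (rv G t)"
proof -
  obtain B where B: "B \<ge> 0" "\<And>t \<omega>. \<omega> \<in> space P \<Longrightarrow> \<bar>rv G t \<omega>\<bar> \<le> B" using assms by (rule bounded_rv) auto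
  then show ?thesis by (intro integrable_P[where B=B] measurable_rv assms)
qed

lemma expectation_rv:
  assumes "window_HM G"
  shows "P.expectation (rv G t) = P.expectation (rv G 0)"
proof (induction t)
  case (Suc t)
  have "P.expectation (rv G (Suc t)) = P.expectation (\<lambda>\<omega>. rv G t (shift \<omega>))"
    by (intro Bochner_Integration.integral_cong) (auto simp: rv_shift)
  then show ?case using Suc integral_shift[OF measurable_rv[OF assms, of t]] by simp
qed simp

lemma covariance_rv:
  assumes "window_HM G" "window_HM H"
  shows "P.expectation (\<lambda>\<omega>. rv G s \<omega> * rv H (s + k) \<omega>) = P.expectation (\<lambda>\<omega>. rv G 0 \<omega> * rv H k \<omega>)"
proof (induction s)
  case (Suc s)
  have "P.expectation (\<lambda>\<omega>. rv G (Suc s) \<omega> * rv H (Suc s + k) \<omega>) = P.expectation (\<lambda>\<omega>. rv G s (shift \<omega>) * rv H (s + k) (shift \<omega>))"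
    by (simp add: rv_shift)
  also have "\<dots> = P.expectation (\<lambda>\<omega>. rv G s \<omega> * rv H (s + k) \<omega>)"
    by (rule integral_shift[where F="\<lambda>\<omega>. rv G s \<omega> * rv H (s + k) \<omega>"])
      (intro borel_measurable_times measurable_rv assms)
  finally show ?case using Suc by simp
qed simp

section \<open>The window operator and its Poisson equation\<close>

lemma window_HM_op: "window_HM G \<Longrightarrow> window_HM (window_op G)"
  unfolding window_HM_def window_op_def by (auto intro!: HM_T HM_spin_select[where g="\<lambda>x. G (tl _ @ [x])"] M_ge)

lemma window_HM_op_pow: "window_HM G \<Longrightarrow> window_HM ((window_op ^^ k) G)"
  by (induction k) (auto intro: window_HM_op)

text \<open>The test function \<phi> may use the whole spin history up to the end of the window.
  This covers an early summand in a covariance as well as the partial sums in a characteristic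
  function.\<close>

lemma rv_markov:
  assumes "window_HM G"
  shows "P.expectation (\<lambda>\<omega>. \<phi> (hist (t + m - 1) \<omega>) * rv G (Suc t) \<omega>)
    = P.expectation (\<lambda>\<omega>. \<phi> (hist (t + m - 1) \<omega>) * rv (window_op G) t \<omega>)"
proof -
  define n where "n = t + m - 1"
  have n: "t + m = Suc n" using m_pos by (simp add: n_def)
  \<comment> \<open>The old window is recovered from the history \<open>h\<close>, so only the
    newest spin and environment remain to be averaged.\<close>
  define g where "g h \<eta> = \<phi> h * G (tl (take m (drop t h)) @ [\<eta> 0]) \<eta>" for h \<eta>
  have "bounded_measurable (g h)" for h
    unfolding g_def
    by (intro bounded_measurable_mult bounded_measurable_const HM_bounded_measurable[OF _ M_ge]
        HM_spin_select[where g="\<lambda>x. G (tl (take m (drop t h)) @ [x])"] window_HMD[OF assms] M_ge)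
  then have "P.expectation (\<lambda>\<omega>. g (hist n \<omega>) (\<omega> (Suc n))) = P.expectation (\<lambda>\<omega>. T (g (hist n \<omega>)) (\<omega> n))"
    by (rule markov_property)
  moreover have "g (hist n \<omega>) (\<omega> (Suc n)) = \<phi> (hist n \<omega>) * rv G (Suc t) \<omega>" for \<omega>
    using n by (simp add: g_def rv_def win_Suc win_hist[of t n])
  moreover have "T (g (hist n \<omega>)) (\<omega> n) = \<phi> (hist n \<omega>) * rv (window_op G) t \<omega>" for \<omega>
    unfolding g_def T_cmult using n by (simp add: rv_def window_op_def win_hist[of t n] n_def[symmetric])
  ultimately show ?thesis by (simp add: n_def)
qed

lemma rv_markov_pow:
  assumes "window_HM H"
  shows "P.expectation (\<lambda>\<omega>. \<phi> (win 0 \<omega>) * rv H k \<omega>) = P.expectation (\<lambda>\<omega>. \<phi> (win 0 \<omega>) * rv ((window_op ^^ k) H) 0 \<omega>)"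
  using assms
proof (induction k arbitrary: H)
  case (Suc k)
  have "win 0 \<omega> = take m (drop 0 (hist (k + m - 1) \<omega>))" for \<omega>
    using m_pos by (intro win_hist) simp
  then have "P.expectation (\<lambda>\<omega>. \<phi> (win 0 \<omega>) * rv H (Suc k) \<omega>) = P.expectation (\<lambda>\<omega>. \<phi> (win 0 \<omega>) * rv (window_op H) k \<omega>)"
    using rv_markov[OF Suc.prems, of "\<lambda>h. \<phi> (take m (drop 0 h))" k] by simp
  also have "\<dots> = P.expectation (\<lambda>\<omega>. \<phi> (win 0 \<omega>) * rv ((window_op ^^ k) (window_op H)) 0 \<omega>)"
    by (intro Suc.IH window_HM_op Suc.prems)
  finally show ?case by (simp add: funpow_swap1)
qed simp

text \<open>Each application discards the oldest spin of the window, so the first \<open>k\<close>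
  entries cannot influence the result.\<close>

lemma window_op_pow_drop:
  assumes "length s = m" "length s' = m" "k \<le> m" "drop k s = drop k s'"
  shows "(window_op ^^ k) G s = (window_op ^^ k) G s'"
  using assms
proof (induction k arbitrary: s s')
  case (Suc k)
  have "(window_op ^^ k) G (tl s @ [x]) = (window_op ^^ k) G (tl s' @ [x])" for x
    using Suc.prems by (intro Suc.IH) (auto simp: drop_Suc)
  then show ?case by (simp add: window_op_def[of "(window_op ^^ k) G"])
qed simp

text \<open>The window of ones is an arbitrary representative: after \<open>m\<close> applications
  every window of length \<open>m\<close> gives the same function of the environment.\<close>

definition reduced :: "(real list \<Rightarrow> (int ^ 'd \<Rightarrow> real) \<Rightarrow> real) \<Rightarrow> (int ^ 'd \<Rightarrow> real) \<Rightarrow> real" where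
  "reduced G = (window_op ^^ m) G (replicate m 1)"

lemma HM_reduced: "window_HM G \<Longrightarrow> HM M (reduced G)"
  unfolding reduced_def by (rule window_HMD[OF window_HM_op_pow])

text \<open>After \<^term>\<open>m\<close> steps the initial window has been forgotten.\<close>

lemma window_op_pow_reduced:
  assumes "length s = m" "\<eta> \<in> space OmegaM"
  shows "(window_op ^^ (m + j)) G s \<eta> = (T ^^ j) (reduced G) \<eta>"
  using assms
proof (induction j arbitrary: s \<eta>)
  case 0
  then show ?case
    unfolding reduced_def using window_op_pow_drop[of s "replicate m 1" m G] by simp
next
  case (Suc j)
  have "(window_op ^^ (m + Suc j)) G s \<eta> = T (\<lambda>\<eta>'. (window_op ^^ (m + j)) G (tl s @ [\<eta>' 0]) \<eta>') \<eta>"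
    by (simp add: window_op_def[of "(window_op ^^ (m + j)) G"])
  also have "\<dots> = T ((T ^^ j) (reduced G)) \<eta>"
    using Suc.prems m_pos by (intro T_cong Suc.IH) auto
  finally show ?case by simp
qed

text \<open>By stationarity the mean may be computed \<open>m\<close> steps later, when conditioning
  leaves a function of one environment. Centering along the path thus becomes centering under
  \<open>PiInv\<close>, as the Poisson equation in H_M demands.\<close>

lemma integral_reduced:
  assumes "window_HM G"
  shows "(\<integral>\<eta>. reduced G \<eta> \<partial>PiInv) = P.expectation (rv G 0)"
proof -
  have "P.expectation (rv G 0) = P.expectation (rv G m)" by (rule expectation_rv[OF assms, symmetric])
  also have "\<dots> = P.expectation (rv ((window_op ^^ m) G) 0)"
    using rv_markov_pow[OF assms, of "\<lambda>_. 1" m] by simp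
  also have "\<dots> = P.expectation (\<lambda>\<omega>. reduced G (\<omega> (m - 1)))"
    using window_op_pow_reduced[of _ _ 0 G]
    by (intro Bochner_Integration.integral_cong) (auto simp: rv_def space_P)
  also have "\<dots> = (\<integral>\<eta>. reduced G \<eta> \<partial>PiInv)"
    by (intro integral_coordinate HM_bounded_measurable[OF HM_reduced[OF assms] M_ge])
  finally show ?thesis ..
qed

text \<open>The Neumann series of \<open>window_op\<close> is cut at \<open>m\<close>. The first
  \<open>m\<close> terms still depend on the window; the tail depends on the environment alone and
  is the solution \<open>u\<close> for \<open>reduced G\<close>. The finite part telescopes to
  \<open>G\<close> minus its \<open>m\<close>-th iterate, and that iterate is cancelled by
  \<open>u - T u\<close>.\<close>

lemma window_poisson_equation:
  assumes G: "window_HM G" and "P.expectation (rv G 0) = 0"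
  shows "\<exists>A. window_HM A \<and> (\<forall>s \<eta>. length s = m \<longrightarrow> \<eta> \<in> space OmegaM \<longrightarrow> A s \<eta> - window_op A s \<eta> = G s \<eta>)"
proof -
  obtain u where u: "HM M u" "\<And>\<eta>. \<eta> \<in> space OmegaM \<Longrightarrow> u \<eta> - T u \<eta> = reduced G \<eta>"
    using poisson_equation[OF HM_reduced[OF G]] integral_reduced[OF G] assms(2) by auto
  define A where "A s \<eta> = (\<Sum>k<m. (window_op ^^ k) G s \<eta>) + u \<eta>" for s \<eta>
  have "window_HM A"
    unfolding window_HM_def A_def by (intro allI HM_add HM_sum window_HMD[OF window_HM_op_pow] G u(1) M_ge)
  moreover have "A s \<eta> - window_op A s \<eta> = G s \<eta>" if s: "length s = m" and \<eta>: "\<eta> \<in> space OmegaM" for s \<eta>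
  proof -
    have bm: "bounded_measurable (\<lambda>\<eta>. (window_op ^^ k) G (tl s @ [\<eta> 0]) \<eta>)" for k
      by (intro HM_bounded_measurable[OF _ M_ge] HM_spin_select[where g="\<lambda>x. (window_op ^^ k) G (tl s @ [x])"] window_HMD[OF window_HM_op_pow] G M_ge)
    have bmsum: "bounded_measurable (\<lambda>\<eta>. \<Sum>k<m. (window_op ^^ k) G (tl s @ [\<eta> 0]) \<eta>)"
      by (intro HM_bounded_measurable[OF _ M_ge] HM_sum HM_spin_select[where g="\<lambda>x. (window_op ^^ _) G (tl s @ [x])"] window_HMD[OF window_HM_op_pow] G M_ge)
    have "window_op A s \<eta> = T (\<lambda>\<eta>. \<Sum>k<m. (window_op ^^ k) G (tl s @ [\<eta> 0]) \<eta>) \<eta> + T u \<eta>"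
      unfolding window_op_def[of A] A_def
      by (rule T_add[OF bmsum HM_bounded_measurable[OF u(1) M_ge] \<eta>])
    also have "T (\<lambda>\<eta>. \<Sum>k<m. (window_op ^^ k) G (tl s @ [\<eta> 0]) \<eta>) \<eta> = (\<Sum>k<m. T (\<lambda>\<eta>. (window_op ^^ k) G (tl s @ [\<eta> 0]) \<eta>) \<eta>)"
      by (intro T_sum bm \<eta>)
    also have "\<dots> = (\<Sum>k<m. (window_op ^^ Suc k) G s \<eta>)"
      by (simp add: window_op_def[of "(window_op ^^ _) G"])
    finally have "A s \<eta> - window_op A s \<eta> = (\<Sum>k<m. (window_op ^^ k) G s \<eta> - (window_op ^^ Suc k) G s \<eta>) + (u \<eta> - T u \<eta>)"
      using A_def[of s \<eta>] by (simp only: sum_subtractf)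
    also have "(\<Sum>k<m. (window_op ^^ k) G s \<eta> - (window_op ^^ Suc k) G s \<eta>) = G s \<eta> - (window_op ^^ m) G s \<eta>"
      by (subst sum_lessThan_telescope') simp
    also have "(window_op ^^ m) G s \<eta> = reduced G \<eta>"
      using window_op_pow_reduced[OF s \<eta>, of 0 G] by simp
    finally show ?thesis using u(2)[OF \<eta>] by simp
  qed
  ultimately show ?thesis by (intro exI[of _ A]) auto
qed

text \<open>Given the initial window and its last environment, the conditional mean of
  \<open>rv H (m + j)\<close> is an iterate of \<open>T\<close> on \<open>reduced H\<close>, within
  order \<open>mubar ^ j\<close> of the constant \<open>c\<close>. Subtracting \<open>c\<close> is
  free because \<open>F\<close> is centered; the offset \<open>m\<close> is the time it takes to
  leave the initial window.\<close>

lemma covariance_decay: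
  assumes F: "P.expectation (rv (\<lambda>s _. F s) 0) = 0" and H: "window_HM H"
  shows "\<exists>C. \<forall>j. \<bar>P.expectation (\<lambda>\<omega>. rv (\<lambda>s _. F s) 0 \<omega> * rv H (m + j) \<omega>)\<bar> \<le> C * mubar ^ j"
proof -
  have HM_F: "window_HM (\<lambda>s _. F s)" by (simp add: window_HM_def HM_const)
  obtain B where B: "B \<ge> 0" "\<And>t \<omega>. \<omega> \<in> space P \<Longrightarrow> \<bar>rv (\<lambda>s _. F s) t \<omega>\<bar> \<le> B" using HM_F by (rule bounded_rv) auto
  define c where "c = (\<integral>\<eta>. reduced H \<eta> \<partial>PiInv)"
  obtain C where C: "C \<ge> 0" "\<And>k \<eta>. \<eta> \<in> space OmegaM \<Longrightarrow> \<bar>(T ^^ k) (reduced H) \<eta> - c\<bar> \<le> C * mubar ^ k"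
    using T_pow_decay[OF HM_reduced[OF H]] unfolding c_def by auto
  have "\<bar>P.expectation (\<lambda>\<omega>. rv (\<lambda>s _. F s) 0 \<omega> * rv H (m + j) \<omega>)\<bar> \<le> (B * C) * mubar ^ j" for j
  proof -
    let ?G = "(window_op ^^ (m + j)) H"
    have G: "rv ?G 0 \<omega> = (T ^^ j) (reduced H) (\<omega> (m - 1))" if "\<omega> \<in> space P" for \<omega>
      using that by (simp add: rv_def space_P window_op_pow_reduced)
    have i1: "integrable P (\<lambda>\<omega>. rv (\<lambda>s _. F s) 0 \<omega> * rv ?G 0 \<omega>)"
      by (intro integrable_rv_mult HM_F window_HM_op_pow H)
    have i2: "integrable P (\<lambda>\<omega>. c * rv (\<lambda>s _. F s) 0 \<omega>)" by (intro integrable_mult_right integrable_rv HM_F)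
    have "P.expectation (\<lambda>\<omega>. rv (\<lambda>s _. F s) 0 \<omega> * rv H (m + j) \<omega>) = P.expectation (\<lambda>\<omega>. rv (\<lambda>s _. F s) 0 \<omega> * rv ?G 0 \<omega>)"
      using rv_markov_pow[OF H, of F "m + j"] by (simp add: rv_def)
    also have "\<dots> = P.expectation (\<lambda>\<omega>. rv (\<lambda>s _. F s) 0 \<omega> * rv ?G 0 \<omega> - c * rv (\<lambda>s _. F s) 0 \<omega>)"
      using F by (subst Bochner_Integration.integral_diff[OF i1 i2]) simp
    also have "norm \<dots> \<le> B * (C * mubar ^ j)"
    proof (rule P.norm_integral_le_const)
      show "integrable P (\<lambda>\<omega>. rv (\<lambda>s _. F s) 0 \<omega> * rv ?G 0 \<omega> - c * rv (\<lambda>s _. F s) 0 \<omega>)"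
        by (rule Bochner_Integration.integrable_diff[OF i1 i2])
      fix \<omega> assume \<omega>: "\<omega> \<in> space P"
      have "rv (\<lambda>s _. F s) 0 \<omega> * rv ?G 0 \<omega> - c * rv (\<lambda>s _. F s) 0 \<omega> = rv (\<lambda>s _. F s) 0 \<omega> * ((T ^^ j) (reduced H) (\<omega> (m - 1)) - c)"
        unfolding G[OF \<omega>] by (simp add: algebra_simps)
      then show "norm (rv (\<lambda>s _. F s) 0 \<omega> * rv ?G 0 \<omega> - c * rv (\<lambda>s _. F s) 0 \<omega>) \<le> B * (C * mubar ^ j)"
        using B(1) B(2)[OF \<omega>, of 0] C(2)[of "\<omega> (m - 1)" j] \<omega> by (simp add: abs_mult space_P mult_mono)
    qed
    finally show ?thesis by simp
  qed
  then show ?thesis by (intro exI[of _ "B * C"]) auto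
qed

theorem window_central_limit:
  fixes F :: "real list \<Rightarrow> real"
  defines "X \<equiv> rv (\<lambda>s _. F s)"
  defines "c \<equiv> \<lambda>k. P.expectation (\<lambda>\<omega>. X 0 \<omega> * X k \<omega>)"
  defines "\<sigma>2 \<equiv> c 0 + 2 * (\<Sum>k. c (Suc k))"
  assumes mean0: "P.expectation (X 0) = 0"
  shows "summable (\<lambda>k. \<bar>c (Suc k)\<bar>)"
    and "(\<lambda>n. P.expectation (\<lambda>\<omega>. ((\<Sum>t<n. X t \<omega>) / sqrt n)\<^sup>2)) \<longlonglongrightarrow> \<sigma>2"
    and "\<sigma>2 > 0 \<Longrightarrow> weak_conv_m (\<lambda>n. distr P borel (\<lambda>\<omega>. (\<Sum>t<n. X t \<omega>) / sqrt n)) (density lborel (normal_density 0 (sqrt \<sigma>2)))"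
proof -
  have HM_F: "window_HM (\<lambda>s _. F s)" by (simp add: window_HM_def HM_const)
  have mean0': "P.expectation (rv (\<lambda>s _. F s) 0) = 0" using mean0 by (simp add: X_def)
  have X_meas: "X t \<in> borel_measurable P" for t unfolding X_def by (rule measurable_rv[OF HM_F])
  obtain B where B: "B \<ge> 0" "\<And>t \<omega>. \<omega> \<in> space P \<Longrightarrow> \<bar>X t \<omega>\<bar> \<le> B"
    unfolding X_def using HM_F by (rule bounded_rv) auto
  have cov: "P.expectation (\<lambda>\<omega>. X s \<omega> * X (s + k) \<omega>) = c k" for s k
    unfolding c_def X_def by (rule covariance_rv[OF HM_F HM_F])
  show summable_c: "summable (\<lambda>k. \<bar>c (Suc k)\<bar>)"
  proof -
    obtain C where C: "\<And>j. \<bar>c (m + j)\<bar> \<le> C * mubar ^ j"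
      using covariance_decay[OF mean0' HM_F] unfolding c_def X_def by auto
    have "summable (\<lambda>j. C * mubar ^ j)" using mubar by (intro summable_mult summable_geometric) auto
    then have "summable (\<lambda>j. \<bar>c (j + m)\<bar>)"
      by (rule summable_comparison_test'[of _ 0]) (use C in \<open>simp add: add.commute\<close>)
    then have "summable (\<lambda>j. \<bar>c j\<bar>)" by (subst (asm) summable_iff_shift)
    then show ?thesis by (subst summable_Suc_iff)
  qed
  show variance: "(\<lambda>n. P.expectation (\<lambda>\<omega>. ((\<Sum>t<n. X t \<omega>) / sqrt n)\<^sup>2)) \<longlonglongrightarrow> \<sigma>2"
    unfolding \<sigma>2_def by (rule P.variance_partial_sums[OF X_meas B(2) cov summable_rabs_cancel[OF summable_c]])

  obtain A where A: "window_HM A" "\<And>s \<eta>. length s = m \<Longrightarrow> \<eta> \<in> space OmegaM \<Longrightarrow> A s \<eta> - window_op A s \<eta> = F s"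
    using window_poisson_equation[OF HM_F mean0'] by auto
  have X_eq: "X t \<omega> = rv A t \<omega> - rv (window_op A) t \<omega>" if "\<omega> \<in> space P" for t \<omega>
    using A(2)[of "win t \<omega>" "\<omega> (t + m - 1)"] that by (simp add: X_def rv_def space_P)
  have HM_opA: "window_HM (window_op A)" by (rule window_HM_op[OF A(1)])
  have intXA: "integrable P (\<lambda>\<omega>. X 0 \<omega> * rv A k \<omega>)" "integrable P (\<lambda>\<omega>. X 0 \<omega> * rv (window_op A) k \<omega>)" for k
    unfolding X_def by (intro integrable_rv_mult HM_F A(1) HM_opA)+
  have step: "P.expectation (\<lambda>\<omega>. X 0 \<omega> * rv (window_op A) k \<omega>) = P.expectation (\<lambda>\<omega>. X 0 \<omega> * rv A (Suc k) \<omega>)" for k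
  proof -
    have "X 0 \<omega> = F (take m (drop 0 (hist (k + m - 1) \<omega>)))" for \<omega>
      using m_pos win_hist[of 0 "k + m - 1" \<omega>] by (simp add: X_def rv_def)
    then show ?thesis using rv_markov[OF A(1), of "\<lambda>h. F (take m (drop 0 h))" k] by simp
  qed
  \<comment> \<open>The Poisson equation splits \<open>X k\<close> into \<open>A\<close> minus
    \<open>window_op A\<close>, and paired with \<open>X 0\<close> the second term equals the first
    one a step later. The covariances telescope, so their sum becomes a single expectation
    containing \<open>window_op A\<close>.\<close>
  have c_telescope: "c k = P.expectation (\<lambda>\<omega>. X 0 \<omega> * rv A k \<omega>) - P.expectation (\<lambda>\<omega>. X 0 \<omega> * rv A (Suc k) \<omega>)" for k
  proof -
    have "c k = P.expectation (\<lambda>\<omega>. X 0 \<omega> * rv A k \<omega> - X 0 \<omega> * rv (window_op A) k \<omega>)"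
      unfolding c_def using X_eq[of _ k] by (intro Bochner_Integration.integral_cong) (auto simp: right_diff_distrib)
    then show ?thesis by (simp add: intXA step)
  qed
  have "(\<lambda>k. P.expectation (\<lambda>\<omega>. X 0 \<omega> * rv A k \<omega>)) \<longlonglongrightarrow> 0"
  proof -
    obtain C where C: "\<And>j. \<bar>P.expectation (\<lambda>\<omega>. X 0 \<omega> * rv A (m + j) \<omega>)\<bar> \<le> C * mubar ^ j"
      using covariance_decay[OF mean0' A(1)] unfolding X_def by auto
    have "(\<lambda>j. C * mubar ^ j) \<longlonglongrightarrow> C * 0" using mubar by (intro tendsto_intros LIMSEQ_power_zero) auto
    then have g: "(\<lambda>j. C * mubar ^ j) \<longlonglongrightarrow> 0" by simp
    have "(\<lambda>j. P.expectation (\<lambda>\<omega>. X 0 \<omega> * rv A (m + j) \<omega>)) \<longlonglongrightarrow> 0"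
      by (rule Lim_null_comparison[OF always_eventually g]) (use C in simp)
    then have "(\<lambda>j. P.expectation (\<lambda>\<omega>. X 0 \<omega> * rv A (j + m) \<omega>)) \<longlonglongrightarrow> 0" by (simp only: add.commute)
    then show ?thesis by (rule LIMSEQ_offset)
  qed
  then have "(\<lambda>k. P.expectation (\<lambda>\<omega>. X 0 \<omega> * rv A (Suc k) \<omega>)) \<longlonglongrightarrow> 0" by (rule LIMSEQ_Suc)
  then have "(\<lambda>k. c (Suc k)) sums (P.expectation (\<lambda>\<omega>. X 0 \<omega> * rv A (Suc 0) \<omega>) - 0)"
    unfolding c_telescope[of "Suc _"] by (rule telescope_sums')
  then have suminf_c: "(\<Sum>k. c (Suc k)) = P.expectation (\<lambda>\<omega>. X 0 \<omega> * rv (window_op A) 0 \<omega>)"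
    by (simp add: sums_iff step)

  assume pos: "\<sigma>2 > 0"
  \<comment> \<open>This right-hand side is dictated by the prediction for \<open>b\<close> in
    \<open>clt_from_correctors\<close>, with \<open>window_op A\<close> standing for
    \<open>a - x\<close>. For a fixed window \<open>F s\<close> is a scalar, so closure under sums
    and scalar multiples keeps \<open>G\<close> in H_M. Its mean vanishes by the value just found
    for the sum of covariances.\<close>
  define G where "G s \<eta> = \<sigma>2 / 2 + (- 1 / 2 * (F s)\<^sup>2 + (- F s) * window_op A s \<eta>)" for s \<eta>
  have HM_G: "window_HM G"
    unfolding window_HM_def G_def by (intro allI HM_add HM_cmult HM_const window_HMD[OF HM_opA] M_ge)
  have rv_G: "rv G t \<omega> = \<sigma>2 / 2 - X t \<omega> * X t \<omega> / 2 - X t \<omega> * rv (window_op A) t \<omega>" for t \<omega>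
    by (simp add: rv_def G_def X_def power2_eq_square)
  have intXX: "integrable P (\<lambda>\<omega>. X 0 \<omega> * X 0 \<omega>)"
    unfolding X_def by (intro integrable_rv_mult HM_F)
  have "P.expectation (rv G 0) = \<sigma>2 / 2 - c 0 / 2 - P.expectation (\<lambda>\<omega>. X 0 \<omega> * rv (window_op A) 0 \<omega>)"
    unfolding rv_G[abs_def] using intXX intXA by (simp add: P.prob_space c_def)
  then have "P.expectation (rv G 0) = 0"
    using suminf_c by (simp add: \<sigma>2_def add_divide_distrib)
  then obtain D where D: "window_HM D" "\<And>s \<eta>. length s = m \<Longrightarrow> \<eta> \<in> space OmegaM \<Longrightarrow> D s \<eta> - window_op D s \<eta> = G s \<eta>"
    using window_poisson_equation[OF HM_G] by auto
  obtain BA where BA: "BA \<ge> 0" "\<And>t \<omega>. \<omega> \<in> space P \<Longrightarrow> \<bar>rv A t \<omega>\<bar> \<le> BA" using A(1) by (rule bounded_rv) auto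
  obtain BD where BD: "BD \<ge> 0" "\<And>t \<omega>. \<omega> \<in> space P \<Longrightarrow> \<bar>rv D t \<omega>\<bar> \<le> BD" using D(1) by (rule bounded_rv) auto
  have HM_opD: "window_HM (window_op D)" by (rule window_HM_op[OF D(1)])
  \<comment> \<open>The sum including \<open>X n\<close> is a function of the spins up to time
    \<open>n + m - 1\<close>, exactly the history allowed in \<open>rv_markov\<close>.\<close>
  have increment: "P.expectation (\<lambda>\<omega>. \<phi> (\<Sum>t<Suc n. X t \<omega>) * (rv H (Suc n) \<omega> - rv (window_op H) n \<omega>)) = 0"
    if H: "window_HM H" and \<phi>: "\<phi> \<in> borel_measurable borel" "\<And>x. \<bar>\<phi> x\<bar> \<le> 1" for H \<phi> n
  proof -
    have sum_eq: "(\<Sum>t<Suc n. X t \<omega>) = (\<Sum>t<Suc n. F (take m (drop t (hist (n + m - 1) \<omega>))))" for \<omega>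
      using m_pos by (intro sum.cong) (auto simp: X_def rv_def win_hist[of _ "n + m - 1"])
    have int: "integrable P (\<lambda>\<omega>. \<phi> (\<Sum>t<Suc n. X t \<omega>) * rv H' t \<omega>)" if H': "window_HM H'" for H' t
    proof -
      obtain C where C: "C \<ge> 0" "\<And>t \<omega>. \<omega> \<in> space P \<Longrightarrow> \<bar>rv H' t \<omega>\<bar> \<le> C" using H' by (rule bounded_rv) auto
      show ?thesis
      proof (rule integrable_P[where B="1 * C"])
        show "(\<lambda>\<omega>. \<phi> (\<Sum>t<Suc n. X t \<omega>) * rv H' t \<omega>) \<in> borel_measurable P"
          by (intro borel_measurable_times measurable_rv[OF H'] measurable_compose[OF _ \<phi>(1)] borel_measurable_sum X_meas)
        show "\<bar>\<phi> (\<Sum>t<Suc n. X t \<omega>) * rv H' t \<omega>\<bar> \<le> 1 * C" if "\<omega> \<in> space P" for \<omega>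
          unfolding abs_mult using \<phi>(2) C(2)[OF that] by (intro mult_mono) auto
      qed
    qed
    show ?thesis
      unfolding right_diff_distrib Bochner_Integration.integral_diff[OF int[OF H] int[OF window_HM_op[OF H]]]
      unfolding sum_eq
      using rv_markov[OF H, of "\<lambda>h. \<phi> (\<Sum>t<Suc n. F (take m (drop t h)))" n] by simp
  qed
  have "weak_conv_m (\<lambda>n. distr P borel (\<lambda>\<omega>. (\<Sum>t<n. X t \<omega>) / sqrt n)) (density lborel (normal_density 0 (sqrt \<sigma>2)))"
  proof (rule P.clt_from_correctors[where a="rv A" and b="rv D" and B="max B (max BA BD)"])
    show "rv A t \<in> borel_measurable P" "rv D t \<in> borel_measurable P" for t
      by (rule measurable_rv[OF A(1)], rule measurable_rv[OF D(1)])
    show "\<bar>X t \<omega>\<bar> \<le> max B (max BA BD)" "\<bar>rv A t \<omega>\<bar> \<le> max B (max BA BD)" "\<bar>rv D t \<omega>\<bar> \<le> max B (max BA BD)"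
      if "\<omega> \<in> space P" for t \<omega>
      using B(2)[OF that, of t] BA(2)[OF that, of t] BD(2)[OF that, of t] by linarith+
    fix n and \<phi> :: "real \<Rightarrow> real" assume \<phi>: "\<phi> \<in> borel_measurable borel" "\<And>x. \<bar>\<phi> x\<bar> \<le> 1"
    have "P.expectation (\<lambda>\<omega>. \<phi> (\<Sum>t<Suc n. X t \<omega>) * (rv A (Suc n) \<omega> - (rv A n \<omega> - X n \<omega>)))
        = P.expectation (\<lambda>\<omega>. \<phi> (\<Sum>t<Suc n. X t \<omega>) * (rv A (Suc n) \<omega> - rv (window_op A) n \<omega>))"
      using X_eq[of _ n] by (intro Bochner_Integration.integral_cong) auto
    then show "P.expectation (\<lambda>\<omega>. \<phi> (\<Sum>t<Suc n. X t \<omega>) * (rv A (Suc n) \<omega> - (rv A n \<omega> - X n \<omega>))) = 0"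
      using increment[OF A(1) \<phi>] by simp
    have D_eq: "rv (window_op D) n \<omega> = rv D n \<omega> - (sqrt \<sigma>2)\<^sup>2 / 2 + (X n \<omega>)\<^sup>2 / 2 + X n \<omega> * (rv A n \<omega> - X n \<omega>)"
      if \<omega>: "\<omega> \<in> space P" for \<omega>
    proof -
      have "rv D n \<omega> - rv (window_op D) n \<omega> = rv G n \<omega>"
        using D(2)[of "win n \<omega>" "\<omega> (n + m - 1)"] \<omega> by (simp add: rv_def space_P)
      moreover have "rv (window_op A) n \<omega> = rv A n \<omega> - X n \<omega>" using X_eq[OF \<omega>, of n] by simp
      ultimately have "rv D n \<omega> - rv (window_op D) n \<omega> = \<sigma>2 / 2 - X n \<omega> * X n \<omega> / 2 - X n \<omega> * (rv A n \<omega> - X n \<omega>)"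
        by (simp only: rv_G)
      then show ?thesis using pos by (simp add: power2_eq_square)
    qed
    have "P.expectation (\<lambda>\<omega>. \<phi> (\<Sum>t<Suc n. X t \<omega>) * (rv D (Suc n) \<omega> -
          (rv D n \<omega> - (sqrt \<sigma>2)\<^sup>2 / 2 + (X n \<omega>)\<^sup>2 / 2 + X n \<omega> * (rv A n \<omega> - X n \<omega>))))
        = P.expectation (\<lambda>\<omega>. \<phi> (\<Sum>t<Suc n. X t \<omega>) * (rv D (Suc n) \<omega> - rv (window_op D) n \<omega>))"
      using D_eq by (intro Bochner_Integration.integral_cong) auto
    then show "P.expectation (\<lambda>\<omega>. \<phi> (\<Sum>t<Suc n. X t \<omega>) * (rv D (Suc n) \<omega> -
          (rv D n \<omega> - (sqrt \<sigma>2)\<^sup>2 / 2 + (X n \<omega>)\<^sup>2 / 2 + X n \<omega> * (rv A n \<omega> - X n \<omega>)))) = 0"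
      using increment[OF D(1) \<phi>] by simp
  qed (use pos X_meas in auto)
  then show "weak_conv_m (\<lambda>n. distr P borel (\<lambda>\<omega>. (\<Sum>t<n. X t \<omega>) / sqrt n)) (density lborel (normal_density 0 (sqrt \<sigma>2)))" .
qed

end

section \<open>The environment seen from the walk\<close>

lemma sets_Kern: "sets (Kern eps P0 c Q0 Q1 \<eta>) = sets OmegaM"
  unfolding Kern_def by simp

lemma prob_space_Qmeas:
  assumes "stoch_sym Q" "s = -1 \<or> s = 1"
  shows "prob_space (Qmeas Q s)"
  unfolding Qmeas_def
proof (rule prob_space_point_measure)
  have s: "s \<in> {-1, 1}" using assms(2) by auto
  have "0 \<le> Q s (-1)" "0 \<le> Q s 1" "Q s (-1) + Q s 1 = 1"
    using assms(1) s unfolding stoch_sym_def by blast+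
  then show "(\<Sum>s'\<in>{-1, 1}. ennreal (Q s s')) = 1" by (simp flip: ennreal_plus)
qed simp_all

text \<open>The jump weights are nonnegative because \<open>\<eta> 0\<close> is -1 or 1. They sum to
  1 because \<open>c\<close> is odd, so its total over the support vanishes, and each spin update is
  a product of probability measures.\<close>

lemma prob_space_Kern:
  fixes P0 c :: "int ^ 'd \<Rightarrow> real"
  assumes P0: "finite {u. P0 u \<noteq> 0}" "(\<Sum>u\<in>{u. P0 u \<noteq> 0}. P0 u) = 1"
    and c_odd: "\<And>u. c (- u) = - c u" and c_fin: "finite {u. c u \<noteq> 0}"
    and range: "\<And>u. 0 \<le> P0 u + eps * c u" "\<And>u. 0 \<le> P0 u - eps * c u"
    and Q: "stoch_sym Q0" "stoch_sym Q1"
    and \<eta>: "\<eta> \<in> space OmegaM"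
  shows "prob_space (Kern eps P0 c Q0 Q1 \<eta>)"
proof
  let ?S = "step_support P0 c"
  define w where "w u = P0 u + eps * c u * \<eta> 0" for u
  define N where "N u = PiM UNIV (\<lambda>x. Qmeas (if u + x = 0 then Q1 else Q0) (\<eta> (u + x)))" for u
  let ?\<mu> = "\<lambda>A. \<Sum>u\<in>?S. ennreal (w u) * emeasure (N u) A"
  have S_eq: "?S = {u. P0 u \<noteq> 0} \<union> {u. c u \<noteq> 0}" by (auto simp: step_support_def)
  then have S: "finite ?S" using P0 c_fin by simp
  have \<eta>s: "\<eta> x = -1 \<or> \<eta> x = 1" for x using \<eta> by (simp add: space_OmegaM)
  have w: "w u \<ge> 0" for u using \<eta>s[of 0] range[of u] by (auto simp: w_def)
  have N: "prob_space (N u)" for u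
    unfolding N_def using Q \<eta>s by (intro prob_space_PiM prob_space_Qmeas) auto
  have sets_N: "sets (N u) = sets OmegaM" for u
    unfolding N_def OmegaM_def by (intro sets_PiM_cong) (auto simp: Qmeas_def sets_point_measure)
  \<comment> \<open>\<open>measure_of\<close> returns the given set function only if it is a
    measure, so countable additivity comes before any evaluation of \<open>Kern\<close>.\<close>
  have "countably_additive (sets OmegaM) ?\<mu>"
  proof (rule countably_additiveI)
    fix A :: "nat \<Rightarrow> (int ^ 'd \<Rightarrow> real) set"
    assume A: "range A \<subseteq> sets OmegaM" "disjoint_family A"
    have "(\<Sum>i. ?\<mu> (A i)) = (\<Sum>u\<in>?S. \<Sum>i. ennreal (w u) * emeasure (N u) (A i))"
      by (rule suminf_sum) auto
    also have "\<dots> = ?\<mu> (\<Union>i. A i)"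
      using A by (intro sum.cong) (auto simp: suminf_emeasure sets_N)
    finally show "(\<Sum>i. ?\<mu> (A i)) = ?\<mu> (\<Union>i. A i)" .
  qed
  then have "emeasure (Kern eps P0 c Q0 Q1 \<eta>) (space OmegaM) = ?\<mu> (space OmegaM)"
    unfolding Kern_def w_def[symmetric] N_def[symmetric]
    by (intro emeasure_measure_of_sigma) (auto simp: positive_def sets.sigma_algebra_axioms)
  also have "\<dots> = (\<Sum>u\<in>?S. ennreal (w u))"
    using prob_space.emeasure_space_1[OF N] sets_eq_imp_space_eq[OF sets_N] by simp
  also have "\<dots> = ennreal (\<Sum>u\<in>?S. w u)" using w by (simp add: sum_ennreal)
  also have "(\<Sum>u\<in>?S. w u) = 1"
  proof -
    have "(\<Sum>u\<in>?S. P0 u) = (\<Sum>u\<in>{u. P0 u \<noteq> 0}. P0 u)"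
      using S by (intro sum.mono_neutral_right) (auto simp: S_eq)
    moreover have "(\<Sum>u\<in>?S. c u) = (\<Sum>u\<in>{u. c u \<noteq> 0}. c u)"
      using S by (intro sum.mono_neutral_right) (auto simp: S_eq)
    moreover have "(\<Sum>u\<in>{u. c u \<noteq> 0}. c u) = (\<Sum>u\<in>{u. c u \<noteq> 0}. - c u)"
      by (rule sum.reindex_bij_witness[of _ uminus uminus]) (auto simp: c_odd)
    ultimately have "(\<Sum>u\<in>?S. c u) = 0" unfolding sum_negf by linarith
    moreover have "(\<Sum>u\<in>?S. w u) = (\<Sum>u\<in>?S. P0 u) + eps * \<eta> 0 * (\<Sum>u\<in>?S. c u)"
      unfolding w_def sum.distrib sum_distrib_left by (simp add: ac_simps)
    ultimately show ?thesis using P0(2) \<open>(\<Sum>u\<in>?S. P0 u) = _\<close> by simp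
  qed
  finally show "emeasure (Kern eps P0 c Q0 Q1 \<eta>) (space (Kern eps P0 c Q0 Q1 \<eta>)) = 1"
    using sets_eq_imp_space_eq[OF sets_Kern[of eps P0 c Q0 Q1 \<eta>]] by simp
qed

section \<open>Transfer to the law of the spin sequence\<close>

lemma space_OmegaPlus: "\<zeta> \<in> space OmegaPlus \<longleftrightarrow> (\<forall>t. \<zeta> t = -1 \<or> \<zeta> t = 1)"
  by (auto simp: OmegaPlus_def space_PiM PiE_UNIV_domain)

text \<open>On \<open>OmegaPlus\<close> any \<open>F\<close> is a finite linear combination of
  indicators of spin words of length \<open>m\<close>.\<close>

lemma measurable_window_fun:
  fixes F :: "real list \<Rightarrow> real"
  shows "(\<lambda>\<zeta>. F (map \<zeta> [t..<t + m])) \<in> borel_measurable OmegaPlus"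
proof -
  let ?L = "{h :: real list. set h \<subseteq> {-1, 1} \<and> length h = m}"
  have "F (map \<zeta> [t..<t + m]) = (\<Sum>h\<in>?L. (\<Prod>i<length h. if \<zeta> (t + i) = h ! i then 1 else 0) * F h)"
    if "\<zeta> \<in> space OmegaPlus" for \<zeta>
  proof -
    have map_eq: "map \<zeta> [t..<t + m] = map (\<lambda>i. \<zeta> (t + i)) [0..<m]"
      by (simp add: list_eq_iff_nth_eq)
    have "(\<Sum>h\<in>?L. (\<Prod>i<length h. if \<zeta> (t + i) = h ! i then 1 else 0) * F h)
        = (\<Sum>h\<in>?L. if map \<zeta> [t..<t + m] = h then F h else 0)"
      unfolding prod_spin_indicator[where \<omega>="\<lambda>i. \<zeta> (t + i)"] by (intro sum.cong) (auto simp: map_eq)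
    also have "\<dots> = F (map \<zeta> [t..<t + m])"
      using that finite_spin_lists[of m] by (auto simp: sum.delta space_OmegaPlus)
    finally show ?thesis ..
  qed
  moreover have "(\<lambda>\<zeta>. if \<zeta> i = x then 1 else 0 :: real) \<in> borel_measurable OmegaPlus" for i and x :: real
    unfolding OmegaPlus_def
    by (rule measurable_compose[OF measurable_component_singleton[of i UNIV]]) auto
  ultimately show ?thesis
    by (subst measurable_cong) (auto intro!: borel_measurable_sum borel_measurable_times borel_measurable_prod)
qed

theorem theorem2:
  fixes eps :: real and P0 c :: "int^'d \<Rightarrow> real"
    and Q0 Q1 :: "real \<Rightarrow> real \<Rightarrow> real" and \<mu> :: real
    and M mubar :: real
    and PiInv :: "(int^'d \<Rightarrow> real) measure"
    and P :: "(nat \<Rightarrow> int^'d \<Rightarrow> real) measure"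
    and f :: "(nat \<Rightarrow> real) \<Rightarrow> real" and m :: nat
  defines "T \<equiv> Top eps P0 c Q0 Q1"
  assumes eps_pos: "eps > 0"
    and P0_prob: "\<forall>u. P0 u \<ge> 0" "finite {u. P0 u \<noteq> 0}" "(\<Sum>u\<in>{u. P0 u \<noteq> 0}. P0 u) = 1"
    and P0_even: "\<forall>u. P0 (- u) = P0 u"
    and P0_aperiodic: "\<forall>lam::real^'d. (\<forall>j. - pi < lam$j \<and> lam$j \<le> pi) \<longrightarrow>
                          (cmod (ptilde0 P0 lam) = 1 \<longleftrightarrow> lam = 0)"
    and P0_inv: "\<exists>a :: int^'d \<Rightarrow> complex. (\<lambda>z. norm (a z)) summable_on UNIV \<and>
                   (\<forall>lam. ptilde0 P0 lam * (\<Sum>\<^sub>\<infinity>z. a z * cis (inner_zd lam z)) = 1)"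
    and c_odd: "\<forall>u. c (- u) = - c u"
    and c_fin: "finite {u. c u \<noteq> 0}"
    and Pc_range: "\<forall>u. 0 \<le> P0 u + eps * c u \<and> P0 u + eps * c u < 1
                      \<and> 0 \<le> P0 u - eps * c u \<and> P0 u - eps * c u < 1"
    and Q0_stoch: "stoch_sym Q0" and Q1_stoch: "stoch_sym Q1"
    and Q0_eig: "has_eigenvalue2 Q0 \<mu>" "0 < \<bar>\<mu>\<bar>" "\<bar>\<mu>\<bar> < 1"
    and M_gt: "M > 1"
    and T_HM: "\<forall>g. HM M g \<longrightarrow> HM M (T g)"
    and Pi_prob: "prob_space PiInv" "sets PiInv = sets OmegaM"
    and Pi_inv: "\<forall>A\<in>sets OmegaM. (\<integral>\<eta>. measure (Kern eps P0 c Q0 Q1 \<eta>) A \<partial>PiInv) = measure PiInv A"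
    and Pi_dens: "\<exists>\<rho>. \<rho> \<in> borel_measurable OmegaM \<and> (\<exists>B. \<forall>\<eta>. 0 \<le> \<rho> \<eta> \<and> \<rho> \<eta> \<le> B)
                      \<and> PiInv = density Pi0 (\<lambda>\<eta>. ennreal (\<rho> \<eta>))"
    and mubar: "0 < mubar" "mubar < 1"
    and gap: "\<forall>g. HM M g \<and> (\<integral>\<eta>. g \<eta> \<partial>PiInv) = 0 \<longrightarrow> normM M (T g) \<le> mubar * normM M g"
    and mustar: "M * sqrt (mubar * (1 + 2 * mubar)) < 1"
    and P_law: "is_chain_law P T PiInv"
    and m_pos: "m \<ge> 1"
    and f_local: "\<forall>\<zeta>\<in>space OmegaPlus. \<forall>\<zeta>'\<in>space OmegaPlus.
                    (\<forall>t<m. \<zeta> t = \<zeta>' t) \<longrightarrow> f \<zeta> = f \<zeta>'"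
    and f_mean: "(\<integral>\<zeta>. f \<zeta> \<partial>zeta_law P) = 0"
  shows "summable (\<lambda>t. \<bar>\<integral>\<zeta>. f \<zeta> * f (shiftn (Suc t) \<zeta>) \<partial>zeta_law P\<bar>)
    \<and> sigma2 (zeta_law P) f \<ge> 0
    \<and> (\<lambda>n. \<integral>\<zeta>. (Ssum f n \<zeta> / sqrt n - (\<integral>\<zeta>'. Ssum f n \<zeta>' / sqrt n \<partial>zeta_law P))\<^sup>2 \<partial>zeta_law P)
        \<longlonglongrightarrow> sigma2 (zeta_law P) f
    \<and> (sigma2 (zeta_law P) f > 0 \<longrightarrow>
        weak_conv_m (\<lambda>n. distr (zeta_law P) borel (\<lambda>\<zeta>. Ssum f n \<zeta> / sqrt n))
                    (density lborel (normal_density 0 (sqrt (sigma2 (zeta_law P) f)))))"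
proof -
  define K where "K = Kern eps P0 c Q0 Q1"
  have "spectral_gap_kernel K PiInv M mubar T"
  proof (rule spectral_gap_kernel.intro)
    show "T g \<eta> = (\<integral>\<eta>'. g \<eta>' \<partial>K \<eta>)" for g \<eta> by (simp add: T_def K_def Top_def)
    show "prob_space (K \<eta>)" if "\<eta> \<in> space OmegaM" for \<eta>
      unfolding K_def
    proof (rule prob_space_Kern[OF P0_prob(2,3) _ c_fin _ _ Q0_stoch Q1_stoch that])
      show "c (- u) = - c u" for u using c_odd by blast
      show "0 \<le> P0 u + eps * c u" "0 \<le> P0 u - eps * c u" for u using Pc_range by blast+
    qed
    show "sets (K \<eta>) = sets OmegaM" for \<eta> unfolding K_def by (rule sets_Kern)
    show "HM M (T g)" if "HM M g" for g using T_HM that by blast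
    show "normM M (T g) \<le> mubar * normM M g" if "HM M g" "(\<integral>\<eta>. g \<eta> \<partial>PiInv) = 0" for g
      using gap that by blast
    show "(\<integral>\<eta>. measure (K \<eta>) A \<partial>PiInv) = measure PiInv A" if "A \<in> sets OmegaM" for A
      unfolding K_def using Pi_inv that by blast
  qed (use Pi_prob M_gt mubar in auto)
  then interpret C: spectral_gap_chain K PiInv M mubar T P m
    by (intro spectral_gap_chain.intro spectral_gap_chain_axioms.intro P_law m_pos)

  define W where "W = zeta_law P"
  define zeta where "zeta \<omega> t = \<omega> t 0" for \<omega> :: "nat \<Rightarrow> int^'d \<Rightarrow> real" and t :: nat
  have meas_zeta: "zeta \<in> P \<rightarrow>\<^sub>M OmegaPlus"
    unfolding zeta_def[abs_def] OmegaPlus_def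
    by (intro measurable_PiM_single' measurable_compose[OF C.measurable_coordinate measurable_spin_count_space])
      (force simp: C.space_P space_OmegaM)+
  have W: "W = distr P OmegaPlus zeta" by (simp add: W_def zeta_law_def zeta_def[abs_def])
  have zeta_space: "zeta \<omega> \<in> space OmegaPlus" if "\<omega> \<in> space P" for \<omega>
    using measurable_space[OF meas_zeta that] .

  \<comment> \<open>Only the first \<open>m\<close> entries matter to \<open>f\<close>. The padding
    value 1 is a spin, which keeps the padded sequence in \<open>OmegaPlus\<close>, where
    \<open>f_local\<close> applies.\<close>
  define F where "F s = f (\<lambda>i. if i < length s then s ! i else 1)" for s
  have f_window: "f (shiftn t \<zeta>) = F (map \<zeta> [t..<t + m])" if "\<zeta> \<in> space OmegaPlus" for t \<zeta>
  proof -
    let ?e = "\<lambda>i. if i < length (map \<zeta> [t..<t + m]) then map \<zeta> [t..<t + m] ! i else 1"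
    have space: "shiftn t \<zeta> \<in> space OmegaPlus" "?e \<in> space OmegaPlus"
      using that by (auto simp: space_OmegaPlus shiftn_def)
    have "shiftn t \<zeta> i = ?e i" if "i < m" for i using that by (simp add: shiftn_def add.commute)
    then show ?thesis unfolding F_def by (rule f_local[rule_format, OF space])
  qed
  define X where "X = C.rv (\<lambda>s _. F s)"
  have X: "f (shiftn t (zeta \<omega>)) = X t \<omega>" if "\<omega> \<in> space P" for t \<omega>
    using f_window[OF zeta_space[OF that]] by (simp add: X_def C.rv_def C.win_def zeta_def[abs_def])
  have f_shift0: "f \<zeta> = f (shiftn 0 \<zeta>)" for \<zeta> by (simp add: shiftn_def)
  \<comment> \<open>Measurability of \<open>f\<close> on \<open>OmegaPlus\<close> is deduced from
    locality: there it is a function of one finite spin word.\<close>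
  have meas_f: "(\<lambda>\<zeta>. f (shiftn t \<zeta>)) \<in> borel_measurable OmegaPlus" for t
    using measurable_window_fun by (subst measurable_cong[OF f_window]) auto
  have meas_Ssum: "Ssum f n \<in> borel_measurable OmegaPlus" for n
    unfolding Ssum_def[abs_def] by (intro borel_measurable_sum meas_f)
  have Ssum_X: "Ssum f n (zeta \<omega>) = (\<Sum>t<n. X t \<omega>)" if "\<omega> \<in> space P" for n \<omega>
    unfolding Ssum_def using X[OF that] by simp
  have integral_W: "(\<integral>\<zeta>. H \<zeta> \<partial>W) = (\<integral>\<omega>. H (zeta \<omega>) \<partial>P)" if "H \<in> borel_measurable OmegaPlus" for H :: "(nat \<Rightarrow> real) \<Rightarrow> real"
    unfolding W by (rule integral_distr[OF meas_zeta that])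

  have HM_F: "C.window_HM (\<lambda>s _. F s)" by (simp add: C.window_HM_def HM_const)
  define c where "c k = (\<integral>\<omega>. X 0 \<omega> * X k \<omega> \<partial>P)" for k
  have cov: "(\<integral>\<zeta>. f \<zeta> * f (shiftn k \<zeta>) \<partial>W) = c k" for k
  proof -
    have "(\<integral>\<zeta>. f (shiftn 0 \<zeta>) * f (shiftn k \<zeta>) \<partial>W) = (\<integral>\<omega>. f (shiftn 0 (zeta \<omega>)) * f (shiftn k (zeta \<omega>)) \<partial>P)"
      by (intro integral_W borel_measurable_times meas_f)
    also have "\<dots> = c k" unfolding c_def by (intro Bochner_Integration.integral_cong) (simp_all only: X)
    finally show ?thesis by (simp only: f_shift0[symmetric])
  qed
  have mean: "(\<integral>\<omega>. X 0 \<omega> \<partial>P) = 0"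
  proof -
    have "(\<integral>\<omega>. X 0 \<omega> \<partial>P) = (\<integral>\<omega>. f (shiftn 0 (zeta \<omega>)) \<partial>P)"
      by (intro Bochner_Integration.integral_cong) (simp_all only: X)
    also have "\<dots> = (\<integral>\<zeta>. f (shiftn 0 \<zeta>) \<partial>W)" by (rule integral_W[OF meas_f, symmetric])
    also have "\<dots> = 0" using f_mean by (simp only: f_shift0[symmetric] W_def)
    finally show ?thesis .
  qed
  have sigma2_eq: "sigma2 W f = c 0 + 2 * (\<Sum>k. c (Suc k))"
    unfolding sigma2_def cov using cov[of 0] by (simp add: power2_eq_square f_shift0[symmetric])
  note clt = C.window_central_limit[of F, folded X_def, folded c_def, OF mean, folded sigma2_eq]
  have mean_S: "(\<integral>\<zeta>. Ssum f n \<zeta> / sqrt n \<partial>W) = 0" for n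
  proof -
    have "(\<integral>\<zeta>. Ssum f n \<zeta> / sqrt n \<partial>W) = (\<integral>\<omega>. Ssum f n (zeta \<omega>) / sqrt n \<partial>P)"
      using meas_Ssum[of n] by (intro integral_W) simp
    also have "\<dots> = (\<integral>\<omega>. (\<Sum>t<n. X t \<omega>) / sqrt n \<partial>P)"
      by (intro Bochner_Integration.integral_cong) (simp_all only: Ssum_X)
    also have "\<dots> = (\<Sum>t<n. (\<integral>\<omega>. X t \<omega> \<partial>P)) / sqrt n"
      unfolding X_def using C.integrable_rv[OF HM_F] by (simp add: Bochner_Integration.integral_sum)
    also have "\<dots> = 0"
      using C.expectation_rv[OF HM_F] mean by (simp add: X_def)
    finally show ?thesis .
  qed
  have var_S: "(\<integral>\<zeta>. (Ssum f n \<zeta> / sqrt n - (\<integral>\<zeta>'. Ssum f n \<zeta>' / sqrt n \<partial>W))\<^sup>2 \<partial>W) = (\<integral>\<omega>. ((\<Sum>t<n. X t \<omega>) / sqrt n)\<^sup>2 \<partial>P)" for n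
  proof -
    have "(\<integral>\<zeta>. (Ssum f n \<zeta> / sqrt n - (\<integral>\<zeta>'. Ssum f n \<zeta>' / sqrt n \<partial>W))\<^sup>2 \<partial>W) = (\<integral>\<zeta>. (Ssum f n \<zeta> / sqrt n)\<^sup>2 \<partial>W)"
      by (simp only: mean_S diff_0_right)
    also have "\<dots> = (\<integral>\<omega>. (Ssum f n (zeta \<omega>) / sqrt n)\<^sup>2 \<partial>P)"
      using meas_Ssum[of n] by (intro integral_W) simp
    also have "\<dots> = (\<integral>\<omega>. ((\<Sum>t<n. X t \<omega>) / sqrt n)\<^sup>2 \<partial>P)"
      by (intro Bochner_Integration.integral_cong) (simp_all only: Ssum_X)
    finally show ?thesis .
  qed
  have distr_S: "distr W borel (\<lambda>\<zeta>. Ssum f n \<zeta> / sqrt n) = distr P borel (\<lambda>\<omega>. (\<Sum>t<n. X t \<omega>) / sqrt n)" for n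
  proof -
    have "distr W borel (\<lambda>\<zeta>. Ssum f n \<zeta> / sqrt n) = distr P borel ((\<lambda>\<zeta>. Ssum f n \<zeta> / sqrt n) \<circ> zeta)"
      unfolding W using meas_Ssum[of n] by (intro distr_distr meas_zeta) simp
    also have "\<dots> = distr P borel (\<lambda>\<omega>. (\<Sum>t<n. X t \<omega>) / sqrt n)"
      by (intro distr_cong) (simp_all add: Ssum_X)
    finally show ?thesis .
  qed
  \<comment> \<open>As a limit of normalized second moments, \<sigma>^2 inherits their sign.\<close>
  have "sigma2 W f \<ge> 0"
    by (rule LIMSEQ_le_const[OF clt(2)]) (auto intro!: exI[of _ 0] integral_nonneg_AE)
  then show ?thesis
    unfolding W_def[symmetric] cov var_S distr_S using clt by (intro conjI impI)
qed

end
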